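(* Let $\Lambda$ be an Artin algebra and $\mathcal X$ a resolving and contravariantly finite subcategory of $\mathrm{mod}\text{-}\Lambda$. Consider $\mathcal S_{\mathcal X}(\Lambda)$ as an exact category with the exact structure $\mathcal E_{\mathcal X}$. (1) A monomorphism $(A\xrightarrow{f}B)$ in $\mathcal S_{\mathcal X}(\Lambda)$ is an indecomposable projective object of the exact category $\mathcal S_{\mathcal X}(\Lambda)$ if and only if it is isomorphic to either $(P\xrightarrow{1}P)$ or $(0\to P)$ with $P$ an indecomposable projective module in $\mathrm{mod}\text{-}\Lambda$. (2) Assume that the exact category $\mathcal X$ has enough injectives. A monomorphism $(A\xrightarrow{f}B)$ in $\mathcal S_{\mathcal X}(\Lambda)$ is an indecomposable injective object of the exact category $\mathcal S_{\mathcal X}(\Lambda)$ if and only if it is isomorphic to either $(I\xrightarrow{1}I)$ or $(0\to I)$ with $I$ an indecomposable injective object of the exact category $\mathcal X$. Moreover, the exact category $\mathcal S_{\mathcal X}(\Lambda)$ has enough projectives, and if $\mathcal X$ has enough injectives then so does $\mathcal S_{\mathcal X}(\Lambda)$.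
   Context: $\Lambda$ is an Artin algebra over a commutative artinian ring; $\mathrm{mod}\text{-}\Lambda$ is the category of finitely generated right $\Lambda$-modules and $\mathrm{prj}\text{-}\Lambda$ its subcategory of projectives. Subcategories are full and closed under isomorphism. $\mathcal X$ is resolving if it contains $\mathrm{prj}\text{-}\Lambda$ and is closed under finite direct sums, direct summands, extensions and kernels of epimorphisms; it is contravariantly finite if every module $M$ admits a morphism $f:X\to M$ with $X\in\mathcal X$ through which every morphism from an object of $\mathcal X$ to $M$ factors. $\mathcal X$ is an exact category via all short exact sequences of $\mathrm{mod}\text{-}\Lambda$ with terms in $\mathcal X$. $\mathrm H(\Lambda)$ is the (abelian) morphism category of $\mathrm{mod}\text{-}\Lambda$: objects are morphisms $(A\xrightarrow{f}B)$, morphisms are commutative squares. $\mathcal S_{\mathcal X}(\Lambda)$ is the full subcategory of $\mathrm H(\Lambda)$ of all monomorphisms $(A\xrightarrow{f}B)$ with $A,B,\mathrm{Cok}\,f\in\mathcal X$. $\mathcal E_{\mathcal X}$ is the class of all short exact sequences of $\mathrm H(\Lambda)$ with terms in $\mathcal S_{\mathcal X}(\Lambda)$. Projective and injective objects of an exact category, and having enough of them, are understood relative to admissible epimorphisms and admissible monomorphisms of that exact structure. *)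

theory Defs
  imports "HOL-Algebra.Algebra"
begin

section \<open>Categories with a preadditive structure\<close>

text \<open>
  Composition is written in the usual order and carries the three objects involved:
  \<open>Comp C A B D g f\<close> is the composite of \<open>f\<close> from \<open>A\<close> to \<open>B\<close> and \<open>g\<close> from \<open>B\<close> to \<open>D\<close>.
  \<open>Plus C A B\<close> and \<open>Zero C A B\<close> are the addition and the zero morphism of \<open>Hom C A B\<close>.
\<close>

record ('o, 'h) cat =
  Obj :: "'o set"
  Hom :: "'o \<Rightarrow> 'o \<Rightarrow> 'h set"
  Id :: "'o \<Rightarrow> 'h"
  Comp :: "'o \<Rightarrow> 'o \<Rightarrow> 'o \<Rightarrow> 'h \<Rightarrow> 'h \<Rightarrow> 'h"
  Plus :: "'o \<Rightarrow> 'o \<Rightarrow> 'h \<Rightarrow> 'h \<Rightarrow> 'h"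
  Zero :: "'o \<Rightarrow> 'o \<Rightarrow> 'h"

definition isomorphic :: "('o, 'h, 'z) cat_scheme \<Rightarrow> 'o \<Rightarrow> 'o \<Rightarrow> bool" where
  "isomorphic C A B \<longleftrightarrow> A \<in> Obj C \<and> B \<in> Obj C \<and>
     (\<exists>f\<in>Hom C A B. \<exists>g\<in>Hom C B A.
        Comp C A B A g f = Id C A \<and> Comp C B A B f g = Id C B)"

definition zero_object :: "('o, 'h, 'z) cat_scheme \<Rightarrow> 'o \<Rightarrow> bool" where
  "zero_object C Z \<longleftrightarrow> Z \<in> Obj C \<and>
     (\<forall>A\<in>Obj C. (\<exists>!f. f \<in> Hom C Z A) \<and> (\<exists>!f. f \<in> Hom C A Z))"

definition monomorphism :: "('o, 'h, 'z) cat_scheme \<Rightarrow> 'o \<Rightarrow> 'o \<Rightarrow> 'h \<Rightarrow> bool" where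
  "monomorphism C A B f \<longleftrightarrow> f \<in> Hom C A B \<and>
     (\<forall>T\<in>Obj C. \<forall>u\<in>Hom C T A. \<forall>v\<in>Hom C T A.
        Comp C T A B f u = Comp C T A B f v \<longrightarrow> u = v)"

definition epimorphism :: "('o, 'h, 'z) cat_scheme \<Rightarrow> 'o \<Rightarrow> 'o \<Rightarrow> 'h \<Rightarrow> bool" where
  "epimorphism C A B f \<longleftrightarrow> f \<in> Hom C A B \<and>
     (\<forall>T\<in>Obj C. \<forall>u\<in>Hom C B T. \<forall>v\<in>Hom C B T.
        Comp C A B T u f = Comp C A B T v f \<longrightarrow> u = v)"

definition is_kernel :: "('o, 'h, 'z) cat_scheme \<Rightarrow> 'o \<Rightarrow> 'h \<Rightarrow> 'o \<Rightarrow> 'h \<Rightarrow> 'o \<Rightarrow> bool" where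
  "is_kernel C K i A f B \<longleftrightarrow> i \<in> Hom C K A \<and> Comp C K A B f i = Zero C K B \<and>
     (\<forall>T\<in>Obj C. \<forall>t\<in>Hom C T A. Comp C T A B f t = Zero C T B \<longrightarrow>
        (\<exists>!u. u \<in> Hom C T K \<and> Comp C T K A i u = t))"

definition is_cokernel :: "('o, 'h, 'z) cat_scheme \<Rightarrow> 'o \<Rightarrow> 'h \<Rightarrow> 'o \<Rightarrow> 'h \<Rightarrow> 'o \<Rightarrow> bool" where
  "is_cokernel C A f B p Q \<longleftrightarrow> p \<in> Hom C B Q \<and> Comp C A B Q p f = Zero C A Q \<and>
     (\<forall>T\<in>Obj C. \<forall>t\<in>Hom C B T. Comp C A B T t f = Zero C A T \<longrightarrow>
        (\<exists>!u. u \<in> Hom C Q T \<and> Comp C B Q T u p = t))"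

definition direct_sum :: "('o, 'h, 'z) cat_scheme \<Rightarrow> 'o \<Rightarrow> 'o \<Rightarrow> 'o \<Rightarrow> bool" where
  "direct_sum C S A B \<longleftrightarrow> S \<in> Obj C \<and> A \<in> Obj C \<and> B \<in> Obj C \<and>
     (\<exists>i\<in>Hom C A S. \<exists>j\<in>Hom C B S. \<exists>p\<in>Hom C S A. \<exists>q\<in>Hom C S B.
        Comp C A S A p i = Id C A \<and> Comp C B S B q j = Id C B \<and>
        Comp C B S A p j = Zero C B A \<and> Comp C A S B q i = Zero C A B \<and>
        Plus C S S (Comp C S A S i p) (Comp C S B S j q) = Id C S)"

definition indecomposable :: "('o, 'h, 'z) cat_scheme \<Rightarrow> 'o \<Rightarrow> bool" where
  "indecomposable C S \<longleftrightarrow> S \<in> Obj C \<and> \<not> zero_object C S \<and>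
     (\<forall>A B. direct_sum C S A B \<longrightarrow> zero_object C A \<or> zero_object C B)"

definition projective_object :: "('o, 'h, 'z) cat_scheme \<Rightarrow> 'o \<Rightarrow> bool" where
  "projective_object C P \<longleftrightarrow> P \<in> Obj C \<and>
     (\<forall>A\<in>Obj C. \<forall>B\<in>Obj C. \<forall>p f. epimorphism C A B p \<and> f \<in> Hom C P B \<longrightarrow>
        (\<exists>g\<in>Hom C P A. Comp C P A B p g = f))"

text \<open>
  In an abelian category the sequence \<open>0 \<rightarrow> A \<rightarrow> B \<rightarrow> D \<rightarrow> 0\<close> is exact iff its
  two maps form a kernel-cokernel pair.
\<close>

definition short_exact :: "('o, 'h, 'z) cat_scheme \<Rightarrow> 'o \<times> 'h \<times> 'o \<times> 'h \<times> 'o \<Rightarrow> bool" where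
  "short_exact C = (\<lambda>(A, i, B, p, D). A \<in> Obj C \<and> B \<in> Obj C \<and> D \<in> Obj C \<and>
     is_kernel C A i B p D \<and> is_cokernel C A i B p D)"

section \<open>Exact categories\<close>

record ('o, 'h) exact_cat = "('o, 'h) cat" +
  Conflations :: "('o \<times> 'h \<times> 'o \<times> 'h \<times> 'o) set"

definition admissible_mono :: "('o, 'h, 'z) exact_cat_scheme \<Rightarrow> 'o \<Rightarrow> 'o \<Rightarrow> 'h \<Rightarrow> bool" where
  "admissible_mono E A B i \<longleftrightarrow> (\<exists>p D. (A, i, B, p, D) \<in> Conflations E)"

definition admissible_epi :: "('o, 'h, 'z) exact_cat_scheme \<Rightarrow> 'o \<Rightarrow> 'o \<Rightarrow> 'h \<Rightarrow> bool" where
  "admissible_epi E B D p \<longleftrightarrow> (\<exists>A i. (A, i, B, p, D) \<in> Conflations E)"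

definition exact_projective :: "('o, 'h, 'z) exact_cat_scheme \<Rightarrow> 'o \<Rightarrow> bool" where
  "exact_projective E P \<longleftrightarrow> P \<in> Obj E \<and>
     (\<forall>B D p f. admissible_epi E B D p \<and> f \<in> Hom E P D \<longrightarrow>
        (\<exists>g\<in>Hom E P B. Comp E P B D p g = f))"

definition exact_injective :: "('o, 'h, 'z) exact_cat_scheme \<Rightarrow> 'o \<Rightarrow> bool" where
  "exact_injective E I \<longleftrightarrow> I \<in> Obj E \<and>
     (\<forall>A B i f. admissible_mono E A B i \<and> f \<in> Hom E A I \<longrightarrow>
        (\<exists>g\<in>Hom E B I. Comp E A B I g i = f))"

definition enough_projectives :: "('o, 'h, 'z) exact_cat_scheme \<Rightarrow> bool" where
  "enough_projectives E \<longleftrightarrow>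
     (\<forall>A\<in>Obj E. \<exists>P p. exact_projective E P \<and> admissible_epi E P A p)"

definition enough_injectives :: "('o, 'h, 'z) exact_cat_scheme \<Rightarrow> bool" where
  "enough_injectives E \<longleftrightarrow>
     (\<forall>A\<in>Obj E. \<exists>I i. exact_injective E I \<and> admissible_mono E A I i)"

text \<open>
  The full subcategory of an abelian category \<open>C\<close> on the class \<open>XX\<close> of objects, whose
  conflations are all short exact sequences of \<open>C\<close> (not merely those computed inside the
  subcategory) with terms in \<open>XX\<close>.
\<close>

definition exact_subcat :: "('o, 'h) cat \<Rightarrow> 'o set \<Rightarrow> ('o, 'h) exact_cat" where
  "exact_subcat C XX =
     \<lparr>Obj = XX, Hom = Hom C, Id = Id C, Comp = Comp C, Plus = Plus C, Zero = Zero C,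
      Conflations = {(A, i, B, p, D). short_exact C (A, i, B, p, D) \<and> A \<in> XX \<and> B \<in> XX \<and> D \<in> XX}\<rparr>"

section \<open>Subcategories of an abelian category\<close>

text \<open>Full subcategories closed under isomorphism are identified with their classes of objects.\<close>

definition subcategory :: "('o, 'h) cat \<Rightarrow> 'o set \<Rightarrow> bool" where
  "subcategory C XX \<longleftrightarrow> XX \<subseteq> Obj C \<and> (\<forall>A B. A \<in> XX \<and> isomorphic C A B \<longrightarrow> B \<in> XX)"

text \<open>The empty direct sum is a projective object, so binary sums suffice below.\<close>

definition resolving :: "('o, 'h) cat \<Rightarrow> 'o set \<Rightarrow> bool" where
  "resolving C XX \<longleftrightarrow> subcategory C XX \<and>
     {P. projective_object C P} \<subseteq> XX \<and>
     (\<forall>S A B. direct_sum C S A B \<and> A \<in> XX \<and> B \<in> XX \<longrightarrow> S \<in> XX) \<and>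
     (\<forall>S A B. direct_sum C S A B \<and> S \<in> XX \<longrightarrow> A \<in> XX \<and> B \<in> XX) \<and>
     (\<forall>A i B p D. short_exact C (A, i, B, p, D) \<and> A \<in> XX \<and> D \<in> XX \<longrightarrow> B \<in> XX) \<and>
     (\<forall>K i A B p. A \<in> XX \<and> B \<in> XX \<and> epimorphism C A B p \<and> K \<in> Obj C \<and> is_kernel C K i A p B
        \<longrightarrow> K \<in> XX)"

definition contravariantly_finite :: "('o, 'h) cat \<Rightarrow> 'o set \<Rightarrow> bool" where
  "contravariantly_finite C XX \<longleftrightarrow>
     (\<forall>M\<in>Obj C. \<exists>A\<in>XX. \<exists>f\<in>Hom C A M.
        \<forall>B\<in>XX. \<forall>g\<in>Hom C B M. \<exists>h\<in>Hom C B A. Comp C B A M f h = g)"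

section \<open>The morphism category and the monomorphism category\<close>

text \<open>
  An object \<open>(A, f, B)\<close> stands for the morphism \<open>f\<close> from \<open>A\<close> to \<open>B\<close>; a morphism is a pair
  of vertical maps making the square commute.
\<close>

definition morphism_cat :: "('o, 'h) cat \<Rightarrow> ('o \<times> 'h \<times> 'o, 'h \<times> 'h) cat" where
  "morphism_cat C =
     \<lparr>Obj = {(A, f, B). A \<in> Obj C \<and> B \<in> Obj C \<and> f \<in> Hom C A B},
      Hom = (\<lambda>(A, f, B) (A', f', B').
        {(a, b). a \<in> Hom C A A' \<and> b \<in> Hom C B B' \<and> Comp C A A' B' f' a = Comp C A B B' b f}),
      Id = (\<lambda>(A, f, B). (Id C A, Id C B)),
      Comp = (\<lambda>(A, f, B) (A', f', B') (A'', f'', B'') (a', b') (a, b).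
        (Comp C A A' A'' a' a, Comp C B B' B'' b' b)),
      Plus = (\<lambda>(A, f, B) (A', f', B') (a, b) (c, d). (Plus C A A' a c, Plus C B B' b d)),
      Zero = (\<lambda>(A, f, B) (A', f', B'). (Zero C A A', Zero C B B'))\<rparr>"

definition mono_objects :: "('o, 'h) cat \<Rightarrow> 'o set \<Rightarrow> ('o \<times> 'h \<times> 'o) set" where
  "mono_objects C XX =
     {(A, f, B). A \<in> XX \<and> B \<in> XX \<and> monomorphism C A B f \<and> (\<exists>Q\<in>XX. \<exists>p. is_cokernel C A f B p Q)}"

definition mono_cat :: "('o, 'h) cat \<Rightarrow> 'o set \<Rightarrow> ('o \<times> 'h \<times> 'o, 'h \<times> 'h) exact_cat" where
  "mono_cat C XX = exact_subcat (morphism_cat C) (mono_objects C XX)"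

section \<open>Artin algebras and their module categories\<close>

definition artinian_ring :: "('r, 's) ring_scheme \<Rightarrow> bool" where
  "artinian_ring R \<longleftrightarrow> ring R \<and>
     (\<forall>I :: nat \<Rightarrow> 'r set. (\<forall>n. ideal (I n) R \<and> I (Suc n) \<subseteq> I n) \<longrightarrow>
        (\<exists>n. \<forall>m\<ge>n. I m = I n))"

text \<open>
  The algebra structure is a ring homomorphism \<open>\<phi>\<close> with central image. (The locale
  \<^locale>\<open>algebra\<close> only covers commutative algebras. For commutative rings,
  the ideals in \<^const>\<open>artinian_ring\<close> are the one-sided ideals as well.)
\<close>

definition artin_algebra ::
    "('r, 's) ring_scheme \<Rightarrow> ('r \<Rightarrow> 'a) \<Rightarrow> ('a, 't) ring_scheme \<Rightarrow> bool" where
  "artin_algebra R \<phi> \<Lambda> \<longleftrightarrow> cring R \<and> artinian_ring R \<and> ring \<Lambda> \<and> \<phi> \<in> ring_hom R \<Lambda> \<and>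
     (\<forall>r\<in>carrier R. \<forall>a\<in>carrier \<Lambda>. \<phi> r \<otimes>\<^bsub>\<Lambda>\<^esub> a = a \<otimes>\<^bsub>\<Lambda>\<^esub> \<phi> r) \<and>
     (\<exists>G\<subseteq>carrier \<Lambda>. finite G \<and>
        (\<forall>a\<in>carrier \<Lambda>. \<exists>c\<in>G \<rightarrow> carrier R. a = (\<Oplus>\<^bsub>\<Lambda>\<^esub>g\<in>G. \<phi> (c g) \<otimes>\<^bsub>\<Lambda>\<^esub> g)))"

text \<open>
  Right modules reuse the record of \<^locale>\<open>module\<close>: \<open>a \<odot>\<^bsub>M\<^esub> x\<close> stands for the right action
  of \<open>a\<close> on \<open>x\<close>, usually written \<open>x a\<close>, whence the order of the factors in \<open>ract_assoc\<close>.
\<close>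

locale right_module = R?: ring R + M?: abelian_group M
  for R :: "('a, 't) ring_scheme" (structure) and M :: "('a, 'b, 'z) module_scheme" (structure) +
  assumes ract_closed: "\<lbrakk>a \<in> carrier R; x \<in> carrier M\<rbrakk> \<Longrightarrow> a \<odot>\<^bsub>M\<^esub> x \<in> carrier M"
    and ract_l_distr: "\<lbrakk>a \<in> carrier R; b \<in> carrier R; x \<in> carrier M\<rbrakk> \<Longrightarrow>
      (a \<oplus>\<^bsub>R\<^esub> b) \<odot>\<^bsub>M\<^esub> x = a \<odot>\<^bsub>M\<^esub> x \<oplus>\<^bsub>M\<^esub> b \<odot>\<^bsub>M\<^esub> x"
    and ract_r_distr: "\<lbrakk>a \<in> carrier R; x \<in> carrier M; y \<in> carrier M\<rbrakk> \<Longrightarrow>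
      a \<odot>\<^bsub>M\<^esub> (x \<oplus>\<^bsub>M\<^esub> y) = a \<odot>\<^bsub>M\<^esub> x \<oplus>\<^bsub>M\<^esub> a \<odot>\<^bsub>M\<^esub> y"
    and ract_assoc: "\<lbrakk>a \<in> carrier R; b \<in> carrier R; x \<in> carrier M\<rbrakk> \<Longrightarrow>
      (a \<otimes>\<^bsub>R\<^esub> b) \<odot>\<^bsub>M\<^esub> x = b \<odot>\<^bsub>M\<^esub> (a \<odot>\<^bsub>M\<^esub> x)"
    and ract_one: "x \<in> carrier M \<Longrightarrow> \<one>\<^bsub>R\<^esub> \<odot>\<^bsub>M\<^esub> x = x"

definition fg_right_module :: "('a, 't) ring_scheme \<Rightarrow> ('a, 'm, 'z) module_scheme \<Rightarrow> bool" where
  "fg_right_module \<Lambda> M \<longleftrightarrow> right_module \<Lambda> M \<and>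
     (\<exists>G\<subseteq>carrier M. finite G \<and>
        (\<forall>x\<in>carrier M. \<exists>c\<in>G \<rightarrow> carrier \<Lambda>. x = (\<Oplus>\<^bsub>M\<^esub>g\<in>G. c g \<odot>\<^bsub>M\<^esub> g)))"

text \<open>Homomorphisms are extensional, so that equality of morphisms is equality of functions.\<close>

definition rmod_hom ::
    "('a, 't) ring_scheme \<Rightarrow> ('a, 'm, 'y) module_scheme \<Rightarrow> ('a, 'n, 'z) module_scheme \<Rightarrow> ('m \<Rightarrow> 'n) set"
  where
  "rmod_hom \<Lambda> M N = {f \<in> carrier M \<rightarrow>\<^sub>E carrier N.
     (\<forall>x\<in>carrier M. \<forall>y\<in>carrier M. f (x \<oplus>\<^bsub>M\<^esub> y) = f x \<oplus>\<^bsub>N\<^esub> f y) \<and>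
     (\<forall>a\<in>carrier \<Lambda>. \<forall>x\<in>carrier M. f (a \<odot>\<^bsub>M\<^esub> x) = a \<odot>\<^bsub>N\<^esub> f x)}"

text \<open>
  The finitely generated right \<open>\<Lambda>\<close>-modules whose elements are drawn from the type
  \<^typ>\<open>(nat \<Rightarrow> 'a) set\<close>, where \<^typ>\<open>'a\<close> is the type of \<open>\<Lambda>\<close>. This type is large enough to hold all
  quotients of the modules \<open>\<Lambda>\<^sup>n\<close>, hence a copy of every finitely generated module
  (lemma \<open>fg_right_module_represented\<close>).
\<close>

type_synonym 'a rmod = "('a, (nat \<Rightarrow> 'a) set) module"
type_synonym 'a rmor = "(nat \<Rightarrow> 'a) set \<Rightarrow> (nat \<Rightarrow> 'a) set"

definition fg_mod :: "('a, 't) ring_scheme \<Rightarrow> ('a rmod, 'a rmor) cat" where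
  "fg_mod \<Lambda> =
     \<lparr>Obj = {M. fg_right_module \<Lambda> M},
      Hom = rmod_hom \<Lambda>,
      Id = (\<lambda>M. \<lambda>x\<in>carrier M. x),
      Comp = (\<lambda>L M N g f. compose (carrier L) g f),
      Plus = (\<lambda>M N f g. \<lambda>x\<in>carrier M. f x \<oplus>\<^bsub>N\<^esub> g x),
      Zero = (\<lambda>M N. \<lambda>x\<in>carrier M. \<zero>\<^bsub>N\<^esub>)\<rparr>"

lemma fg_right_module_represented:
  fixes \<Lambda> :: "('a, 't) ring_scheme" and M :: "('a, 'm, 'z) module_scheme"
  assumes "fg_right_module \<Lambda> M"
  shows "\<exists>N\<in>Obj (fg_mod \<Lambda>). \<exists>f\<in>rmod_hom \<Lambda> M N. bij_betw f (carrier M) (carrier N)"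
proof -
  interpret right_module \<Lambda> M using assms by (simp add: fg_right_module_def)
  obtain G where G: "G \<subseteq> carrier M" "finite G"
    and gen: "\<And>x. x \<in> carrier M \<Longrightarrow> \<exists>c\<in>G \<rightarrow> carrier \<Lambda>. x = (\<Oplus>\<^bsub>M\<^esub>g\<in>G. c g \<odot>\<^bsub>M\<^esub> g)"
    using assms by (auto simp: fg_right_module_def)
  obtain e :: "'m \<Rightarrow> nat" where e: "inj_on e G"
    using finite_imp_inj_to_nat_seg[OF G(2)] by blast
  define j where "j m = {c. (\<forall>g\<in>G. c (e g) \<in> carrier \<Lambda>) \<and> m = (\<Oplus>\<^bsub>M\<^esub>g\<in>G. c (e g) \<odot>\<^bsub>M\<^esub> g)}" for m
  have ne: "j m \<noteq> {}" if m: "m \<in> carrier M" for m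
  proof -
    obtain c where c: "c \<in> G \<rightarrow> carrier \<Lambda>" "m = (\<Oplus>\<^bsub>M\<^esub>g\<in>G. c g \<odot>\<^bsub>M\<^esub> g)" using gen[OF m] by blast
    have "(\<Oplus>\<^bsub>M\<^esub>g\<in>G. (c \<circ> inv_into G e) (e g) \<odot>\<^bsub>M\<^esub> g) = (\<Oplus>\<^bsub>M\<^esub>g\<in>G. c g \<odot>\<^bsub>M\<^esub> g)"
      using c G e by (intro M.finsum_cong') (auto simp: ract_closed subset_iff Pi_iff)
    then have "c \<circ> inv_into G e \<in> j m" using c e by (auto simp: j_def)
    then show ?thesis by blast
  qed
  have inj: "inj_on j (carrier M)"
  proof (rule inj_onI)
    fix x y assume xy: "x \<in> carrier M" "j x = j y"
    obtain c where "c \<in> j x" "c \<in> j y" using ne[OF xy(1)] xy(2) by blast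
    then show "x = y" unfolding j_def by blast
  qed
  define k where "k = inv_into (carrier M) j"
  have kj[simp]: "k (j x) = x" if "x \<in> carrier M" for x
    using inj that by (simp add: k_def)
  define N :: "'a rmod" where
    "N = \<lparr>partial_object.carrier = j ` carrier M, monoid.mult = (\<lambda>x y. x), monoid.one = j \<zero>\<^bsub>M\<^esub>, ring.zero = j \<zero>\<^bsub>M\<^esub>,
          ring.add = (\<lambda>x y. j (k x \<oplus>\<^bsub>M\<^esub> k y)), module.smult = (\<lambda>a x. j (a \<odot>\<^bsub>M\<^esub> k x))\<rparr>"
  have N_simps[simp]: "carrier N = j ` carrier M" "\<zero>\<^bsub>N\<^esub> = j \<zero>\<^bsub>M\<^esub>"
     "\<And>x y. x \<oplus>\<^bsub>N\<^esub> y = j (k x \<oplus>\<^bsub>M\<^esub> k y)" "\<And>a x. a \<odot>\<^bsub>N\<^esub> x = j (a \<odot>\<^bsub>M\<^esub> k x)"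
    by (simp_all add: N_def)
  interpret N: abelian_group N
  proof (rule abelian_groupI)
    fix x assume "x \<in> carrier N"
    then obtain m where m: "m \<in> carrier M" "x = j m" by auto
    then show "\<exists>y\<in>carrier N. y \<oplus>\<^bsub>N\<^esub> x = \<zero>\<^bsub>N\<^esub>"
      by (intro bexI[of _ "j (\<ominus>\<^bsub>M\<^esub> m)"]) (auto simp: M.l_neg)
  qed (auto simp: M.a_ac)
  have rm: "right_module \<Lambda> N"
    by unfold_locales
      (auto simp: ract_closed ract_l_distr ract_r_distr ract_assoc ract_one)
  have hom: "j (\<Oplus>\<^bsub>M\<^esub>g\<in>F. h g) = (\<Oplus>\<^bsub>N\<^esub>g\<in>j ` F. j (h (k g)))"
    if "finite F" "F \<subseteq> carrier M" "h \<in> F \<rightarrow> carrier M" for F h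
    using that
  proof (induction F)
    case (insert x F)
    have "j x \<notin> j ` F" using insert inj by (auto dest: inj_onD)
    moreover have "(\<lambda>g. j (h (k g))) \<in> j ` F \<rightarrow> carrier N" "j (h (k (j x))) \<in> carrier N"
      using insert by (auto simp: subset_iff Pi_iff)
    moreover have "(\<Oplus>\<^bsub>M\<^esub>g\<in>F. h g) \<in> carrier M" using insert by (intro M.finsum_closed) auto
    ultimately show ?case using insert by (simp add: insert.IH[symmetric] Pi_iff)
  qed simp
  have "fg_right_module \<Lambda> N"
    unfolding fg_right_module_def
  proof (intro conjI rm exI[of _ "j ` G"] ballI)
    fix x assume "x \<in> carrier N"
    then obtain m where m: "m \<in> carrier M" "x = j m" by auto
    obtain c where c: "c \<in> G \<rightarrow> carrier \<Lambda>" "m = (\<Oplus>\<^bsub>M\<^esub>g\<in>G. c g \<odot>\<^bsub>M\<^esub> g)" using gen[OF m(1)] by blast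
    have "j m = (\<Oplus>\<^bsub>N\<^esub>g\<in>j ` G. j (c (k g) \<odot>\<^bsub>M\<^esub> k g))"
      unfolding c(2) using c G by (intro hom) (auto simp: ract_closed subset_iff Pi_iff)
    moreover have "c \<circ> k \<in> j ` G \<rightarrow> carrier \<Lambda>" using c G by (auto simp: subset_iff Pi_iff)
    ultimately show "\<exists>c\<in>j ` G \<rightarrow> carrier \<Lambda>. x = (\<Oplus>\<^bsub>N\<^esub>g\<in>j ` G. c g \<odot>\<^bsub>N\<^esub> g)"
      using m by (intro bexI[of _ "c \<circ> k"]) (simp_all add: o_def)
  qed (use G in auto)
  then have "N \<in> Obj (fg_mod \<Lambda>)" by (simp add: fg_mod_def)
  moreover have "restrict j (carrier M) \<in> rmod_hom \<Lambda> M N"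
    by (auto simp: rmod_hom_def ract_closed)
  moreover have "bij_betw (restrict j (carrier M)) (carrier M) (carrier N)"
    using inj by (auto simp: bij_betw_def inj_on_def)
  ultimately show ?thesis by blast
qed

end

theory Submission
  imports Defs
begin

text \<open>
  Let \<open>\<M>\<close> be the exact category of monomorphisms over the resolving subcategory \<open>XX\<close>.

  Evaluation of morphisms at their domains and at their codomains has a left and a right adjoint,
  given by the objects \<open>(T = T)\<close>, \<open>(0 \<rightarrow> T)\<close> and \<open>(T \<rightarrow> 0)\<close>. So a sequence of morphisms is short
  exact iff its sequence of domains and its sequence of codomains are
  (\<open>short_exact_morphism_cat\<close>). A map from \<open>(P = P)\<close> is a map from \<open>P\<close> to a domain, a map from
  \<open>(0 \<rightarrow> P)\<close> is a map from \<open>P\<close> to a codomain, and both objects are therefore projective in \<open>\<M>\<close> if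
  \<open>P\<close> is a projective module. A map from \<open>(A \<rightarrow> B)\<close> to \<open>(I = I)\<close> is a map \<open>B \<rightarrow> I\<close>, and a map to
  \<open>(0 \<rightarrow> I)\<close> is a map from the cokernel of \<open>A \<rightarrow> B\<close> to \<open>I\<close>. Since the cokernels of a conflation of
  \<open>\<M>\<close> form a conflation of \<open>XX\<close> (\<open>cokernel_row_exact\<close>), both objects are injective in \<open>\<M>\<close> if
  \<open>I\<close> is injective in \<open>XX\<close>.

  There are enough of these. Let \<open>Q\<close> be the cokernel of \<open>A \<rightarrow> B\<close>. Epimorphisms \<open>P \<rightarrow> A\<close> and
  \<open>P' \<rightarrow> B\<close> with \<open>P\<close> and \<open>P'\<close> projective define an epimorphism from \<open>(P \<rightarrow> P \<oplus> P')\<close> to \<open>(A \<rightarrow> B)\<close>.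
  Its kernel is a monomorphism whose cokernel is the kernel of \<open>P' \<rightarrow> Q\<close> (\<open>kernel_row_exact\<close>), and
  \<open>XX\<close> contains all kernels of epimorphisms between its objects. If \<open>XX\<close> has enough injectives,
  choose inflations \<open>A \<rightarrow> I\<close> and \<open>Q \<rightarrow> J\<close>; an extension of the first to \<open>B\<close> and the second make a
  map \<open>B \<rightarrow> I \<oplus> J\<close>, which embeds \<open>(A \<rightarrow> B)\<close> into \<open>(I \<rightarrow> I \<oplus> J)\<close>. The cokernel of this embedding is
  in \<open>\<M>\<close> because \<open>XX\<close> is closed under extensions.

  The classification avoids the Krull-Schmidt theorem. A projective or injective object
  \<open>(A \<rightarrow> B)\<close> is a retract of one of the split monomorphisms just constructed. Retracts of split
  monomorphisms split, so that \<open>(A \<rightarrow> B)\<close> is the direct sum of \<open>(A = A)\<close> and \<open>(0 \<rightarrow> Q)\<close>. If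
  \<open>(A \<rightarrow> B)\<close> is indecomposable, one of the two summands vanishes
  (\<open>indecomposable_retract_cases\<close>).

  What is left is that finitely generated modules have kernels, that is, that their submodules are
  finitely generated. Such a module satisfies the descending chain condition over the commutative
  artinian base ring, and over a commutative artinian ring this condition implies finite
  generation of all submodules (\<open>fin_gen_of_dcc\<close>).
\<close>

section \<open>Preadditive categories\<close>

text \<open>
  The record \<^typ>\<open>('o, 'h) cat\<close> has no subtraction of morphisms, so negatives are only
  required to exist; they are unique by cancellation.
\<close>

locale preadditive =
  fixes C :: "('o, 'h, 'z) cat_scheme"
  assumes Id_in [simp, intro]: "A \<in> Obj C \<Longrightarrow> Id C A \<in> Hom C A A"
    and Comp_in [simp, intro]:
      "\<lbrakk>f \<in> Hom C A B; g \<in> Hom C B D; A \<in> Obj C; B \<in> Obj C; D \<in> Obj C\<rbrakk> \<Longrightarrow> Comp C A B D g f \<in> Hom C A D"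
    and Comp_assoc:
      "\<lbrakk>f \<in> Hom C A B; g \<in> Hom C B D; h \<in> Hom C D E; A \<in> Obj C; B \<in> Obj C; D \<in> Obj C; E \<in> Obj C\<rbrakk>
        \<Longrightarrow> Comp C A B E (Comp C B D E h g) f = Comp C A D E h (Comp C A B D g f)"
    and Comp_Id [simp]: "\<lbrakk>f \<in> Hom C A B; A \<in> Obj C; B \<in> Obj C\<rbrakk> \<Longrightarrow> Comp C A A B f (Id C A) = f"
    and Id_Comp [simp]: "\<lbrakk>f \<in> Hom C A B; A \<in> Obj C; B \<in> Obj C\<rbrakk> \<Longrightarrow> Comp C A B B (Id C B) f = f"
    and Plus_in [simp, intro]:
      "\<lbrakk>f \<in> Hom C A B; g \<in> Hom C A B; A \<in> Obj C; B \<in> Obj C\<rbrakk> \<Longrightarrow> Plus C A B f g \<in> Hom C A B"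
    and Zero_in [simp, intro]: "\<lbrakk>A \<in> Obj C; B \<in> Obj C\<rbrakk> \<Longrightarrow> Zero C A B \<in> Hom C A B"
    and Plus_assoc:
      "\<lbrakk>f \<in> Hom C A B; g \<in> Hom C A B; h \<in> Hom C A B; A \<in> Obj C; B \<in> Obj C\<rbrakk>
        \<Longrightarrow> Plus C A B (Plus C A B f g) h = Plus C A B f (Plus C A B g h)"
    and Plus_comm:
      "\<lbrakk>f \<in> Hom C A B; g \<in> Hom C A B; A \<in> Obj C; B \<in> Obj C\<rbrakk> \<Longrightarrow> Plus C A B f g = Plus C A B g f"
    and Plus_Zero [simp]: "\<lbrakk>f \<in> Hom C A B; A \<in> Obj C; B \<in> Obj C\<rbrakk> \<Longrightarrow> Plus C A B f (Zero C A B) = f"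
    and Plus_inverse:
      "\<lbrakk>f \<in> Hom C A B; A \<in> Obj C; B \<in> Obj C\<rbrakk> \<Longrightarrow> \<exists>g\<in>Hom C A B. Plus C A B f g = Zero C A B"
    and Comp_Plus:
      "\<lbrakk>f \<in> Hom C A B; f' \<in> Hom C A B; g \<in> Hom C B D; A \<in> Obj C; B \<in> Obj C; D \<in> Obj C\<rbrakk>
        \<Longrightarrow> Comp C A B D g (Plus C A B f f') = Plus C A D (Comp C A B D g f) (Comp C A B D g f')"
    and Plus_Comp:
      "\<lbrakk>f \<in> Hom C A B; g \<in> Hom C B D; g' \<in> Hom C B D; A \<in> Obj C; B \<in> Obj C; D \<in> Obj C\<rbrakk>
        \<Longrightarrow> Comp C A B D (Plus C B D g g') f = Plus C A D (Comp C A B D g f) (Comp C A B D g' f)"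
begin

lemma Zero_Plus [simp]: "\<lbrakk>f \<in> Hom C A B; A \<in> Obj C; B \<in> Obj C\<rbrakk> \<Longrightarrow> Plus C A B (Zero C A B) f = f"
  using Plus_comm[of "Zero C A B" A B f] by simp

lemma Plus_cancel:
  assumes "f \<in> Hom C A B" "g \<in> Hom C A B" "h \<in> Hom C A B" "A \<in> Obj C" "B \<in> Obj C"
    and "Plus C A B f g = Plus C A B f h"
  shows "g = h"
proof -
  obtain k where k: "k \<in> Hom C A B" "Plus C A B f k = Zero C A B"
    using Plus_inverse assms by blast
  have "Plus C A B k (Plus C A B f g) = Plus C A B k (Plus C A B f h)" using assms by simp
  then have "Plus C A B (Plus C A B k f) g = Plus C A B (Plus C A B k f) h"
    using assms k by (simp add: Plus_assoc)
  then show ?thesis using k assms Plus_comm[of k A B f] by simp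
qed

text \<open>
  A composite with zero is an idempotent of the additive group, hence zero by cancellation.
\<close>

lemma Comp_Zero [simp]:
  assumes "g \<in> Hom C B D" "A \<in> Obj C" "B \<in> Obj C" "D \<in> Obj C"
  shows "Comp C A B D g (Zero C A B) = Zero C A D"
proof -
  let ?x = "Comp C A B D g (Zero C A B)"
  have x: "?x \<in> Hom C A D" using assms by simp
  have "Plus C A D ?x ?x = Comp C A B D g (Plus C A B (Zero C A B) (Zero C A B))"
    using assms by (simp only: Comp_Plus Zero_in)
  also have "\<dots> = Plus C A D ?x (Zero C A D)" using assms x by simp
  finally show ?thesis using Plus_cancel[OF x x Zero_in] assms by blast
qed

lemma Zero_Comp [simp]:
  assumes "f \<in> Hom C A B" "A \<in> Obj C" "B \<in> Obj C" "D \<in> Obj C"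
  shows "Comp C A B D (Zero C B D) f = Zero C A D"
proof -
  let ?x = "Comp C A B D (Zero C B D) f"
  have x: "?x \<in> Hom C A D" using assms by simp
  have "Plus C A D ?x ?x = Comp C A B D (Plus C B D (Zero C B D) (Zero C B D)) f"
    using assms by (simp only: Plus_Comp Zero_in)
  also have "\<dots> = Plus C A D ?x (Zero C A D)" using assms x by simp
  finally show ?thesis using Plus_cancel[OF x x Zero_in] assms by blast
qed

text \<open>
  A zero object is recognised by one equation, which makes it independent of the full
  subcategory in which it is considered and lets it be checked in each component.
\<close>

lemma zero_object_iff:
  assumes "Z \<in> Obj C"
  shows "zero_object C Z \<longleftrightarrow> Id C Z = Zero C Z Z"
proof
  assume "zero_object C Z"
  then show "Id C Z = Zero C Z Z"
    using assms Id_in[OF assms] Zero_in[OF assms assms] unfolding zero_object_def by blast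
next
  assume eq: "Id C Z = Zero C Z Z"
  have "f = Zero C Z A" if "f \<in> Hom C Z A" "A \<in> Obj C" for f A
    using Comp_Id[of f Z A] Comp_Zero[of f Z A Z] that assms eq by simp
  moreover have "f = Zero C A Z" if "f \<in> Hom C A Z" "A \<in> Obj C" for f A
    using Id_Comp[of f A Z] Zero_Comp[of f A Z Z] that assms eq by simp
  ultimately show "zero_object C Z" using assms unfolding zero_object_def by blast
qed

lemma Hom_from_zero: "\<lbrakk>zero_object C Z; f \<in> Hom C Z A; A \<in> Obj C\<rbrakk> \<Longrightarrow> f = Zero C Z A"
  and Hom_to_zero: "\<lbrakk>zero_object C Z; g \<in> Hom C A Z; A \<in> Obj C\<rbrakk> \<Longrightarrow> g = Zero C A Z"
  unfolding zero_object_def by blast+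

lemma zero_object_in: "zero_object C Z \<Longrightarrow> Z \<in> Obj C"
  by (simp add: zero_object_def)

end

definition biproduct ::
    "('o, 'h, 'z) cat_scheme \<Rightarrow> 'o \<Rightarrow> 'o \<Rightarrow> 'o \<Rightarrow> 'h \<Rightarrow> 'h \<Rightarrow> 'h \<Rightarrow> 'h \<Rightarrow> bool" where
  "biproduct C S A B i j p q \<longleftrightarrow> S \<in> Obj C \<and> A \<in> Obj C \<and> B \<in> Obj C \<and>
     i \<in> Hom C A S \<and> j \<in> Hom C B S \<and> p \<in> Hom C S A \<and> q \<in> Hom C S B \<and>
     Comp C A S A p i = Id C A \<and> Comp C B S B q j = Id C B \<and>
     Comp C B S A p j = Zero C B A \<and> Comp C A S B q i = Zero C A B \<and>
     Plus C S S (Comp C S A S i p) (Comp C S B S j q) = Id C S"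

lemma direct_sum_iff: "direct_sum C S A B \<longleftrightarrow> (\<exists>i j p q. biproduct C S A B i j p q)"
  unfolding direct_sum_def biproduct_def by blast

lemma biproduct_arrows:
  "biproduct C S A B i j p q \<Longrightarrow> S \<in> Obj C \<and> A \<in> Obj C \<and> B \<in> Obj C \<and>
     i \<in> Hom C A S \<and> j \<in> Hom C B S \<and> p \<in> Hom C S A \<and> q \<in> Hom C S B"
  and biproduct_sum:
  "biproduct C S A B i j p q \<Longrightarrow>
     Plus C S S (Comp C S A S i p) (Comp C S B S j q) = Id C S"
  by (simp_all add: biproduct_def)

lemma projective_objectD:
  "\<lbrakk>projective_object C P; epimorphism C A B p; f \<in> Hom C P B; A \<in> Obj C; B \<in> Obj C\<rbrakk>
    \<Longrightarrow> \<exists>g\<in>Hom C P A. Comp C P A B p g = f"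
  by (simp add: projective_object_def)

lemma exact_projectiveD:
  "\<lbrakk>exact_projective E P; admissible_epi E B D p; f \<in> Hom E P D\<rbrakk>
    \<Longrightarrow> \<exists>g\<in>Hom E P B. Comp E P B D p g = f"
  by (simp add: exact_projective_def)

lemma exact_injectiveD:
  "\<lbrakk>exact_injective E I; admissible_mono E A B i; f \<in> Hom E A I\<rbrakk>
    \<Longrightarrow> \<exists>g\<in>Hom E B I. Comp E A B I g i = f"
  by (simp add: exact_injective_def)

definition retract :: "('o, 'h, 'z) cat_scheme \<Rightarrow> 'o \<Rightarrow> 'o \<Rightarrow> bool" where
  "retract C A B \<longleftrightarrow> A \<in> Obj C \<and> B \<in> Obj C \<and>
     (\<exists>s\<in>Hom C A B. \<exists>r\<in>Hom C B A. Comp C A B A r s = Id C A)"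

lemma isomorphic_sym: "isomorphic C A B \<Longrightarrow> isomorphic C B A"
  unfolding isomorphic_def by blast

lemma isomorphic_retract: "isomorphic C A B \<Longrightarrow> retract C A B"
  unfolding isomorphic_def retract_def by blast

context preadditive
begin

lemma Comp_retraction:
  assumes "s \<in> Hom C A B" "r \<in> Hom C B A" "Comp C A B A r s = Id C A" "f \<in> Hom C D A"
    and "A \<in> Obj C" "B \<in> Obj C" "D \<in> Obj C"
  shows "Comp C D B A r (Comp C D A B s f) = f"
  using assms Comp_assoc[of f D A s B r A] by simp

lemma retraction_Comp:
  assumes "s \<in> Hom C A B" "r \<in> Hom C B A" "Comp C A B A r s = Id C A" "f \<in> Hom C A D"
    and "A \<in> Obj C" "B \<in> Obj C" "D \<in> Obj C"
  shows "Comp C A B D (Comp C B A D f r) s = f"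
  using assms Comp_assoc[of s A B r A f D] by simp

text \<open>
  Conjugation by an isomorphism \<open>u\<close> with inverse \<open>v\<close>.
\<close>

lemma biproduct_iso:
  assumes "biproduct C S A B i j p q"
    and u: "u \<in> Hom C S T" and v: "v \<in> Hom C T S" and T: "T \<in> Obj C"
    and vu: "Comp C S T S v u = Id C S" and uv: "Comp C T S T u v = Id C T"
  shows "biproduct C T A B (Comp C A S T u i) (Comp C B S T u j)
    (Comp C T S A p v) (Comp C T S B q v)"
proof -
  note b = assms(1)[unfolded biproduct_def]
  have 1: "Comp C V T W (Comp C T S W g v) (Comp C V S T u f) = Comp C V S W g f"
    if "f \<in> Hom C V S" "g \<in> Hom C S W" "V \<in> Obj C" "W \<in> Obj C" for f g V W
    using that b u v T vu Comp_assoc[of "Comp C V S T u f" V T v S g W]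
      Comp_assoc[of f V S u T v S] by simp
  have 2: "Comp C T V T (Comp C V S T u f) (Comp C T S V g v) =
      Comp C T S T (Comp C S S T u (Comp C S V S f g)) v"
    if "f \<in> Hom C V S" "g \<in> Hom C S V" "V \<in> Obj C" for f g V
    using that b u v T by (simp add: Comp_assoc)
  have "Plus C T T (Comp C T A T (Comp C A S T u i) (Comp C T S A p v))
     (Comp C T B T (Comp C B S T u j) (Comp C T S B q v)) =
     Comp C T S T (Comp C S S T u (Plus C S S (Comp C S A S i p) (Comp C S B S j q))) v"
    using biproduct_arrows[OF assms(1)] u v T by (simp add: 2 Comp_Plus Plus_Comp)
  also have "\<dots> = Id C T" using b u v T uv by simp
  finally show ?thesis using b u v T unfolding biproduct_def by (simp add: 1)
qed

lemma zero_object_iso: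
  assumes "isomorphic C A B" "zero_object C A"
  shows "zero_object C B"
proof -
  obtain f g where fg: "A \<in> Obj C" "B \<in> Obj C" "f \<in> Hom C A B" "g \<in> Hom C B A"
      "Comp C B A B f g = Id C B"
    using assms by (auto simp: isomorphic_def)
  then have "f = Zero C A B" using assms Hom_from_zero by blast
  then show ?thesis using fg by (simp add: zero_object_iff)
qed

lemma indecomposable_iso:
  assumes iso: "isomorphic C S T" and S: "indecomposable C S"
  shows "indecomposable C T"
proof -
  have "\<not> zero_object C T"
    using S zero_object_iso[OF isomorphic_sym[OF iso]] by (auto simp: indecomposable_def)
  moreover have "direct_sum C S A B" if "direct_sum C T A B" for A B
  proof -
    obtain i j p q where b: "biproduct C T A B i j p q" using \<open>direct_sum C T A B\<close> unfolding direct_sum_iff by blast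
    obtain u v where "S \<in> Obj C" "u \<in> Hom C T S" "v \<in> Hom C S T"
        "Comp C T S T v u = Id C T" "Comp C S T S u v = Id C S"
      using iso unfolding isomorphic_def by blast
    from biproduct_iso[OF b this(2,3,1,4,5)] show ?thesis unfolding direct_sum_iff by blast
  qed
  ultimately show ?thesis
    using S iso unfolding indecomposable_def isomorphic_def by blast
qed

lemma biproduct_zero_left:
  assumes "zero_object C Z" "B \<in> Obj C"
  shows "biproduct C B Z B (Zero C Z B) (Id C B) (Zero C B Z) (Id C B)"
  using assms zero_object_in[OF assms(1)] zero_object_iff[of Z] unfolding biproduct_def by simp

lemma biproduct_expand_target:
  assumes b: "biproduct C S A B i j p q" and g: "g \<in> Hom C V S"
    and "V \<in> Obj C"
  shows "Plus C V S (Comp C V A S i (Comp C V S A p g)) (Comp C V B S j (Comp C V S B q g)) = g"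
proof -
  have "g = Comp C V S S (Plus C S S (Comp C S A S i p) (Comp C S B S j q)) g"
    using biproduct_arrows[OF b] biproduct_sum[OF b] assms(2,3) by simp
  also have "\<dots> = Plus C V S (Comp C V A S i (Comp C V S A p g)) (Comp C V B S j (Comp C V S B q g))"
    using biproduct_arrows[OF b] assms(2,3) by (simp add: Plus_Comp Comp_assoc)
  finally show ?thesis by simp
qed

lemma biproduct_expand_source:
  assumes b: "biproduct C S A B i j p q" and g: "g \<in> Hom C S V"
    and "V \<in> Obj C"
  shows "Plus C S V (Comp C S A V (Comp C A S V g i) p) (Comp C S B V (Comp C B S V g j) q) = g"
proof -
  have "g = Comp C S S V g (Plus C S S (Comp C S A S i p) (Comp C S B S j q))"
    using biproduct_arrows[OF b] biproduct_sum[OF b] assms(2,3) by simp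
  also have "\<dots> = Plus C S V (Comp C S A V (Comp C A S V g i) p) (Comp C S B V (Comp C B S V g j) q)"
    using biproduct_arrows[OF b] assms(2,3) by (simp add: Comp_Plus Comp_assoc)
  finally show ?thesis by simp
qed

text \<open>
  The map \<open>1 - f r\<close> vanishes on \<open>f\<close> and therefore factors through the cokernel \<open>q\<close> as
  \<open>j q\<close>. As \<open>q\<close> is epic, \<open>q j = 1\<close> and \<open>r j = 0\<close> follow from \<open>q j q = q\<close> and \<open>r j q = 0\<close>.
\<close>

lemma cokernel_split_mono:
  assumes f: "f \<in> Hom C A B" and r: "r \<in> Hom C B A" and rf: "Comp C A B A r f = Id C A"
    and q: "is_cokernel C A f B q Q" and ob: "A \<in> Obj C" "B \<in> Obj C" "Q \<in> Obj C"
  shows "\<exists>j. biproduct C B A Q f j r q"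
proof -
  have q': "q \<in> Hom C B Q" "Comp C A B Q q f = Zero C A Q" using q by (auto simp: is_cokernel_def)
  have epi: "u = v" if "u \<in> Hom C Q T" "v \<in> Hom C Q T" "T \<in> Obj C"
    "Comp C B Q T u q = Comp C B Q T v q" for u v T
  proof -
    have "Comp C A B T (Comp C B Q T u q) f = Zero C A T"
      using that f q' ob by (simp add: Comp_assoc)
    then have "\<exists>!w. w \<in> Hom C Q T \<and> Comp C B Q T w q = Comp C B Q T u q"
      using q that(1,3) q'(1) ob unfolding is_cokernel_def by (metis Comp_in)
    then show ?thesis using that by metis
  qed
  obtain m where m: "m \<in> Hom C B B" "Plus C B B (Comp C B A B f r) m = Zero C B B"
    using Plus_inverse[of "Comp C B A B f r" B B] f r ob by auto
  \<comment> \<open>\<open>t\<close> is \<open>1 - f r\<close>\<close>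
  define t where "t = Plus C B B (Id C B) m"
  have t: "t \<in> Hom C B B" using m ob by (simp add: t_def)
  have frt: "Plus C B B (Comp C B A B f r) t = Id C B"
  proof -
    have "Plus C B B (Comp C B A B f r) t = Plus C B B (Id C B) (Plus C B B (Comp C B A B f r) m)"
      unfolding t_def using m f r ob
      by (metis Comp_in Id_in Plus_assoc Plus_comm)
    then show ?thesis using m ob by simp
  qed
  have "Comp C A B B t f = Zero C A B"
  proof -
    have "Plus C A B (Comp C A B B (Comp C B A B f r) f) (Comp C A B B t f) = Comp C A B B (Id C B) f"
      using frt f r t ob by (simp add: Plus_Comp[symmetric])
    then have "Plus C A B f (Comp C A B B t f) = Plus C A B f (Zero C A B)"
      using f r t rf ob by (simp add: Comp_assoc)
    then show ?thesis using Plus_cancel f t ob by (metis Comp_in Zero_in)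
  qed
  then obtain j where j: "j \<in> Hom C Q B" "Comp C B Q B j q = t"
    using q t ob unfolding is_cokernel_def by metis
  have sum: "Plus C B B (Comp C B A B f r) (Comp C B Q B j q) = Id C B" using j frt by simp
  have "Comp C B Q Q (Comp C Q B Q q j) q = Comp C B B Q q (Comp C B Q B j q)"
    using j q' ob by (simp add: Comp_assoc)
  also have "\<dots> = Plus C B Q (Comp C B B Q q (Comp C B A B f r)) (Comp C B B Q q (Comp C B Q B j q))"
    using q' ob f r j(1) by (simp add: Comp_assoc[symmetric])
  also have "\<dots> = Comp C B Q Q (Id C Q) q"
    using q' ob f r sum j(1) by (simp add: Comp_Plus[symmetric])
  finally have qj: "Comp C Q B Q q j = Id C Q" using epi j q' ob by blast
  have "Plus C B A r (Comp C B B A r (Comp C B Q B j q)) =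
     Plus C B A (Comp C B B A r (Comp C B A B f r)) (Comp C B B A r (Comp C B Q B j q))"
    using q' ob f r rf j(1) by (simp add: Comp_assoc[symmetric])
  also have "\<dots> = Plus C B A r (Zero C B A)"
    using q' ob f r sum j(1) by (simp add: Comp_Plus[symmetric])
  finally have "Comp C B B A r (Comp C B Q B j q) = Zero C B A"
    using Plus_cancel j q' r ob by (metis Comp_in Zero_in)
  then have "Comp C B Q A (Comp C Q B A r j) q = Comp C B Q A (Zero C Q A) q"
    using j q' r ob by (simp add: Comp_assoc)
  then have rj: "Comp C Q B A r j = Zero C Q A" using epi j q' r ob by (metis Comp_in Zero_in)
  show ?thesis unfolding biproduct_def
    by (intro exI[of _ j] conjI) (fact f r rf q' ob j(1) sum qj rj)+
qed

lemma retract_projective_object: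
  assumes "retract C A B" "projective_object C B"
  shows "projective_object C A"
proof -
  obtain s r where sr: "A \<in> Obj C" "B \<in> Obj C" "s \<in> Hom C A B" "r \<in> Hom C B A"
      "Comp C A B A r s = Id C A"
    using assms by (auto simp: retract_def)
  have "\<exists>g\<in>Hom C A V. Comp C A V W p g = f"
    if "V \<in> Obj C" "W \<in> Obj C" "epimorphism C V W p" "f \<in> Hom C A W" for V W p f
  proof -
    note lift = that
    have "p \<in> Hom C V W" using that by (simp add: epimorphism_def)
    moreover have "Comp C B A W f r \<in> Hom C B W" using that sr by simp
    then obtain g where g: "g \<in> Hom C B V" "Comp C B V W p g = Comp C B A W f r"
      using projective_objectD[OF assms(2) lift(3) _ lift(1,2)] by blast
    ultimately have "Comp C A V W p (Comp C A B V g s) = f"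
      using that sr retraction_Comp[of s A B r f W] by (simp add: Comp_assoc[symmetric])
    then show ?thesis using g sr that by blast
  qed
  then show ?thesis using sr unfolding projective_object_def by blast
qed

lemma biproduct_projective_object:
  assumes b: "biproduct C S A B i j p q" and "projective_object C A" "projective_object C B"
  shows "projective_object C S"
proof -
  note b' = biproduct_arrows[OF b]
  have "\<exists>g\<in>Hom C S V. Comp C S V W e g = f"
    if "V \<in> Obj C" "W \<in> Obj C" "epimorphism C V W e" "f \<in> Hom C S W" for V W e f
  proof -
    note lift = that
    have e: "e \<in> Hom C V W" using that by (simp add: epimorphism_def)
    have fij: "Comp C A S W f i \<in> Hom C A W" "Comp C B S W f j \<in> Hom C B W" using that b' by auto
    then obtain g h where g: "g \<in> Hom C A V" "Comp C A V W e g = Comp C A S W f i"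
      and h: "h \<in> Hom C B V" "Comp C B V W e h = Comp C B S W f j"
      using projective_objectD[OF assms(2) lift(3) fij(1) lift(1,2)]
        projective_objectD[OF assms(3) lift(3) fij(2) lift(1,2)] by blast
    have "Comp C S V W e (Plus C S V (Comp C S A V g p) (Comp C S B V h q)) = f"
    proof -
      have "Comp C S V W e (Plus C S V (Comp C S A V g p) (Comp C S B V h q)) =
          Plus C S W (Comp C S A W (Comp C A V W e g) p) (Comp C S B W (Comp C B V W e h) q)"
        using e g(1) h(1) b' lift(1,2) by (simp add: Comp_Plus Comp_assoc)
      then show ?thesis using biproduct_expand_source[OF b, of f W] g(2) h(2) that e by simp
    qed
    then show ?thesis using g h b' that by blast
  qed
  then show ?thesis using b' unfolding projective_object_def by blast
qed

lemma biproduct_copair: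
  assumes b: "biproduct C S A B i j p q" and f: "f \<in> Hom C A T" "g \<in> Hom C B T" "T \<in> Obj C"
  shows "\<exists>h\<in>Hom C S T. Comp C A S T h i = f \<and> Comp C B S T h j = g"
proof -
  note b' = biproduct_arrows[OF b]
  have e: "Comp C A S A p i = Id C A" "Comp C B S B q j = Id C B"
    "Comp C B S A p j = Zero C B A" "Comp C A S B q i = Zero C A B"
    using b by (simp_all add: biproduct_def)
  show ?thesis
    using b' f e by (intro bexI[of _ "Plus C S T (Comp C S A T f p) (Comp C S B T g q)"])
      (simp_all add: Plus_Comp Comp_assoc)
qed

lemma biproduct_pair:
  assumes b: "biproduct C S A B i j p q" and f: "f \<in> Hom C T A" "g \<in> Hom C T B" "T \<in> Obj C"
  shows "\<exists>h\<in>Hom C T S. Comp C T S A p h = f \<and> Comp C T S B q h = g"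
proof -
  note b' = biproduct_arrows[OF b]
  have e: "Comp C A S A p i = Id C A" "Comp C B S B q j = Id C B"
    "Comp C B S A p j = Zero C B A" "Comp C A S B q i = Zero C A B"
    using b by (simp_all add: biproduct_def)
  show ?thesis
    using b' f e by (intro bexI[of _ "Plus C T S (Comp C T A S i f) (Comp C T B S j g)"])
      (simp_all add: Comp_Plus Comp_assoc[symmetric])
qed

lemma isomorphic_refl: "A \<in> Obj C \<Longrightarrow> isomorphic C A A"
  unfolding isomorphic_def by (intro conjI bexI[of _ "Id C A"]) simp_all

lemma zero_object_projective:
  assumes "zero_object C Z"
  shows "projective_object C Z"
  unfolding projective_object_def
proof (intro conjI ballI allI impI)
  show Z: "Z \<in> Obj C" using assms by (rule zero_object_in)
  fix A B p f assume A: "A \<in> Obj C" "B \<in> Obj C" "epimorphism C A B p \<and> f \<in> Hom C Z B"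
  then have "f = Zero C Z B" "p \<in> Hom C A B"
    using Hom_from_zero[OF assms] by (auto simp: epimorphism_def)
  then show "\<exists>g\<in>Hom C Z A. Comp C Z A B p g = f"
    using A Z by (intro bexI[of _ "Zero C Z A"]) simp_all
qed

lemma biproduct_jointly_epic:
  assumes b: "biproduct C S A B i j p q" and f: "f \<in> Hom C S T" "g \<in> Hom C S T" "T \<in> Obj C"
    and fi: "Comp C A S T f i = Comp C A S T g i" and fj: "Comp C B S T f j = Comp C B S T g j"
  shows "f = g"
proof -
  have "f = Plus C S T (Comp C S A T (Comp C A S T f i) p) (Comp C S B T (Comp C B S T f j) q)"
    by (rule biproduct_expand_source[OF b f(1,3), symmetric])
  also have "\<dots> = g" unfolding fi fj by (rule biproduct_expand_source[OF b f(2,3)])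
  finally show ?thesis .
qed

lemma biproduct_jointly_monic:
  assumes b: "biproduct C S A B i j p q" and f: "f \<in> Hom C T S" "g \<in> Hom C T S" "T \<in> Obj C"
    and pf: "Comp C T S A p f = Comp C T S A p g" and qf: "Comp C T S B q f = Comp C T S B q g"
  shows "f = g"
proof -
  have "f = Plus C T S (Comp C T A S i (Comp C T S A p f)) (Comp C T B S j (Comp C T S B q f))"
    by (rule biproduct_expand_target[OF b f(1,3), symmetric])
  also have "\<dots> = g" unfolding pf qf by (rule biproduct_expand_target[OF b f(2,3)])
  finally show ?thesis .
qed

end

locale preadditive_exact = preadditive E for E :: "('o, 'h, 'z) exact_cat_scheme" +
  assumes conflation:
    "(A, i, B, p, D) \<in> Conflations E \<Longrightarrow>
      A \<in> Obj E \<and> B \<in> Obj E \<and> D \<in> Obj E \<and> i \<in> Hom E A B \<and> p \<in> Hom E B D"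
begin

lemma retract_exact_projective:
  assumes "retract E A B" "exact_projective E B"
  shows "exact_projective E A"
proof -
  obtain s r where sr: "A \<in> Obj E" "B \<in> Obj E" "s \<in> Hom E A B" "r \<in> Hom E B A"
      "Comp E A B A r s = Id E A"
    using assms by (auto simp: retract_def)
  have "\<exists>g\<in>Hom E A V. Comp E A V W p g = f"
    if "admissible_epi E V W p" "f \<in> Hom E A W" for V W p f
  proof -
    note lift = that
    have p: "p \<in> Hom E V W" "V \<in> Obj E" "W \<in> Obj E"
      using that conflation by (auto simp: admissible_epi_def)
    then have "Comp E B A W f r \<in> Hom E B W" using that sr by simp
    then obtain g where g: "g \<in> Hom E B V" "Comp E B V W p g = Comp E B A W f r"
      using exact_projectiveD[OF assms(2) lift(1)] by blast
    then have "Comp E A V W p (Comp E A B V g s) = f"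
      using that sr p retraction_Comp[of s A B r f W] by (simp add: Comp_assoc[symmetric])
    then show ?thesis using g sr that p by blast
  qed
  then show ?thesis using sr unfolding exact_projective_def by blast
qed

lemma retract_exact_injective:
  assumes "retract E A B" "exact_injective E B"
  shows "exact_injective E A"
proof -
  obtain s r where sr: "A \<in> Obj E" "B \<in> Obj E" "s \<in> Hom E A B" "r \<in> Hom E B A"
      "Comp E A B A r s = Id E A"
    using assms by (auto simp: retract_def)
  have "\<exists>g\<in>Hom E W A. Comp E V W A g i = f"
    if "admissible_mono E V W i" "f \<in> Hom E V A" for V W i f
  proof -
    note lift = that
    have i: "i \<in> Hom E V W" "V \<in> Obj E" "W \<in> Obj E"
      using that conflation by (auto simp: admissible_mono_def)
    then have "Comp E V A B s f \<in> Hom E V B" using that sr by simp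
    then obtain g where g: "g \<in> Hom E W B" "Comp E V W B g i = Comp E V A B s f"
      using exact_injectiveD[OF assms(2) lift(1)] by blast
    then have "Comp E V W A (Comp E W B A r g) i = f"
      using that sr i Comp_retraction[of s A B r f V] by (simp add: Comp_assoc)
    then show ?thesis using g sr that i by blast
  qed
  then show ?thesis using sr unfolding exact_injective_def by blast
qed

text \<open>
  Lift the two components of a map separately and add the lifts.
\<close>

lemma biproduct_exact_projective:
  assumes b: "biproduct E S A B i j p q" and "exact_projective E A" "exact_projective E B"
  shows "exact_projective E S"
proof -
  note b' = biproduct_arrows[OF b]
  have "\<exists>g\<in>Hom E S V. Comp E S V W e g = f"
    if "admissible_epi E V W e" "f \<in> Hom E S W" for V W e f
  proof -
    note lift = that
    have e: "e \<in> Hom E V W" "V \<in> Obj E" "W \<in> Obj E"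
      using that conflation by (auto simp: admissible_epi_def)
    then have fij: "Comp E A S W f i \<in> Hom E A W" "Comp E B S W f j \<in> Hom E B W" using that b' by auto
    then obtain g h where g: "g \<in> Hom E A V" "Comp E A V W e g = Comp E A S W f i"
      and h: "h \<in> Hom E B V" "Comp E B V W e h = Comp E B S W f j"
      using exact_projectiveD[OF assms(2) lift(1) fij(1)] exact_projectiveD[OF assms(3) lift(1) fij(2)]
      by blast
    have "Comp E S V W e (Plus E S V (Comp E S A V g p) (Comp E S B V h q)) = f"
    proof -
      have "Comp E S V W e (Plus E S V (Comp E S A V g p) (Comp E S B V h q)) =
          Plus E S W (Comp E S A W (Comp E A V W e g) p) (Comp E S B W (Comp E B V W e h) q)"
        using e g(1) h(1) b' lift(1,2) by (simp add: Comp_Plus Comp_assoc)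
      then show ?thesis using biproduct_expand_source[OF b, of f W] g(2) h(2) that e by simp
    qed
    then show ?thesis using g h b' that e by blast
  qed
  then show ?thesis using b' unfolding exact_projective_def by blast
qed

lemma biproduct_exact_injective:
  assumes b: "biproduct E S A B i j p q" and "exact_injective E A" "exact_injective E B"
  shows "exact_injective E S"
proof -
  note b' = biproduct_arrows[OF b]
  have "\<exists>g\<in>Hom E W S. Comp E V W S g e = f"
    if "admissible_mono E V W e" "f \<in> Hom E V S" for V W e f
  proof -
    note lift = that
    have e: "e \<in> Hom E V W" "V \<in> Obj E" "W \<in> Obj E"
      using that conflation by (auto simp: admissible_mono_def)
    then have fij: "Comp E V S A p f \<in> Hom E V A" "Comp E V S B q f \<in> Hom E V B" using that b' by auto
    then obtain g h where g: "g \<in> Hom E W A" "Comp E V W A g e = Comp E V S A p f"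
      and h: "h \<in> Hom E W B" "Comp E V W B h e = Comp E V S B q f"
      using exact_injectiveD[OF assms(2) lift(1) fij(1)] exact_injectiveD[OF assms(3) lift(1) fij(2)]
      by blast
    have "Comp E V W S (Plus E W S (Comp E W A S i g) (Comp E W B S j h)) e = f"
    proof -
      have "Comp E V W S (Plus E W S (Comp E W A S i g) (Comp E W B S j h)) e =
          Plus E V S (Comp E V A S i (Comp E V W A g e)) (Comp E V B S j (Comp E V W B h e))"
        using e g(1) h(1) b' lift(1,2) by (simp add: Plus_Comp Comp_assoc)
      then show ?thesis using biproduct_expand_target[OF b, of f V] g(2) h(2) that e by simp
    qed
    then show ?thesis using g h b' that e by blast
  qed
  then show ?thesis using b' unfolding exact_injective_def by blast
qed

text \<open>
  A lift of the identity splits the deflation.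
\<close>

lemma exact_projective_retract:
  assumes A: "exact_projective E A" and p: "admissible_epi E P A p"
  shows "retract E A P"
proof -
  have "A \<in> Obj E" "P \<in> Obj E" "p \<in> Hom E P A"
    using p conflation by (auto simp: admissible_epi_def)
  then show ?thesis using exact_projectiveD[OF A p Id_in] unfolding retract_def by blast
qed

lemma exact_injective_retract:
  assumes A: "exact_injective E A" and i: "admissible_mono E A I i"
  shows "retract E A I"
proof -
  have "A \<in> Obj E" "I \<in> Obj E" "i \<in> Hom E A I"
    using i conflation by (auto simp: admissible_mono_def)
  then show ?thesis using exact_injectiveD[OF A i Id_in] unfolding retract_def by blast
qed

end

section \<open>The morphism category\<close>

lemma morphism_cat_simps [simp]:
  "(A, f, B) \<in> Obj (morphism_cat C) \<longleftrightarrow> A \<in> Obj C \<and> B \<in> Obj C \<and> f \<in> Hom C A B"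
  "(a, b) \<in> Hom (morphism_cat C) (A, f, B) (A', f', B') \<longleftrightarrow>
     a \<in> Hom C A A' \<and> b \<in> Hom C B B' \<and> Comp C A A' B' f' a = Comp C A B B' b f"
  "Id (morphism_cat C) (A, f, B) = (Id C A, Id C B)"
  "Comp (morphism_cat C) (A, f, B) (A', f', B') (A'', f'', B'') (a', b') (a, b) =
     (Comp C A A' A'' a' a, Comp C B B' B'' b' b)"
  "Plus (morphism_cat C) (A, f, B) (A', f', B') (a, b) (c, d) = (Plus C A A' a c, Plus C B B' b d)"
  "Zero (morphism_cat C) (A, f, B) (A', f', B') = (Zero C A A', Zero C B B')"
  by (simp_all add: morphism_cat_def)

lemma exact_subcat_simps [simp]:
  "Obj (exact_subcat C XX) = XX"
  "Hom (exact_subcat C XX) = Hom C"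
  "Id (exact_subcat C XX) = Id C"
  "Comp (exact_subcat C XX) = Comp C"
  "Plus (exact_subcat C XX) = Plus C"
  "Zero (exact_subcat C XX) = Zero C"
  "(A, i, B, p, D) \<in> Conflations (exact_subcat C XX) \<longleftrightarrow>
     short_exact C (A, i, B, p, D) \<and> A \<in> XX \<and> B \<in> XX \<and> D \<in> XX"
  by (simp_all add: exact_subcat_def)

lemma mono_cat_simps [simp]:
  "Obj (mono_cat C XX) = mono_objects C XX"
  "Hom (mono_cat C XX) = Hom (morphism_cat C)"
  "Id (mono_cat C XX) = Id (morphism_cat C)"
  "Comp (mono_cat C XX) = Comp (morphism_cat C)"
  "Plus (mono_cat C XX) = Plus (morphism_cat C)"
  "Zero (mono_cat C XX) = Zero (morphism_cat C)"
  "(M, i, N, p, L) \<in> Conflations (mono_cat C XX) \<longleftrightarrow>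
     short_exact (morphism_cat C) (M, i, N, p, L) \<and>
     M \<in> mono_objects C XX \<and> N \<in> mono_objects C XX \<and> L \<in> mono_objects C XX"
  by (simp_all add: mono_cat_def)

lemma is_kernelI:
  assumes "i \<in> Hom C K A" "Comp C K A B f i = Zero C K B"
    and "\<And>T t. \<lbrakk>T \<in> Obj C; t \<in> Hom C T A; Comp C T A B f t = Zero C T B\<rbrakk> \<Longrightarrow>
      \<exists>u\<in>Hom C T K. Comp C T K A i u = t"
    and "\<And>T u v. \<lbrakk>T \<in> Obj C; u \<in> Hom C T K; v \<in> Hom C T K; Comp C T K A i u = Comp C T K A i v\<rbrakk>
      \<Longrightarrow> u = v"
  shows "is_kernel C K i A f B"
  using assms unfolding is_kernel_def by metis

lemma is_cokernelI:
  assumes "p \<in> Hom C B Q" "Comp C A B Q p f = Zero C A Q"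
    and "\<And>T t. \<lbrakk>T \<in> Obj C; t \<in> Hom C B T; Comp C A B T t f = Zero C A T\<rbrakk> \<Longrightarrow>
      \<exists>u\<in>Hom C Q T. Comp C B Q T u p = t"
    and "\<And>T u v. \<lbrakk>T \<in> Obj C; u \<in> Hom C Q T; v \<in> Hom C Q T; Comp C B Q T u p = Comp C B Q T v p\<rbrakk>
      \<Longrightarrow> u = v"
  shows "is_cokernel C A f B p Q"
  using assms unfolding is_cokernel_def by metis

lemma is_kernel_ex1:
  "\<lbrakk>is_kernel C K i A f B; T \<in> Obj C; t \<in> Hom C T A; Comp C T A B f t = Zero C T B\<rbrakk>
    \<Longrightarrow> \<exists>!u. u \<in> Hom C T K \<and> Comp C T K A i u = t"
  unfolding is_kernel_def by simp

lemma is_cokernel_ex1: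
  "\<lbrakk>is_cokernel C A f B p Q; T \<in> Obj C; t \<in> Hom C B T; Comp C A B T t f = Zero C A T\<rbrakk>
    \<Longrightarrow> \<exists>!u. u \<in> Hom C Q T \<and> Comp C B Q T u p = t"
  unfolding is_cokernel_def by simp

lemma is_kernelE:
  "\<lbrakk>is_kernel C K i A f B; T \<in> Obj C; t \<in> Hom C T A; Comp C T A B f t = Zero C T B\<rbrakk>
    \<Longrightarrow> \<exists>u\<in>Hom C T K. Comp C T K A i u = t"
  using is_kernel_ex1[of C K i A f B T t] by blast

lemma is_cokernelE:
  "\<lbrakk>is_cokernel C A f B p Q; T \<in> Obj C; t \<in> Hom C B T; Comp C A B T t f = Zero C A T\<rbrakk>
    \<Longrightarrow> \<exists>u\<in>Hom C Q T. Comp C B Q T u p = t"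
  using is_cokernel_ex1[of C A f B p Q T t] by blast

context preadditive
begin

lemma kernel_cancel:
  assumes k: "is_kernel C K i A f B" and f: "f \<in> Hom C A B"
    and ob: "K \<in> Obj C" "A \<in> Obj C" "B \<in> Obj C" "T \<in> Obj C"
    and uv: "u \<in> Hom C T K" "v \<in> Hom C T K" "Comp C T K A i u = Comp C T K A i v"
  shows "u = v"
proof -
  have i: "i \<in> Hom C K A" "Comp C K A B f i = Zero C K B" using k by (auto simp: is_kernel_def)
  then have "Comp C T A B f (Comp C T K A i u) = Zero C T B"
    using f ob uv(1) by (simp add: Comp_assoc[symmetric])
  then have "\<exists>!w. w \<in> Hom C T K \<and> Comp C T K A i w = Comp C T K A i u"
    using i f ob uv(1) by (intro is_kernel_ex1[OF k]) simp_all
  then show ?thesis using uv by metis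
qed

lemma cokernel_cancel:
  assumes k: "is_cokernel C A f B p Q" and f: "f \<in> Hom C A B"
    and ob: "A \<in> Obj C" "B \<in> Obj C" "Q \<in> Obj C" "T \<in> Obj C"
    and uv: "u \<in> Hom C Q T" "v \<in> Hom C Q T" "Comp C B Q T u p = Comp C B Q T v p"
  shows "u = v"
proof -
  have p: "p \<in> Hom C B Q" "Comp C A B Q p f = Zero C A Q" using k by (auto simp: is_cokernel_def)
  then have "Comp C A B T (Comp C B Q T u p) f = Zero C A T"
    using f ob uv(1) by (simp add: Comp_assoc)
  then have "\<exists>!w. w \<in> Hom C Q T \<and> Comp C B Q T w p = Comp C B Q T u p"
    using p f ob uv(1) by (intro is_cokernel_ex1[OF k]) simp_all
  then show ?thesis using uv by metis
qed

lemma short_exact_epi: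
  assumes "short_exact C (A, i, B, p, D)"
  shows "epimorphism C B D p"
proof -
  have k: "is_cokernel C A i B p D" "i \<in> Hom C A B" "p \<in> Hom C B D"
    and ob: "A \<in> Obj C" "B \<in> Obj C" "D \<in> Obj C"
    using assms by (auto simp: short_exact_def is_kernel_def is_cokernel_def)
  show ?thesis
    unfolding epimorphism_def using k(3) cokernel_cancel[OF k(1,2) ob] by simp
qed

lemma short_exact_mono:
  assumes "short_exact C (A, i, B, p, D)"
  shows "monomorphism C A B i"
proof -
  have k: "is_kernel C A i B p D" "p \<in> Hom C B D" "i \<in> Hom C A B"
    and ob: "A \<in> Obj C" "B \<in> Obj C" "D \<in> Obj C"
    using assms by (auto simp: short_exact_def is_kernel_def is_cokernel_def)
  show ?thesis
    unfolding monomorphism_def using k(3) kernel_cancel[OF k(1,2) ob] by simp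
qed

end

lemma preadditive_exact_subcat:
  fixes C :: "('o, 'h) cat"
  assumes "preadditive C" "XX \<subseteq> Obj C"
  shows "preadditive_exact (exact_subcat C XX)"
proof -
  interpret preadditive C by fact
  show ?thesis
  proof (unfold_locales, goal_cases)
    case (14 A i B p D)
    then show ?case
      by (auto simp: short_exact_def is_kernel_def is_cokernel_def)
  qed (use assms(2) in \<open>auto simp: subset_iff Comp_assoc Plus_assoc Comp_Plus Plus_Comp
      intro: Plus_comm Plus_inverse\<close>)
qed

locale preadditive_zero = preadditive C for C :: "('o, 'h) cat" +
  assumes zero_exists: "\<exists>Z. zero_object C Z"
begin

lemma paste_squares:
  assumes "a \<in> Hom C A A'" "b \<in> Hom C B B'" "a' \<in> Hom C A' A''" "b' \<in> Hom C B' B''"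
    and "f \<in> Hom C A B" "f' \<in> Hom C A' B'" "f'' \<in> Hom C A'' B''"
    and "A \<in> Obj C" "A' \<in> Obj C" "A'' \<in> Obj C" "B \<in> Obj C" "B' \<in> Obj C" "B'' \<in> Obj C"
    and 1: "Comp C A A' B' f' a = Comp C A B B' b f"
    and 2: "Comp C A' A'' B'' f'' a' = Comp C A' B' B'' b' f'"
  shows "Comp C A A'' B'' f'' (Comp C A A' A'' a' a) = Comp C A B B'' (Comp C B B' B'' b' b) f"
proof -
  have "Comp C A A'' B'' f'' (Comp C A A' A'' a' a) = Comp C A A' B'' (Comp C A' A'' B'' f'' a') a"
    using assms(1-13) by (simp add: Comp_assoc)
  also have "\<dots> = Comp C A B' B'' b' (Comp C A A' B' f' a)"
    using assms(1-13) by (simp add: 2 Comp_assoc)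
  also have "\<dots> = Comp C A B B'' (Comp C B B' B'' b' b) f"
    using assms(1-13) by (simp add: 1 Comp_assoc)
  finally show ?thesis .
qed

lemma preadditive_morphism_cat: "preadditive (morphism_cat C)"
proof (unfold_locales, goal_cases)
  case (2 f A B g D)
  then show ?case
    by (cases f; cases A; cases B; cases g; cases D) (auto intro: paste_squares)
next
  case (3 f A B g D h E)
  then show ?case
    by (cases f; cases A; cases B; cases g; cases D; cases h; cases E) (simp add: Comp_assoc)
next
  case (6 f A B g)
  then show ?case
    by (cases f; cases A; cases B; cases g) (simp add: Comp_Plus Plus_Comp)
next
  case (8 f A B g h)
  then show ?case
    by (cases f; cases A; cases B; cases g; cases h) (simp add: Plus_assoc)
next
  case (9 f A B g)
  then show ?case
    by (cases f; cases A; cases B; cases g) (simp add: Plus_comm)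
next
  case (11 f A B)
  obtain A1 x A2 where A: "A = (A1, x, A2)" by (metis prod_cases3)
  obtain B1 y B2 where B: "B = (B1, y, B2)" by (metis prod_cases3)
  obtain f1 f2 where f: "f = (f1, f2)" by fastforce
  have h: "f1 \<in> Hom C A1 B1" "f2 \<in> Hom C A2 B2" "x \<in> Hom C A1 A2" "y \<in> Hom C B1 B2"
    "A1 \<in> Obj C" "A2 \<in> Obj C" "B1 \<in> Obj C" "B2 \<in> Obj C"
    "Comp C A1 B1 B2 y f1 = Comp C A1 A2 B2 f2 x"
    using 11 by (simp_all add: A B f)
  obtain g1 where g1: "g1 \<in> Hom C A1 B1" "Plus C A1 B1 f1 g1 = Zero C A1 B1"
    using Plus_inverse h by blast
  obtain g2 where g2: "g2 \<in> Hom C A2 B2" "Plus C A2 B2 f2 g2 = Zero C A2 B2"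
    using Plus_inverse h by blast
  have "Plus C A1 B2 (Comp C A1 B1 B2 y f1) (Comp C A1 B1 B2 y g1) =
      Comp C A1 B1 B2 y (Plus C A1 B1 f1 g1)"
    by (intro Comp_Plus[symmetric] h g1(1))
  also have "\<dots> = Zero C A1 B2" using h g1 by simp
  also have "\<dots> = Comp C A1 A2 B2 (Plus C A2 B2 f2 g2) x" using h g2 by simp
  also have "\<dots> = Plus C A1 B2 (Comp C A1 A2 B2 f2 x) (Comp C A1 A2 B2 g2 x)"
    by (intro Plus_Comp h g2(1))
  finally have "Comp C A1 B1 B2 y g1 = Comp C A1 A2 B2 g2 x"
    using Plus_cancel[of "Comp C A1 B1 B2 y f1" A1 B2 "Comp C A1 B1 B2 y g1" "Comp C A1 A2 B2 g2 x"]
      h g1 g2 by simp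
  then show ?case
    using g1 g2 by (intro bexI[of _ "(g1, g2)"]) (simp_all add: A B f)
next
  case (12 f A B f' g D)
  then show ?case
    by (cases f; cases f'; cases A; cases B; cases g; cases D) (simp add: Comp_Plus)
next
  case (13 f A B g D g')
  then show ?case
    by (cases f; cases g'; cases A; cases B; cases g; cases D) (simp add: Plus_Comp)
qed auto

section \<open>Short exact sequences of morphisms\<close>

context
  fixes A1 f A2 B1 g B2 D1 h D2 i1 i2 p1 p2
  assumes obj: "A1 \<in> Obj C" "A2 \<in> Obj C" "B1 \<in> Obj C" "B2 \<in> Obj C" "D1 \<in> Obj C" "D2 \<in> Obj C"
    and f: "f \<in> Hom C A1 A2" and g: "g \<in> Hom C B1 B2" and h: "h \<in> Hom C D1 D2"
    and i: "i1 \<in> Hom C A1 B1" "i2 \<in> Hom C A2 B2" "Comp C A1 B1 B2 g i1 = Comp C A1 A2 B2 i2 f"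
    and p: "p1 \<in> Hom C B1 D1" "p2 \<in> Hom C B2 D2" "Comp C B1 D1 D2 h p1 = Comp C B1 B2 D2 p2 g"
begin

text \<open>
  Test the kernel property on \<open>(T = T)\<close> to reach the domains, and on \<open>(0 \<rightarrow> T)\<close> to reach the
  codomains. Uniqueness of the factorisations is transported in the same way.
\<close>

lemma kernel_components:
  assumes ker: "is_kernel (morphism_cat C) (A1, f, A2) (i1, i2) (B1, g, B2) (p1, p2) (D1, h, D2)"
  shows "is_kernel C A1 i1 B1 p1 D1" "is_kernel C A2 i2 B2 p2 D2"
proof -
  obtain Z where Z: "zero_object C Z" using zero_exists by blast
  note Zo = zero_object_in[OF Z]
  have pi: "Comp C A1 B1 D1 p1 i1 = Zero C A1 D1" "Comp C A2 B2 D2 p2 i2 = Zero C A2 D2"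
    using ker by (simp_all add: is_kernel_def)
  have uniq: "x = y \<and> x' = y'"
    if "(T, k, T') \<in> Obj (morphism_cat C)"
      "(x, x') \<in> Hom (morphism_cat C) (T, k, T') (A1, f, A2)"
      "(y, y') \<in> Hom (morphism_cat C) (T, k, T') (A1, f, A2)"
      "Comp C T A1 B1 i1 x = Comp C T A1 B1 i1 y" "Comp C T' A2 B2 i2 x' = Comp C T' A2 B2 i2 y'"
    for T k T' x x' y y'
  proof -
    let ?t = "Comp (morphism_cat C) (T, k, T') (A1, f, A2) (B1, g, B2) (i1, i2) (x, x')"
    interpret H: preadditive "morphism_cat C" by (rule preadditive_morphism_cat)
    have "(A1, f, A2) \<in> Obj (morphism_cat C)" "(B1, g, B2) \<in> Obj (morphism_cat C)"
      "(i1, i2) \<in> Hom (morphism_cat C) (A1, f, A2) (B1, g, B2)"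
      using obj f g i by simp_all
    then have "?t \<in> Hom (morphism_cat C) (T, k, T') (B1, g, B2)"
      using that(1,2) H.Comp_in by blast
    moreover have "Comp (morphism_cat C) (T, k, T') (B1, g, B2) (D1, h, D2) (p1, p2) ?t =
        Zero (morphism_cat C) (T, k, T') (D1, h, D2)"
      using that(1,2) obj i(1,2) p(1,2) pi by (simp add: Comp_assoc[symmetric])
    ultimately have "\<exists>!u. u \<in> Hom (morphism_cat C) (T, k, T') (A1, f, A2) \<and>
        Comp (morphism_cat C) (T, k, T') (A1, f, A2) (B1, g, B2) (i1, i2) u = ?t"
      by (intro is_kernel_ex1[OF ker that(1)])
    moreover have "Comp (morphism_cat C) (T, k, T') (A1, f, A2) (B1, g, B2) (i1, i2) (y, y') = ?t"
      using that(4,5) by simp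
    ultimately have "(x, x') = (y, y')" using that(2,3) by blast
    then show ?thesis by simp
  qed
  show "is_kernel C A1 i1 B1 p1 D1"
  proof (rule is_kernelI)
    fix T t assume t: "T \<in> Obj C" "t \<in> Hom C T B1" "Comp C T B1 D1 p1 t = Zero C T D1"
    let ?T = "(T, Id C T, T)"
    have "Comp C T B2 D2 p2 (Comp C T B1 B2 g t) = Comp C T B1 D2 (Comp C B1 B2 D2 p2 g) t"
      using t(1,2) obj p g by (simp add: Comp_assoc)
    also have "\<dots> = Zero C T D2"
      using t obj p(1) h by (simp add: p(3)[symmetric] Comp_assoc)
    finally have "\<exists>u\<in>Hom (morphism_cat C) ?T (A1, f, A2).
        Comp (morphism_cat C) ?T (A1, f, A2) (B1, g, B2) (i1, i2) u = (t, Comp C T B1 B2 g t)"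
      using t obj g by (intro is_kernelE[OF ker]) simp_all
    then show "\<exists>u\<in>Hom C T A1. Comp C T A1 B1 i1 u = t" by auto
  next
    fix T u v assume uv: "T \<in> Obj C" "u \<in> Hom C T A1" "v \<in> Hom C T A1"
      "Comp C T A1 B1 i1 u = Comp C T A1 B1 i1 v"
    have *: "Comp C T A2 B2 i2 (Comp C T A1 A2 f w) = Comp C T B1 B2 g (Comp C T A1 B1 i1 w)"
      if "w \<in> Hom C T A1" for w
      using that uv(1) i obj f g by (simp add: Comp_assoc[symmetric])
    show "u = v"
      using uniq[of T "Id C T" T u "Comp C T A1 A2 f u" v "Comp C T A1 A2 f v"] uv obj f
        *[OF uv(2)] *[OF uv(3)] by simp
  qed (use i pi in simp_all)
  show "is_kernel C A2 i2 B2 p2 D2"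
  proof (rule is_kernelI)
    fix T t assume t: "T \<in> Obj C" "t \<in> Hom C T B2" "Comp C T B2 D2 p2 t = Zero C T D2"
    let ?T = "(Z, Zero C Z T, T)"
    have "\<exists>u\<in>Hom (morphism_cat C) ?T (A1, f, A2).
        Comp (morphism_cat C) ?T (A1, f, A2) (B1, g, B2) (i1, i2) u = (Zero C Z B1, t)"
      using t obj g Zo p by (intro is_kernelE[OF ker]) simp_all
    then show "\<exists>u\<in>Hom C T A2. Comp C T A2 B2 i2 u = t" by auto
  next
    fix T u v assume uv: "T \<in> Obj C" "u \<in> Hom C T A2" "v \<in> Hom C T A2"
      "Comp C T A2 B2 i2 u = Comp C T A2 B2 i2 v"
    show "u = v"
      using uniq[of Z "Zero C Z T" T "Zero C Z A1" u "Zero C Z A1" v] uv obj f Zo by simp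
  qed (use i pi in simp_all)
qed

text \<open>
  Dually, \<open>(T \<rightarrow> 0)\<close> tests the domains and \<open>(T = T)\<close> the codomains.
\<close>

lemma cokernel_components:
  assumes coker: "is_cokernel (morphism_cat C) (A1, f, A2) (i1, i2) (B1, g, B2) (p1, p2) (D1, h, D2)"
  shows "is_cokernel C A1 i1 B1 p1 D1" "is_cokernel C A2 i2 B2 p2 D2"
proof -
  obtain Z where Z: "zero_object C Z" using zero_exists by blast
  note Zo = zero_object_in[OF Z]
  have pi: "Comp C A1 B1 D1 p1 i1 = Zero C A1 D1" "Comp C A2 B2 D2 p2 i2 = Zero C A2 D2"
    using coker by (simp_all add: is_cokernel_def)
  have uniq: "x = y \<and> x' = y'"
    if "(T, k, T') \<in> Obj (morphism_cat C)"
      "(x, x') \<in> Hom (morphism_cat C) (D1, h, D2) (T, k, T')"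
      "(y, y') \<in> Hom (morphism_cat C) (D1, h, D2) (T, k, T')"
      "Comp C B1 D1 T x p1 = Comp C B1 D1 T y p1" "Comp C B2 D2 T' x' p2 = Comp C B2 D2 T' y' p2"
    for T k T' x x' y y'
  proof -
    let ?t = "Comp (morphism_cat C) (B1, g, B2) (D1, h, D2) (T, k, T') (x, x') (p1, p2)"
    interpret H: preadditive "morphism_cat C" by (rule preadditive_morphism_cat)
    have "(B1, g, B2) \<in> Obj (morphism_cat C)" "(D1, h, D2) \<in> Obj (morphism_cat C)"
      "(p1, p2) \<in> Hom (morphism_cat C) (B1, g, B2) (D1, h, D2)"
      using obj h g p by simp_all
    then have "?t \<in> Hom (morphism_cat C) (B1, g, B2) (T, k, T')"
      using that(1,2) H.Comp_in by blast
    moreover have "Comp (morphism_cat C) (A1, f, A2) (B1, g, B2) (T, k, T') ?t (i1, i2) =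
        Zero (morphism_cat C) (A1, f, A2) (T, k, T')"
      using that(1,2) obj i(1,2) p(1,2) pi by (simp add: Comp_assoc)
    ultimately have "\<exists>!u. u \<in> Hom (morphism_cat C) (D1, h, D2) (T, k, T') \<and>
        Comp (morphism_cat C) (B1, g, B2) (D1, h, D2) (T, k, T') u (p1, p2) = ?t"
      by (intro is_cokernel_ex1[OF coker that(1)])
    moreover have "Comp (morphism_cat C) (B1, g, B2) (D1, h, D2) (T, k, T') (y, y') (p1, p2) = ?t"
      using that(4,5) by simp
    ultimately have "(x, x') = (y, y')" using that(2,3) by blast
    then show ?thesis by simp
  qed
  show "is_cokernel C A1 i1 B1 p1 D1"
  proof (rule is_cokernelI)
    fix T t assume t: "T \<in> Obj C" "t \<in> Hom C B1 T" "Comp C A1 B1 T t i1 = Zero C A1 T"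
    let ?T = "(T, Zero C T Z, Z)"
    have "\<exists>u\<in>Hom (morphism_cat C) (D1, h, D2) ?T.
        Comp (morphism_cat C) (B1, g, B2) (D1, h, D2) ?T u (p1, p2) = (t, Zero C B2 Z)"
      using t obj g Zo i by (intro is_cokernelE[OF coker]) simp_all
    then show "\<exists>u\<in>Hom C D1 T. Comp C B1 D1 T u p1 = t" by auto
  next
    fix T u v assume uv: "T \<in> Obj C" "u \<in> Hom C D1 T" "v \<in> Hom C D1 T"
      "Comp C B1 D1 T u p1 = Comp C B1 D1 T v p1"
    show "u = v"
      using uniq[of T "Zero C T Z" Z u "Zero C D2 Z" v "Zero C D2 Z"] uv obj h Zo by simp
  qed (use p pi in simp_all)
  show "is_cokernel C A2 i2 B2 p2 D2"
  proof (rule is_cokernelI)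
    fix T t assume t: "T \<in> Obj C" "t \<in> Hom C B2 T" "Comp C A2 B2 T t i2 = Zero C A2 T"
    let ?T = "(T, Id C T, T)"
    have "Comp C A1 B1 T (Comp C B1 B2 T t g) i1 = Comp C A1 A2 T (Comp C A2 B2 T t i2) f"
      using t(1,2) obj i g f by (simp add: Comp_assoc)
    also have "\<dots> = Zero C A1 T" using t obj f by simp
    finally have "\<exists>u\<in>Hom (morphism_cat C) (D1, h, D2) ?T.
        Comp (morphism_cat C) (B1, g, B2) (D1, h, D2) ?T u (p1, p2) = (Comp C B1 B2 T t g, t)"
      using t obj g by (intro is_cokernelE[OF coker]) simp_all
    then show "\<exists>u\<in>Hom C D2 T. Comp C B2 D2 T u p2 = t" by auto
  next
    fix T u v assume uv: "T \<in> Obj C" "u \<in> Hom C D2 T" "v \<in> Hom C D2 T"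
      "Comp C B2 D2 T u p2 = Comp C B2 D2 T v p2"
    have *: "Comp C B1 D1 T (Comp C D1 D2 T w h) p1 = Comp C B1 B2 T (Comp C B2 D2 T w p2) g"
      if "w \<in> Hom C D2 T" for w
      using that uv(1) p obj h g by (simp add: Comp_assoc)
    show "u = v"
      using uniq[of T "Id C T" T "Comp C D1 D2 T u h" u "Comp C D1 D2 T v h" v] uv obj h
        *[OF uv(2)] *[OF uv(3)] by simp
  qed (use p pi in simp_all)
qed

text \<open>
  The factorisations of the two components commute with the horizontal maps because \<open>i2\<close> is
  monic.
\<close>

lemma kernel_morphism_catI:
  assumes k1: "is_kernel C A1 i1 B1 p1 D1" and k2: "is_kernel C A2 i2 B2 p2 D2"
  shows "is_kernel (morphism_cat C) (A1, f, A2) (i1, i2) (B1, g, B2) (p1, p2) (D1, h, D2)"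
proof (rule is_kernelI)
  note m1 = kernel_cancel[OF k1 p(1) obj(1,3,5)] and m2 = kernel_cancel[OF k2 p(2) obj(2,4,6)]
  {
    fix T t assume T: "T \<in> Obj (morphism_cat C)" "t \<in> Hom (morphism_cat C) T (B1, g, B2)"
      and pt: "Comp (morphism_cat C) T (B1, g, B2) (D1, h, D2) (p1, p2) t =
        Zero (morphism_cat C) T (D1, h, D2)"
    obtain T1 k T2 where T': "T = (T1, k, T2)" by (metis prod_cases3)
    obtain t1 t2 where t': "t = (t1, t2)" by fastforce
    note T = T[unfolded T' t', simplified] and pt = pt[unfolded T' t', simplified]
    obtain u1 where u1: "u1 \<in> Hom C T1 A1" "Comp C T1 A1 B1 i1 u1 = t1"
      using is_kernelE[OF k1, of T1 t1] T pt by blast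
    obtain u2 where u2: "u2 \<in> Hom C T2 A2" "Comp C T2 A2 B2 i2 u2 = t2"
      using is_kernelE[OF k2, of T2 t2] T pt by blast
    have "Comp C T1 A2 B2 i2 (Comp C T1 A1 A2 f u1) = Comp C T1 B1 B2 g (Comp C T1 A1 B1 i1 u1)"
      using u1(1) T(1) i obj f g by (simp add: Comp_assoc[symmetric])
    also have "\<dots> = Comp C T1 T2 B2 (Comp C T2 A2 B2 i2 u2) k"
      unfolding u1(2) u2(2) using T by simp
    also have "\<dots> = Comp C T1 A2 B2 i2 (Comp C T1 T2 A2 u2 k)"
      using u2(1) T(1) i(1,2) obj by (simp add: Comp_assoc)
    finally have "Comp C T1 A1 A2 f u1 = Comp C T1 T2 A2 u2 k"
      using u1(1) u2(1) T(1) obj f m2[of T1 "Comp C T1 A1 A2 f u1" "Comp C T1 T2 A2 u2 k"] by simp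
    then show "\<exists>u\<in>Hom (morphism_cat C) T (A1, f, A2).
        Comp (morphism_cat C) T (A1, f, A2) (B1, g, B2) (i1, i2) u = t"
      using u1 u2 unfolding T' t' by (intro bexI[of _ "(u1, u2)"]) simp_all
  }
  {
    fix T u v assume T: "T \<in> Obj (morphism_cat C)" "u \<in> Hom (morphism_cat C) T (A1, f, A2)"
      "v \<in> Hom (morphism_cat C) T (A1, f, A2)"
      "Comp (morphism_cat C) T (A1, f, A2) (B1, g, B2) (i1, i2) u =
       Comp (morphism_cat C) T (A1, f, A2) (B1, g, B2) (i1, i2) v"
    then show "u = v"
      using m1 m2 by (cases T; cases u; cases v) auto
  }
qed (use i k1 k2 in \<open>simp_all add: is_kernel_def\<close>)

text \<open>
  The factorisations of the two components commute with the horizontal maps because \<open>p1\<close> is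
  epic.
\<close>

lemma cokernel_morphism_catI:
  assumes k1: "is_cokernel C A1 i1 B1 p1 D1" and k2: "is_cokernel C A2 i2 B2 p2 D2"
  shows "is_cokernel (morphism_cat C) (A1, f, A2) (i1, i2) (B1, g, B2) (p1, p2) (D1, h, D2)"
proof (rule is_cokernelI)
  note e1 = cokernel_cancel[OF k1 i(1) obj(1,3,5)] and e2 = cokernel_cancel[OF k2 i(2) obj(2,4,6)]
  {
    fix T t assume T: "T \<in> Obj (morphism_cat C)" "t \<in> Hom (morphism_cat C) (B1, g, B2) T"
      and pt: "Comp (morphism_cat C) (A1, f, A2) (B1, g, B2) T t (i1, i2) =
        Zero (morphism_cat C) (A1, f, A2) T"
    obtain T1 k T2 where T': "T = (T1, k, T2)" by (metis prod_cases3)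
    obtain t1 t2 where t': "t = (t1, t2)" by fastforce
    note T = T[unfolded T' t', simplified] and pt = pt[unfolded T' t', simplified]
    obtain u1 where u1: "u1 \<in> Hom C D1 T1" "Comp C B1 D1 T1 u1 p1 = t1"
      using is_cokernelE[OF k1, of T1 t1] T pt by blast
    obtain u2 where u2: "u2 \<in> Hom C D2 T2" "Comp C B2 D2 T2 u2 p2 = t2"
      using is_cokernelE[OF k2, of T2 t2] T pt by blast
    have "Comp C B1 D1 T2 (Comp C D1 D2 T2 u2 h) p1 = Comp C B1 B2 T2 (Comp C B2 D2 T2 u2 p2) g"
      using u2(1) T(1) p obj h g by (simp add: Comp_assoc)
    also have "\<dots> = Comp C B1 T1 T2 k (Comp C B1 D1 T1 u1 p1)"
      unfolding u1(2) u2(2) using T by simp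
    also have "\<dots> = Comp C B1 D1 T2 (Comp C D1 T1 T2 k u1) p1"
      using u1(1) T(1) p(1,2) obj by (simp add: Comp_assoc)
    finally have "Comp C D1 D2 T2 u2 h = Comp C D1 T1 T2 k u1"
      using u1(1) u2(1) T(1) obj h e1[of T2 "Comp C D1 D2 T2 u2 h" "Comp C D1 T1 T2 k u1"] by simp
    then show "\<exists>u\<in>Hom (morphism_cat C) (D1, h, D2) T.
        Comp (morphism_cat C) (B1, g, B2) (D1, h, D2) T u (p1, p2) = t"
      using u1 u2 unfolding T' t' by (intro bexI[of _ "(u1, u2)"]) simp_all
  }
  {
    fix T u v assume T: "T \<in> Obj (morphism_cat C)" "u \<in> Hom (morphism_cat C) (D1, h, D2) T"
      "v \<in> Hom (morphism_cat C) (D1, h, D2) T"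
      "Comp (morphism_cat C) (B1, g, B2) (D1, h, D2) T u (p1, p2) =
       Comp (morphism_cat C) (B1, g, B2) (D1, h, D2) T v (p1, p2)"
    then show "u = v"
      using e1 e2 by (cases T; cases u; cases v) auto
  }
qed (use p k1 k2 in \<open>simp_all add: is_cokernel_def\<close>)

end

text \<open>
  Both directions are formal: kernels and cokernels of morphisms are computed in the two
  components.
\<close>

lemma short_exact_morphism_cat:
  "short_exact (morphism_cat C) ((A1, f, A2), (i1, i2), (B1, g, B2), (p1, p2), (D1, h, D2)) \<longleftrightarrow>
   f \<in> Hom C A1 A2 \<and> g \<in> Hom C B1 B2 \<and> h \<in> Hom C D1 D2 \<and>
   Comp C A1 B1 B2 g i1 = Comp C A1 A2 B2 i2 f \<and> Comp C B1 D1 D2 h p1 = Comp C B1 B2 D2 p2 g \<and>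
   short_exact C (A1, i1, B1, p1, D1) \<and> short_exact C (A2, i2, B2, p2, D2)" (is "?l \<longleftrightarrow> ?r")
proof
  assume l: ?l
  then have *: "A1 \<in> Obj C" "A2 \<in> Obj C" "B1 \<in> Obj C" "B2 \<in> Obj C" "D1 \<in> Obj C" "D2 \<in> Obj C"
    "f \<in> Hom C A1 A2" "g \<in> Hom C B1 B2" "h \<in> Hom C D1 D2"
    "i1 \<in> Hom C A1 B1" "i2 \<in> Hom C A2 B2" "Comp C A1 B1 B2 g i1 = Comp C A1 A2 B2 i2 f"
    "p1 \<in> Hom C B1 D1" "p2 \<in> Hom C B2 D2" "Comp C B1 D1 D2 h p1 = Comp C B1 B2 D2 p2 g"
    by (simp_all add: short_exact_def is_kernel_def is_cokernel_def)
  show ?r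
    using kernel_components[OF *] cokernel_components[OF *] l * by (simp add: short_exact_def)
next
  assume r: ?r
  then have *: "A1 \<in> Obj C" "A2 \<in> Obj C" "B1 \<in> Obj C" "B2 \<in> Obj C" "D1 \<in> Obj C" "D2 \<in> Obj C"
    "f \<in> Hom C A1 A2" "g \<in> Hom C B1 B2" "h \<in> Hom C D1 D2"
    "i1 \<in> Hom C A1 B1" "i2 \<in> Hom C A2 B2" "Comp C A1 B1 B2 g i1 = Comp C A1 A2 B2 i2 f"
    "p1 \<in> Hom C B1 D1" "p2 \<in> Hom C B2 D2" "Comp C B1 D1 D2 h p1 = Comp C B1 B2 D2 p2 g"
    by (simp_all add: short_exact_def is_kernel_def is_cokernel_def)
  show ?l
    using kernel_morphism_catI[OF *] cokernel_morphism_catI[OF *] r * by (simp add: short_exact_def)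
qed

end

section \<open>Split monomorphisms and indecomposable objects\<close>

context preadditive_zero
begin

lemma biproduct_Id_zero:
  assumes "zero_object C Z" "A \<in> Obj C"
  shows "biproduct C A A Z (Id C A) (Zero C Z A) (Id C A) (Zero C A Z)"
  using assms zero_object_in[OF assms(1)] zero_object_iff[of Z] by (simp add: biproduct_def)

lemma biproduct_cokernel:
  assumes "biproduct C S A B i j p q"
  shows "is_cokernel C A i S q B"
proof (rule is_cokernelI)
  note b = biproduct_arrows[OF assms]
  show "q \<in> Hom C S B" "Comp C A S B q i = Zero C A B"
    using assms by (simp_all add: biproduct_def)
  have qj: "Comp C B S B q j = Id C B" using assms by (simp add: biproduct_def)
  fix T assume T: "T \<in> Obj C"
  {
    fix t assume t: "t \<in> Hom C S T" "Comp C A S T t i = Zero C A T"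
    have "Comp C S B T (Comp C B S T t j) q = t"
      using biproduct_expand_source[OF assms t(1) T] t b T by simp
    then show "\<exists>u\<in>Hom C B T. Comp C S B T u q = t" using t b T by blast
  next
    fix u v assume uv: "u \<in> Hom C B T" "v \<in> Hom C B T" "Comp C S B T u q = Comp C S B T v q"
    have "Comp C B S T (Comp C S B T w q) j = w" if "w \<in> Hom C B T" for w
      using retraction_Comp[of j B S q w T] that b qj T by simp
    then show "u = v" using uv by metis
  }
qed

lemma split_mono_monomorphism:
  assumes "i \<in> Hom C A S" "p \<in> Hom C S A" "Comp C A S A p i = Id C A" "A \<in> Obj C" "S \<in> Obj C"
  shows "monomorphism C A S i"
  unfolding monomorphism_def
proof (intro conjI assms ballI impI)
  fix T u v assume "T \<in> Obj C" "u \<in> Hom C T A" "v \<in> Hom C T A"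
    "Comp C T A S i u = Comp C T A S i v"
  then show "u = v" using Comp_retraction[OF assms(1-3)] assms by metis
qed

lemma monomorphism_to_zero:
  assumes "monomorphism C A B f" "zero_object C B" "A \<in> Obj C"
  shows "zero_object C A"
proof -
  have B: "B \<in> Obj C" using assms zero_object_in by simp
  have f: "f \<in> Hom C A B" using assms by (simp add: monomorphism_def)
  then have "f = Zero C A B" using assms Hom_to_zero by blast
  then have "Comp C A A B f (Id C A) = Comp C A A B f (Zero C A A)" using assms f B by simp
  then have "Id C A = Zero C A A"
    using assms unfolding monomorphism_def by (metis Id_in Zero_in)
  then show ?thesis using assms zero_object_iff by simp
qed

end

locale additive_subcat = preadditive_zero C for C :: "('o, 'h) cat" +
  fixes XX :: "'o set"
  assumes subcat: "XX \<subseteq> Obj C"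
    and zero_mem: "zero_object C Z \<Longrightarrow> Z \<in> XX"
    and summands: "\<lbrakk>direct_sum C S A B; S \<in> XX\<rbrakk> \<Longrightarrow> A \<in> XX \<and> B \<in> XX"
begin

lemma obj [intro]: "A \<in> XX \<Longrightarrow> A \<in> Obj C"
  using subcat by blast

lemma mono_objectsD:
  assumes "(A, f, B) \<in> mono_objects C XX"
  shows "A \<in> XX" "B \<in> XX" "A \<in> Obj C" "B \<in> Obj C" "f \<in> Hom C A B" "monomorphism C A B f"
  using assms subcat by (auto simp: mono_objects_def monomorphism_def)

text \<open>
  The objects \<open>(A = A)\<close> and \<open>(0 \<rightarrow> B)\<close> are the cases \<open>A \<oplus> 0\<close> and \<open>0 \<oplus> B\<close> of this lemma.
\<close>

lemma mono_objects_biproduct: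
  assumes "biproduct C S A B i j p q" "A \<in> XX" "S \<in> XX"
  shows "(A, i, S) \<in> mono_objects C XX"
proof -
  have "B \<in> XX" using summands assms unfolding direct_sum_iff by blast
  moreover have "monomorphism C A S i"
    using assms(1) split_mono_monomorphism[of i A S p] by (simp add: biproduct_def)
  ultimately show ?thesis
    using assms biproduct_cokernel[OF assms(1)] by (auto simp: mono_objects_def)
qed

lemma mono_objects_Id:
  assumes "A \<in> XX"
  shows "(A, Id C A, A) \<in> mono_objects C XX"
  using zero_exists mono_objects_biproduct biproduct_Id_zero assms by blast

lemma mono_objects_Zero:
  assumes "zero_object C Z" "B \<in> XX"
  shows "(Z, Zero C Z B, B) \<in> mono_objects C XX"
  using mono_objects_biproduct biproduct_zero_left zero_mem assms by blast

sublocale mono: preadditive_exact "mono_cat C XX"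
proof -
  have "mono_objects C XX \<subseteq> Obj (morphism_cat C)"
    using mono_objectsD by (auto simp: subset_iff)
  then show "preadditive_exact (mono_cat C XX)"
    unfolding mono_cat_def by (intro preadditive_exact_subcat preadditive_morphism_cat)
qed

sublocale sub: preadditive_exact "exact_subcat C XX"
  using preadditive_exact_subcat preadditive_axioms subcat by blast

lemma zero_object_mono_cat:
  assumes "(A, f, B) \<in> mono_objects C XX"
  shows "zero_object (mono_cat C XX) (A, f, B) \<longleftrightarrow> zero_object C A \<and> zero_object C B"
  using assms mono_objectsD[OF assms]
  by (simp add: mono.zero_object_iff zero_object_iff)

lemma zero_object_mono_cat_iff_codomain:
  assumes "(A, f, B) \<in> mono_objects C XX"
  shows "zero_object (mono_cat C XX) (A, f, B) \<longleftrightarrow> zero_object C B"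
  using zero_object_mono_cat[OF assms] monomorphism_to_zero mono_objectsD[OF assms] by blast

lemma zero_object_subcat:
  assumes "A \<in> XX"
  shows "zero_object (exact_subcat C XX) A \<longleftrightarrow> zero_object C A"
  using assms obj[OF assms] by (simp add: sub.zero_object_iff zero_object_iff)

lemma biproduct_subcat:
  "biproduct (exact_subcat C XX) S A B i j p q \<longleftrightarrow>
     biproduct C S A B i j p q \<and> S \<in> XX \<and> A \<in> XX \<and> B \<in> XX"
  using subcat by (auto simp: biproduct_def)

lemma biproduct_mono_cat:
  "biproduct (mono_cat C XX) (S, k, S') (A, f, A') (B, g, B') (i, i') (j, j') (p, p') (q, q') \<longleftrightarrow>
     (S, k, S') \<in> mono_objects C XX \<and> (A, f, A') \<in> mono_objects C XX \<and>
     (B, g, B') \<in> mono_objects C XX \<and>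
     biproduct C S A B i j p q \<and> biproduct C S' A' B' i' j' p' q' \<and>
     Comp C A S S' k i = Comp C A A' S' i' f \<and> Comp C B S S' k j = Comp C B B' S' j' g \<and>
     Comp C S A A' f p = Comp C S S' A' p' k \<and> Comp C S B B' g q = Comp C S S' B' q' k"
  using mono_objectsD by (auto simp: biproduct_def)

lemma indecomposable_subcat:
  assumes "A \<in> XX"
  shows "indecomposable (exact_subcat C XX) A \<longleftrightarrow> indecomposable C A"
proof -
  have ds: "direct_sum (exact_subcat C XX) A B D \<longleftrightarrow> direct_sum C A B D" for B D
    using summands[of A B D] assms unfolding direct_sum_iff biproduct_subcat by blast
  have "B \<in> XX" "D \<in> XX" if "direct_sum C A B D" for B D
    using summands[OF that assms] by auto
  then show ?thesis
    using assms obj[OF assms] unfolding indecomposable_def ds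
    by (auto simp: zero_object_subcat)
qed

text \<open>
  A decomposition of \<open>(A \<rightarrow> B)\<close> decomposes \<open>B\<close>, and a summand with zero codomain is zero. This
  covers \<open>(P = P)\<close> and \<open>(0 \<rightarrow> P)\<close> at once.
\<close>

lemma indecomposable_codomain:
  assumes M: "(A, f, B) \<in> mono_objects C XX" and B: "indecomposable (exact_subcat C XX) B"
  shows "indecomposable (mono_cat C XX) (A, f, B)"
proof -
  note M' = mono_objectsD[OF M]
  have "zero_object (mono_cat C XX) U \<or> zero_object (mono_cat C XX) V"
    if ds: "direct_sum (mono_cat C XX) (A, f, B) U V" for U V
  proof -
    obtain A1 f1 B1 A2 f2 B2 where UV: "U = (A1, f1, B1)" "V = (A2, f2, B2)"
      by (metis prod_cases3)
    obtain i j p q where b: "biproduct (mono_cat C XX) (A, f, B) U V i j p q"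
      using ds unfolding direct_sum_iff by blast
    then have objs: "(A1, f1, B1) \<in> mono_objects C XX" "(A2, f2, B2) \<in> mono_objects C XX"
      by (auto simp: biproduct_def UV)
    have "direct_sum C B B1 B2"
      using b UV unfolding direct_sum_iff
      by (cases i; cases j; cases p; cases q) (auto simp: biproduct_mono_cat)
    then have "zero_object C B1 \<or> zero_object C B2"
      using B M' indecomposable_subcat unfolding indecomposable_def by blast
    then show ?thesis using objs UV zero_object_mono_cat_iff_codomain by auto
  qed
  moreover have "\<not> zero_object (mono_cat C XX) (A, f, B)"
    using B M M' by (auto simp: indecomposable_def zero_object_mono_cat zero_object_subcat)
  ultimately show ?thesis using M by (auto simp: indecomposable_def)
qed

text \<open>
  A split monomorphism with complement \<open>Q\<close> is \<open>(A = A) \<oplus> (0 \<rightarrow> Q)\<close>.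
\<close>

lemma biproduct_split_mono:
  assumes M: "(A, f, B) \<in> mono_objects C XX" and b: "biproduct C B A Q f j r q"
    and Z: "zero_object C Z"
  shows "biproduct (mono_cat C XX) (A, f, B) (A, Id C A, A) (Z, Zero C Z Q, Q)
    (Id C A, f) (Zero C Z A, j) (Id C A, r) (Zero C A Z, q)"
proof -
  note M' = mono_objectsD[OF M]
  have "Q \<in> XX" using summands M' b unfolding direct_sum_iff by blast
  then show ?thesis
    using M b M' biproduct_arrows[OF b] mono_objects_Id mono_objects_Zero[OF Z] zero_object_in[OF Z]
      biproduct_Id_zero[OF Z]
    by (simp add: biproduct_mono_cat) (simp add: biproduct_def)
qed

lemma indecomposable_Id_domain:
  assumes ind: "indecomposable (mono_cat C XX) (A, Id C A, A)" and A: "A \<in> XX"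
  shows "indecomposable (exact_subcat C XX) A"
proof -
  note I = mono_objects_Id
  have "zero_object (exact_subcat C XX) U \<or> zero_object (exact_subcat C XX) V"
    if ds: "direct_sum (exact_subcat C XX) A U V" for U V
  proof -
    obtain i j p q where b: "biproduct C A U V i j p q" and UV: "U \<in> XX" "V \<in> XX"
      using ds unfolding direct_sum_iff biproduct_subcat by blast
    have "biproduct (mono_cat C XX) (A, Id C A, A) (U, Id C U, U) (V, Id C V, V)
        (i, i) (j, j) (p, p) (q, q)"
      using b biproduct_arrows[OF b] A UV by (simp add: biproduct_mono_cat I)
    then have "zero_object (mono_cat C XX) (U, Id C U, U) \<or> zero_object (mono_cat C XX) (V, Id C V, V)"
      using ind unfolding indecomposable_def direct_sum_iff by blast
    then show ?thesis using UV by (simp add: zero_object_mono_cat I zero_object_subcat)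
  qed
  moreover have "\<not> zero_object (exact_subcat C XX) A"
    using ind A by (simp add: indecomposable_def zero_object_mono_cat I zero_object_subcat)
  ultimately show ?thesis using A by (auto simp: indecomposable_def)
qed

lemma indecomposable_Zero_codomain:
  assumes ind: "indecomposable (mono_cat C XX) (Z, Zero C Z B, B)" and B: "B \<in> XX"
    and Z: "zero_object C Z"
  shows "indecomposable (exact_subcat C XX) B"
proof -
  note I = mono_objects_Zero[OF Z] and Z' = zero_object_in[OF Z]
  have "zero_object (exact_subcat C XX) U \<or> zero_object (exact_subcat C XX) V"
    if ds: "direct_sum (exact_subcat C XX) B U V" for U V
  proof -
    obtain i j p q where b: "biproduct C B U V i j p q" and UV: "U \<in> XX" "V \<in> XX"
      using ds unfolding direct_sum_iff biproduct_subcat by blast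
    have "biproduct (mono_cat C XX) (Z, Zero C Z B, B) (Z, Zero C Z U, U) (Z, Zero C Z V, V)
        (Id C Z, i) (Zero C Z Z, j) (Id C Z, p) (Zero C Z Z, q)"
      using b biproduct_arrows[OF b] B UV Z' biproduct_Id_zero[OF Z Z'] zero_object_iff[OF Z'] Z
      by (simp add: biproduct_mono_cat I)
    then have "zero_object (mono_cat C XX) (Z, Zero C Z U, U) \<or>
        zero_object (mono_cat C XX) (Z, Zero C Z V, V)"
      using ind unfolding indecomposable_def direct_sum_iff by blast
    then show ?thesis using UV by (auto simp: zero_object_mono_cat I zero_object_subcat)
  qed
  moreover have "\<not> zero_object (exact_subcat C XX) B"
    using ind B Z by (simp add: indecomposable_def zero_object_mono_cat I zero_object_subcat)
  ultimately show ?thesis using B by (auto simp: indecomposable_def)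
qed

text \<open>
  One of the summands \<open>(A = A)\<close> and \<open>(0 \<rightarrow> Q)\<close> vanishes: if \<open>A = 0\<close> the object is \<open>(0 \<rightarrow> B)\<close>,
  and if \<open>Q = 0\<close> then \<open>f\<close> is invertible.
\<close>

lemma indecomposable_split_mono_cases:
  assumes ind: "indecomposable (mono_cat C XX) (A, f, B)" and b: "biproduct C B A Q f j r q"
  shows "indecomposable (exact_subcat C XX) A \<and> isomorphic (mono_cat C XX) (A, f, B) (A, Id C A, A) \<or>
    zero_object C A \<and> f = Zero C A B \<and> indecomposable (exact_subcat C XX) B"
proof -
  obtain Z where Z: "zero_object C Z" using zero_exists by blast
  have M: "(A, f, B) \<in> mono_objects C XX" using ind by (simp add: indecomposable_def)
  note M' = mono_objectsD[OF M] and b' = biproduct_arrows[OF b] and I = mono_objects_Id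
  have Q: "Q \<in> XX" using summands M' b unfolding direct_sum_iff by blast
  consider "zero_object (mono_cat C XX) (A, Id C A, A)" |
    "zero_object (mono_cat C XX) (Z, Zero C Z Q, Q)"
    using ind biproduct_split_mono[OF M b Z] unfolding indecomposable_def direct_sum_iff by blast
  then show ?thesis
  proof cases
    case 1
    then have A: "zero_object C A" using M' I by (simp add: zero_object_mono_cat)
    then have "f = Zero C A B" using Hom_from_zero M' by blast
    then show ?thesis using A ind M' indecomposable_Zero_codomain by blast
  next
    case 2
    then have Qz: "zero_object C Q" using Q Z by (simp add: zero_object_mono_cat mono_objects_Zero)
    have rf: "Comp C A B A r f = Id C A" using b by (simp add: biproduct_def)
    have "q = Zero C B Q" using Hom_to_zero[OF Qz] b' by blast
    then have fr: "Comp C B A B f r = Id C B"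
      using biproduct_sum[OF b] b' by simp
    have "isomorphic (mono_cat C XX) (A, f, B) (A, Id C A, A)"
      using M M' b' I rf fr unfolding isomorphic_def
      by (intro conjI bexI[of _ "(Id C A, r)"] bexI[of _ "(Id C A, f)"]) simp_all
    then show ?thesis
      using mono.indecomposable_iso ind indecomposable_Id_domain M'(1) by blast
  qed
qed

text \<open>
  Let \<open>(s, t)\<close> be the inclusion and \<open>(r, w)\<close> the retraction. Then \<open>r p t f = r p i s = r s = 1\<close>,
  so \<open>f\<close> splits. If \<open>A = 0\<close>, then \<open>w i = f r = 0\<close>, whence \<open>w\<close> factors through \<open>q\<close> and \<open>B\<close> is a
  retract of \<open>J\<close>.
\<close>

lemma retract_of_split_mono:
  assumes ret: "retract (mono_cat C XX) (A, f, B) (I, i, S)" and b: "biproduct C S I J i j p q"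
  shows "\<exists>r\<in>Hom C B A. Comp C A B A r f = Id C A" "retract C A I"
    "zero_object C A \<Longrightarrow> retract C B J"
proof -
  have M: "(A, f, B) \<in> mono_objects C XX" using ret by (simp add: retract_def)
  note M' = mono_objectsD[OF M] and b' = biproduct_arrows[OF b]
  obtain s t r w where st: "s \<in> Hom C A I" "t \<in> Hom C B S" "Comp C A I S i s = Comp C A B S t f"
    and rw: "r \<in> Hom C I A" "w \<in> Hom C S B" "Comp C I A B f r = Comp C I S B w i"
    and eq: "Comp C A I A r s = Id C A" "Comp C B S B w t = Id C B"
    using ret by (auto simp: retract_def)
  have pi: "Comp C I S I p i = Id C I" using b by (simp add: biproduct_def)
  have "Comp C A B A (Comp C B I A r (Comp C B S I p t)) f =
      Comp C A I A r (Comp C A S I p (Comp C A B S t f))"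
    using st(1,2) rw(1,2) b' M' by (simp add: Comp_assoc)
  also have "\<dots> = Comp C A I A r s"
    using st(1) b' M' pi Comp_retraction[of i I S p s A] by (simp add: st(3)[symmetric])
  finally have "Comp C A B A (Comp C B I A r (Comp C B S I p t)) f = Id C A" using eq by simp
  then show "\<exists>r\<in>Hom C B A. Comp C A B A r f = Id C A" using st rw b' M' by blast
  show "retract C A I" using st rw eq M' b' by (auto simp: retract_def)
  show "retract C B J" if A: "zero_object C A"
  proof -
    have "r = Zero C I A" using Hom_to_zero[OF A] rw b' by blast
    then have wi: "Comp C I S B w i = Zero C I B" using rw M' b' by simp
    have "Comp C B J B (Comp C J S B w j) (Comp C B S J q t) =
        Comp C B S B (Comp C S J B (Comp C J S B w j) q) t"
      using st(2) rw(2) b' M' by (simp add: Comp_assoc)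
    also have "Comp C S J B (Comp C J S B w j) q = w"
      using biproduct_expand_source[OF b rw(2) M'(4)] wi rw(2) b' M' by simp
    finally have "Comp C B J B (Comp C J S B w j) (Comp C B S J q t) = Id C B" using eq by simp
    then show ?thesis using st rw b' M' unfolding retract_def by blast
  qed
qed

text \<open>
  The first alternative gives the objects \<open>(A = A)\<close>, the second the objects \<open>(0 \<rightarrow> B)\<close>. The
  retractions carry projectivity or injectivity from \<open>I\<close> and \<open>J\<close> over to \<open>A\<close> and \<open>B\<close>.
\<close>

lemma indecomposable_retract_cases:
  assumes ind: "indecomposable (mono_cat C XX) (A, f, B)"
    and ret: "retract (mono_cat C XX) (A, f, B) (I, i, S)" and b: "biproduct C S I J i j p q"
  shows "indecomposable (exact_subcat C XX) A \<and> retract C A I \<and>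
      isomorphic (mono_cat C XX) (A, f, B) (A, Id C A, A) \<or>
    zero_object C A \<and> f = Zero C A B \<and> indecomposable (exact_subcat C XX) B \<and> retract C B J"
proof -
  have M: "(A, f, B) \<in> mono_objects C XX" using ind by (simp add: indecomposable_def)
  note M' = mono_objectsD[OF M]
  obtain Q q' where "Q \<in> XX" "is_cokernel C A f B q' Q" using M by (auto simp: mono_objects_def)
  moreover obtain r where "r \<in> Hom C B A" "Comp C A B A r f = Id C A"
    using retract_of_split_mono(1)[OF ret b] by blast
  ultimately obtain j' where "biproduct C B A Q f j' r q'"
    using cokernel_split_mono M' obj by blast
  then show ?thesis
    using indecomposable_split_mono_cases[OF ind] retract_of_split_mono(2,3)[OF ret b] by blast
qed

section \<open>Projective and injective objects of the monomorphism category\<close>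

text \<open>
  Lift \<open>t1\<close> to \<open>s\<close> through the epimorphism of domains; the codomain component of the lift is
  then forced to be \<open>g s\<close>.
\<close>

lemma exact_projective_Id:
  assumes P: "projective_object C P" "P \<in> XX"
  shows "exact_projective (mono_cat C XX) (P, Id C P, P)"
  unfolding exact_projective_def
proof (intro conjI allI impI, goal_cases)
  case 1
  then show ?case using mono_objects_Id P by simp
next
  case (2 M N e t)
  obtain B1 g B2 where M: "M = (B1, g, B2)" by (metis prod_cases3)
  obtain D1 h D2 where N: "N = (D1, h, D2)" by (metis prod_cases3)
  obtain e1 e2 where e: "e = (e1, e2)" by fastforce
  obtain t1 t2 where t: "t = (t1, t2)" by fastforce
  obtain A1 f A2 i1 i2 where se: "short_exact (morphism_cat C) ((A1, f, A2), (i1, i2), M, e, N)"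
    and mem: "M \<in> mono_objects C XX" "N \<in> mono_objects C XX"
    using 2 by (auto simp: admissible_epi_def)
  note sq = se[unfolded M N e short_exact_morphism_cat]
  note M' = mono_objectsD[OF mem(1)[unfolded M]] and N' = mono_objectsD[OF mem(2)[unfolded N]]
  have t': "t1 \<in> Hom C P D1" "t2 \<in> Hom C P D2" "Comp C P D1 D2 h t1 = t2"
    using 2 N t obj[OF P(2)] N'(3,4) by auto
  have e': "e1 \<in> Hom C B1 D1" "e2 \<in> Hom C B2 D2"
    using sq by (auto simp: short_exact_def is_cokernel_def)
  obtain s where s: "s \<in> Hom C P B1" "Comp C P B1 D1 e1 s = t1"
    using projective_objectD[OF P(1) _ t'(1)] short_exact_epi sq M' N' by blast
  have "Comp C P B2 D2 e2 (Comp C P B1 B2 g s) = Comp C P B1 D2 (Comp C B1 B2 D2 e2 g) s"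
    using e' s(1) M' N' obj[OF P(2)] by (simp add: Comp_assoc)
  also have "\<dots> = Comp C P B1 D2 (Comp C B1 D1 D2 h e1) s" using sq by simp
  also have "\<dots> = t2"
    using e' s M' N' obj[OF P(2)] t' by (simp add: Comp_assoc)
  finally show ?case
    using s M' obj[OF P(2)] unfolding M N e t
    by (intro bexI[of _ "(s, Comp C P B1 B2 g s)"]) simp_all
qed

lemma exact_projective_Zero:
  assumes P: "projective_object C P" "P \<in> XX" and Z: "zero_object C Z"
  shows "exact_projective (mono_cat C XX) (Z, Zero C Z P, P)"
  unfolding exact_projective_def
proof (intro conjI allI impI, goal_cases)
  case 1
  then show ?case using mono_objects_Zero P Z by simp
next
  case (2 M N e t)
  obtain B1 g B2 where M: "M = (B1, g, B2)" by (metis prod_cases3)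
  obtain D1 h D2 where N: "N = (D1, h, D2)" by (metis prod_cases3)
  obtain e1 e2 where e: "e = (e1, e2)" by fastforce
  obtain t1 t2 where t: "t = (t1, t2)" by fastforce
  obtain A1 f A2 i1 i2 where se: "short_exact (morphism_cat C) ((A1, f, A2), (i1, i2), M, e, N)"
    and mem: "M \<in> mono_objects C XX" "N \<in> mono_objects C XX"
    using 2 by (auto simp: admissible_epi_def)
  note sq = se[unfolded M N e short_exact_morphism_cat]
  note M' = mono_objectsD[OF mem(1)[unfolded M]] and N' = mono_objectsD[OF mem(2)[unfolded N]]
  have t': "t1 \<in> Hom C Z D1" "t2 \<in> Hom C P D2" using 2 N t by auto
  have e': "e1 \<in> Hom C B1 D1" using sq by (auto simp: short_exact_def is_cokernel_def)
  obtain s where s: "s \<in> Hom C P B2" "Comp C P B2 D2 e2 s = t2"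
    using projective_objectD[OF P(1) _ t'(2)] short_exact_epi sq M' N' by blast
  show ?case
    using s M' N' e' obj[OF P(2)] zero_object_in[OF Z] Hom_from_zero[OF Z t'(1)] unfolding M N e t
    by (intro bexI[of _ "(Zero C Z B1, s)"]) simp_all
qed

text \<open>
  Extend \<open>t2\<close> along the inflation of codomains; the domain component is then forced.
\<close>

lemma exact_injective_Id:
  assumes I: "exact_injective (exact_subcat C XX) I"
  shows "exact_injective (mono_cat C XX) (I, Id C I, I)"
  unfolding exact_injective_def
proof (intro conjI allI impI, goal_cases)
  case 1
  then show ?case using mono_objects_Id I by (simp add: exact_injective_def)
next
  case (2 M N i t)
  have IX: "I \<in> XX" "I \<in> Obj C" using I obj by (auto simp: exact_injective_def)
  obtain A1 f A2 where M: "M = (A1, f, A2)" by (metis prod_cases3)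
  obtain B1 g B2 where N: "N = (B1, g, B2)" by (metis prod_cases3)
  obtain i1 i2 where i: "i = (i1, i2)" by fastforce
  obtain t1 t2 where t: "t = (t1, t2)" by fastforce
  obtain D1 h D2 p1 p2 where se: "short_exact (morphism_cat C) (M, i, N, (p1, p2), (D1, h, D2))"
    and mem: "M \<in> mono_objects C XX" "N \<in> mono_objects C XX" "(D1, h, D2) \<in> mono_objects C XX"
    using 2 by (auto simp: admissible_mono_def)
  note sq = se[unfolded M N i short_exact_morphism_cat]
  note M' = mono_objectsD[OF mem(1)[unfolded M]] and N' = mono_objectsD[OF mem(2)[unfolded N]]
    and D' = mono_objectsD[OF mem(3)]
  have t': "t1 \<in> Hom C A1 I" "t2 \<in> Hom C A2 I" "t1 = Comp C A1 A2 I t2 f"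
    using 2 M t IX M' by auto
  have i': "i1 \<in> Hom C A1 B1" "i2 \<in> Hom C A2 B2"
    using sq by (auto simp: short_exact_def is_kernel_def)
  have "admissible_mono (exact_subcat C XX) A2 B2 i2"
    using sq M' N' D' unfolding admissible_mono_def by auto
  then obtain s where s: "s \<in> Hom C B2 I" "Comp C A2 B2 I s i2 = t2"
    using exact_injectiveD[OF I, of A2 B2 i2 t2] t' by auto
  have "Comp C A1 B1 I (Comp C B1 B2 I s g) i1 = Comp C A1 B2 I s (Comp C A1 B1 B2 g i1)"
    using i' s(1) M' N' IX by (simp add: Comp_assoc)
  also have "\<dots> = Comp C A1 B2 I s (Comp C A1 A2 B2 i2 f)" using sq by simp
  also have "\<dots> = t1"
    using i' s M' N' IX t' by (simp add: Comp_assoc[symmetric])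
  finally show ?case
    using s N' IX unfolding M N i t
    by (intro bexI[of _ "(Comp C B1 B2 I s g, s)"]) simp_all
qed

end

section \<open>Submodules of right modules\<close>

definition rsubmod :: "('a, 't) ring_scheme \<Rightarrow> ('a, 'm, 'z) module_scheme \<Rightarrow> 'm set \<Rightarrow> bool" where
  "rsubmod R M L \<longleftrightarrow> L \<subseteq> carrier M \<and> \<zero>\<^bsub>M\<^esub> \<in> L \<and> (\<forall>x\<in>L. \<forall>y\<in>L. x \<oplus>\<^bsub>M\<^esub> y \<in> L) \<and>
     (\<forall>a\<in>carrier R. \<forall>x\<in>L. a \<odot>\<^bsub>M\<^esub> x \<in> L)"

definition rspan :: "('a, 't) ring_scheme \<Rightarrow> ('a, 'm, 'z) module_scheme \<Rightarrow> 'm set \<Rightarrow> 'm set" where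
  "rspan R M G = \<Inter>{L. rsubmod R M L \<and> G \<subseteq> L}"

lemma rsubmodI:
  assumes "L \<subseteq> carrier M" "\<zero>\<^bsub>M\<^esub> \<in> L" "\<And>x y. \<lbrakk>x \<in> L; y \<in> L\<rbrakk> \<Longrightarrow> x \<oplus>\<^bsub>M\<^esub> y \<in> L"
    and "\<And>a x. \<lbrakk>a \<in> carrier R; x \<in> L\<rbrakk> \<Longrightarrow> a \<odot>\<^bsub>M\<^esub> x \<in> L"
  shows "rsubmod R M L"
  using assms by (simp add: rsubmod_def)

lemma rsubmodD:
  assumes "rsubmod R M L"
  shows "L \<subseteq> carrier M" "\<zero>\<^bsub>M\<^esub> \<in> L" "\<lbrakk>x \<in> L; y \<in> L\<rbrakk> \<Longrightarrow> x \<oplus>\<^bsub>M\<^esub> y \<in> L"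
    "\<lbrakk>a \<in> carrier R; x \<in> L\<rbrakk> \<Longrightarrow> a \<odot>\<^bsub>M\<^esub> x \<in> L"
  using assms by (simp_all add: rsubmod_def)

lemma rspan_least: "\<lbrakk>rsubmod R M L; G \<subseteq> L\<rbrakk> \<Longrightarrow> rspan R M G \<subseteq> L"
  by (auto simp: rspan_def)

lemma rspan_incl: "G \<subseteq> rspan R M G"
  by (auto simp: rspan_def)

context right_module
begin

lemma ract_zero_left [simp]: "x \<in> carrier M \<Longrightarrow> \<zero> \<odot>\<^bsub>M\<^esub> x = \<zero>\<^bsub>M\<^esub>"
  using ract_l_distr[of \<zero> \<zero> x] ract_closed[of \<zero> x] by (metis M.add.r_cancel_one' R.l_zero R.zero_closed)

lemma ract_zero_right [simp]: "a \<in> carrier R \<Longrightarrow> a \<odot>\<^bsub>M\<^esub> \<zero>\<^bsub>M\<^esub> = \<zero>\<^bsub>M\<^esub>"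
  using ract_r_distr[of a "\<zero>\<^bsub>M\<^esub>" "\<zero>\<^bsub>M\<^esub>"] ract_closed[of a "\<zero>\<^bsub>M\<^esub>"]
  by (metis M.add.r_cancel_one' M.l_zero M.zero_closed)

lemma ract_minus_left:
  assumes "a \<in> carrier R" "x \<in> carrier M"
  shows "(\<ominus> a) \<odot>\<^bsub>M\<^esub> x = \<ominus>\<^bsub>M\<^esub> (a \<odot>\<^bsub>M\<^esub> x)"
proof -
  have "(\<ominus> a) \<odot>\<^bsub>M\<^esub> x \<oplus>\<^bsub>M\<^esub> a \<odot>\<^bsub>M\<^esub> x = \<zero>\<^bsub>M\<^esub>"
    using assms ract_l_distr[of "\<ominus> a" a x] by (simp add: R.l_neg)
  then show ?thesis using assms by (simp add: M.minus_equality ract_closed)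
qed

lemma ract_minus_right:
  assumes "a \<in> carrier R" "x \<in> carrier M"
  shows "a \<odot>\<^bsub>M\<^esub> (\<ominus>\<^bsub>M\<^esub> x) = \<ominus>\<^bsub>M\<^esub> (a \<odot>\<^bsub>M\<^esub> x)"
proof -
  have "a \<odot>\<^bsub>M\<^esub> (\<ominus>\<^bsub>M\<^esub> x) \<oplus>\<^bsub>M\<^esub> a \<odot>\<^bsub>M\<^esub> x = \<zero>\<^bsub>M\<^esub>"
    using assms ract_r_distr[of a "\<ominus>\<^bsub>M\<^esub> x" x] by (simp add: M.l_neg)
  then show ?thesis using assms by (simp add: M.minus_equality ract_closed)
qed

lemma ract_minus_one: "x \<in> carrier M \<Longrightarrow> (\<ominus> \<one>) \<odot>\<^bsub>M\<^esub> x = \<ominus>\<^bsub>M\<^esub> x"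
  by (simp add: ract_minus_left ract_one)

lemma rsubmod_neg: "\<lbrakk>rsubmod R M L; x \<in> L\<rbrakk> \<Longrightarrow> \<ominus>\<^bsub>M\<^esub> x \<in> L"
  using rsubmodD(1)[of R M L] rsubmodD(4)[of R M L "\<ominus> \<one>" x] ract_minus_one[of x] by auto

lemma rsubmod_minus: "\<lbrakk>rsubmod R M L; x \<in> L; y \<in> L\<rbrakk> \<Longrightarrow> x \<ominus>\<^bsub>M\<^esub> y \<in> L"
  using rsubmod_neg[of L y] rsubmodD(3)[of R M L x "\<ominus>\<^bsub>M\<^esub> y"] by (simp add: a_minus_def)

lemma rsubmod_carrier: "rsubmod R M (carrier M)"
  by (rule rsubmodI) (auto simp: ract_closed)

lemma rsubmod_zero: "rsubmod R M {\<zero>\<^bsub>M\<^esub>}"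
  by (rule rsubmodI) auto

lemma rsubmod_Int: "\<lbrakk>rsubmod R M L; rsubmod R M N\<rbrakk> \<Longrightarrow> rsubmod R M (L \<inter> N)"
  by (auto simp: rsubmod_def)

lemma rsubmod_Inter:
  assumes "\<And>L. L \<in> S \<Longrightarrow> rsubmod R M L" "S \<noteq> {}"
  shows "rsubmod R M (\<Inter>S)"
proof (rule rsubmodI)
  show "\<Inter>S \<subseteq> carrier M" using assms rsubmodD(1) by blast
qed (use assms in \<open>auto simp: rsubmod_def\<close>)

lemma rsubmod_rspan: "G \<subseteq> carrier M \<Longrightarrow> rsubmod R M (rspan R M G)"
  unfolding rspan_def using rsubmod_carrier by (intro rsubmod_Inter) auto

lemma rsubmod_finsum:
  assumes "rsubmod R M L" "finite F" "h \<in> F \<rightarrow> L"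
  shows "(\<Oplus>\<^bsub>M\<^esub>g\<in>F. h g) \<in> L"
  using assms(2,3)
proof (induction F)
  case empty
  then show ?case using rsubmodD[OF assms(1)] by simp
next
  case (insert x F)
  have "h \<in> F \<rightarrow> carrier M" "h x \<in> carrier M" using insert rsubmodD(1)[OF assms(1)] by auto
  then show ?case using insert rsubmodD(3)[OF assms(1)] by simp
qed

text \<open>
  The linear combinations of \<open>G\<close> are a submodule containing \<open>G\<close>, and every submodule
  containing \<open>G\<close> contains them.
\<close>

lemma rspan_finite:
  assumes G: "finite G" "G \<subseteq> carrier M"
  shows "rspan R M G = {x. \<exists>c\<in>G \<rightarrow> carrier R. x = (\<Oplus>\<^bsub>M\<^esub>g\<in>G. c g \<odot>\<^bsub>M\<^esub> g)}" (is "_ = ?S")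
proof
  have in_M: "(\<lambda>g. c g \<odot>\<^bsub>M\<^esub> g) \<in> G \<rightarrow> carrier M" if "c \<in> G \<rightarrow> carrier R" for c
    using that G ract_closed by (auto simp: subset_iff)
  have "rsubmod R M ?S"
  proof (rule rsubmodI)
    show "?S \<subseteq> carrier M" using in_M by auto
    show "\<zero>\<^bsub>M\<^esub> \<in> ?S"
    proof -
      have "(\<Oplus>\<^bsub>M\<^esub>g\<in>G. \<zero> \<odot>\<^bsub>M\<^esub> g) = (\<Oplus>\<^bsub>M\<^esub>g\<in>G. \<zero>\<^bsub>M\<^esub>)"
        using G by (intro M.finsum_cong') auto
      then show ?thesis by (auto intro!: bexI[of _ "\<lambda>_. \<zero>"])
    qed
    fix x y assume "x \<in> ?S" "y \<in> ?S"
    then obtain c d where c: "c \<in> G \<rightarrow> carrier R" "x = (\<Oplus>\<^bsub>M\<^esub>g\<in>G. c g \<odot>\<^bsub>M\<^esub> g)"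
      and d: "d \<in> G \<rightarrow> carrier R" "y = (\<Oplus>\<^bsub>M\<^esub>g\<in>G. d g \<odot>\<^bsub>M\<^esub> g)" by blast
    have "x \<oplus>\<^bsub>M\<^esub> y = (\<Oplus>\<^bsub>M\<^esub>g\<in>G. c g \<odot>\<^bsub>M\<^esub> g \<oplus>\<^bsub>M\<^esub> d g \<odot>\<^bsub>M\<^esub> g)"
      unfolding c(2) d(2) using in_M c d by (intro M.finsum_addf[symmetric]) auto
    also have "\<dots> = (\<Oplus>\<^bsub>M\<^esub>g\<in>G. (c g \<oplus> d g) \<odot>\<^bsub>M\<^esub> g)"
      using c d G by (intro M.finsum_cong') (auto simp: ract_l_distr ract_closed subset_iff Pi_iff)
    finally show "x \<oplus>\<^bsub>M\<^esub> y \<in> ?S"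
      using c d by (intro CollectI bexI[of _ "\<lambda>g. c g \<oplus> d g"]) auto
  next
    fix a x assume a: "a \<in> carrier R" and "x \<in> ?S"
    then obtain c where c: "c \<in> G \<rightarrow> carrier R" "x = (\<Oplus>\<^bsub>M\<^esub>g\<in>G. c g \<odot>\<^bsub>M\<^esub> g)" by blast
    have "a \<odot>\<^bsub>M\<^esub> (\<Oplus>\<^bsub>M\<^esub>g\<in>F. c g \<odot>\<^bsub>M\<^esub> g) = (\<Oplus>\<^bsub>M\<^esub>g\<in>F. (c g \<otimes> a) \<odot>\<^bsub>M\<^esub> g)"
      if "finite F" "F \<subseteq> G" for F
      using that
    proof (induction F)
      case (insert g F)
      have 1: "(\<lambda>g. c g \<odot>\<^bsub>M\<^esub> g) \<in> F \<rightarrow> carrier M" "c g \<odot>\<^bsub>M\<^esub> g \<in> carrier M"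
        "(\<lambda>g. (c g \<otimes> a) \<odot>\<^bsub>M\<^esub> g) \<in> F \<rightarrow> carrier M" "(c g \<otimes> a) \<odot>\<^bsub>M\<^esub> g \<in> carrier M"
        "c g \<in> carrier R" "g \<in> carrier M"
        using insert.prems c a G by (auto simp: ract_closed subset_iff Pi_iff)
      then show ?case
        using insert a by (simp add: ract_r_distr ract_assoc)
    qed (use a in simp)
    then have "a \<odot>\<^bsub>M\<^esub> x = (\<Oplus>\<^bsub>M\<^esub>g\<in>G. (c g \<otimes> a) \<odot>\<^bsub>M\<^esub> g)" using G c by simp
    then show "a \<odot>\<^bsub>M\<^esub> x \<in> ?S"
      using c a by (intro CollectI bexI[of _ "\<lambda>g. c g \<otimes> a"]) auto
  qed
  moreover have "G \<subseteq> ?S"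
  proof
    fix g assume g: "g \<in> G"
    have "(\<Oplus>\<^bsub>M\<^esub>k\<in>G. (if k = g then \<one> else \<zero>) \<odot>\<^bsub>M\<^esub> k) = (\<Oplus>\<^bsub>M\<^esub>k\<in>G. if g = k then k else \<zero>\<^bsub>M\<^esub>)"
      using G by (intro M.finsum_cong') (auto simp: ract_one subset_iff)
    also have "\<dots> = g" using M.finsum_singleton[OF g G(1), of "\<lambda>k. k"] G by auto
    finally show "g \<in> ?S"
      by (intro CollectI bexI[of _ "\<lambda>k. if k = g then \<one> else \<zero>"]) auto
  qed
  ultimately show "rspan R M G \<subseteq> ?S" by (rule rspan_least)
  have "(\<lambda>g. c g \<odot>\<^bsub>M\<^esub> g) \<in> G \<rightarrow> rspan R M G" if "c \<in> G \<rightarrow> carrier R" for c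
  proof
    fix g assume "g \<in> G"
    then show "c g \<odot>\<^bsub>M\<^esub> g \<in> rspan R M G"
      using that rsubmodD(4)[OF rsubmod_rspan[OF G(2)], of "c g" g] rspan_incl[of G R M] by blast
  qed
  from rsubmod_finsum[OF rsubmod_rspan[OF G(2)] G(1) this] show "?S \<subseteq> rspan R M G" by auto
qed

lemma rspan_insert:
  assumes "x \<in> carrier M" "G \<subseteq> carrier M" "y \<in> rspan R M (insert x G)"
  shows "\<exists>m\<in>rspan R M G. \<exists>a\<in>carrier R. y = m \<oplus>\<^bsub>M\<^esub> a \<odot>\<^bsub>M\<^esub> x"
proof -
  let ?L = "{y. \<exists>m\<in>rspan R M G. \<exists>a\<in>carrier R. y = m \<oplus>\<^bsub>M\<^esub> a \<odot>\<^bsub>M\<^esub> x}"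
  note sp = rsubmodD[OF rsubmod_rspan[OF assms(2)]]
  have spM: "m \<in> rspan R M G \<Longrightarrow> m \<in> carrier M" for m using sp(1) by blast
  have "rsubmod R M ?L"
  proof (rule rsubmodI)
    show "?L \<subseteq> carrier M" using spM assms(1) by (auto simp: ract_closed)
    show "\<zero>\<^bsub>M\<^esub> \<in> ?L"
      using sp(2) assms(1) by (auto intro!: bexI[of _ "\<zero>\<^bsub>M\<^esub>"] bexI[of _ \<zero>])
  next
    fix y z assume "y \<in> ?L" "z \<in> ?L"
    then obtain m a n b where mn: "m \<in> rspan R M G" "n \<in> rspan R M G" "a \<in> carrier R" "b \<in> carrier R"
      "y = m \<oplus>\<^bsub>M\<^esub> a \<odot>\<^bsub>M\<^esub> x" "z = n \<oplus>\<^bsub>M\<^esub> b \<odot>\<^bsub>M\<^esub> x" by blast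
    then have "y \<oplus>\<^bsub>M\<^esub> z = (m \<oplus>\<^bsub>M\<^esub> n) \<oplus>\<^bsub>M\<^esub> (a \<oplus> b) \<odot>\<^bsub>M\<^esub> x"
      using assms(1) spM by (simp add: ract_l_distr ract_closed M.a_ac)
    then show "y \<oplus>\<^bsub>M\<^esub> z \<in> ?L" using mn sp(3) by blast
  next
    fix b y assume b: "b \<in> carrier R" and "y \<in> ?L"
    then obtain m a where m: "m \<in> rspan R M G" "a \<in> carrier R" "y = m \<oplus>\<^bsub>M\<^esub> a \<odot>\<^bsub>M\<^esub> x" by blast
    then have "b \<odot>\<^bsub>M\<^esub> y = b \<odot>\<^bsub>M\<^esub> m \<oplus>\<^bsub>M\<^esub> (a \<otimes> b) \<odot>\<^bsub>M\<^esub> x"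
      using assms(1) spM b by (simp add: ract_r_distr ract_closed ract_assoc)
    then show "b \<odot>\<^bsub>M\<^esub> y \<in> ?L" using m b sp(4) by blast
  qed
  moreover have "insert x G \<subseteq> ?L"
  proof -
    have "x \<in> ?L"
      using sp(2) assms(1) by (auto intro!: bexI[of _ "\<zero>\<^bsub>M\<^esub>"] bexI[of _ \<one>] simp: ract_one)
    moreover have "g \<in> ?L" if "g \<in> G" for g
      using that rspan_incl[of G R M] spM assms(1)
      by (auto intro!: bexI[of _ g] bexI[of _ \<zero>])
    ultimately show ?thesis by blast
  qed
  ultimately have "rspan R M (insert x G) \<subseteq> ?L" by (rule rspan_least)
  then show ?thesis using assms(3) by blast
qed

end

text \<open>
  Finite generation without linear combinations. In this form it passes to quotients and
  products by comparing submodules.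
\<close>

lemma fg_right_module_iff_rspan:
  "fg_right_module R M \<longleftrightarrow>
     right_module R M \<and> (\<exists>G\<subseteq>carrier M. finite G \<and> rspan R M G = carrier M)"
proof (cases "right_module R M")
  case True
  then interpret right_module R M .
  have "rspan R M G = carrier M \<longleftrightarrow>
      (\<forall>x\<in>carrier M. \<exists>c\<in>G \<rightarrow> carrier R. x = (\<Oplus>\<^bsub>M\<^esub>g\<in>G. c g \<odot>\<^bsub>M\<^esub> g))"
    (is "_ \<longleftrightarrow> ?Q G") if "finite G" "G \<subseteq> carrier M" for G
  proof -
    have "rspan R M G = carrier M \<longleftrightarrow> carrier M \<subseteq> rspan R M G"
      using rsubmodD(1)[OF rsubmod_rspan[OF that(2)]] by auto
    then show ?thesis by (simp add: rspan_finite[OF that] subset_iff Ball_def)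
  qed
  then have "(\<exists>G\<subseteq>carrier M. finite G \<and> rspan R M G = carrier M) \<longleftrightarrow>
      (\<exists>G\<subseteq>carrier M. finite G \<and> ?Q G)"
    by (intro ex_cong1 conj_cong refl)
  then show ?thesis using True by (simp add: fg_right_module_def)
qed (simp add: fg_right_module_def)

section \<open>Finitely generated modules over commutative artinian rings\<close>

definition rmod_dcc :: "('a, 't) ring_scheme \<Rightarrow> ('a, 'm, 'z) module_scheme \<Rightarrow> 'm set \<Rightarrow> bool" where
  "rmod_dcc R M N \<longleftrightarrow> (\<forall>I :: nat \<Rightarrow> 'm set.
     (\<forall>n. rsubmod R M (I n) \<and> I n \<subseteq> N \<and> I (Suc n) \<subseteq> I n) \<longrightarrow> (\<exists>n. \<forall>m\<ge>n. I m = I n))"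

text \<open>
  If there were no minimal member, dependent choice would produce an infinite strictly
  descending chain.
\<close>

lemma rmod_dcc_minimal:
  assumes dcc: "rmod_dcc R M N" and N0: "rsubmod R M N0" "N0 \<subseteq> N" "P N0"
  shows "\<exists>L. rsubmod R M L \<and> L \<subseteq> N \<and> P L \<and> (\<forall>L'. rsubmod R M L' \<and> L' \<subset> L \<longrightarrow> \<not> P L')"
proof (rule ccontr)
  assume neg: "\<not> ?thesis"
  let ?Q = "\<lambda>L. rsubmod R M L \<and> L \<subseteq> N \<and> P L"
  have "\<exists>I :: nat \<Rightarrow> _. \<forall>n. ?Q (I n) \<and> I (Suc n) \<subset> I n"
  proof (rule dependent_nat_choice[of "\<lambda>_. ?Q" "\<lambda>_ L L'. L' \<subset> L"])
    show "\<exists>L. ?Q L" using N0 by (intro exI[of _ N0]) simp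
    show "\<exists>L'. ?Q L' \<and> L' \<subset> L" if "?Q L" for L n
    proof -
      have "\<not> (\<forall>L'. rsubmod R M L' \<and> L' \<subset> L \<longrightarrow> \<not> P L')"
        using neg[unfolded not_ex, rule_format, of L] that by simp
      then obtain L' where "rsubmod R M L'" "L' \<subset> L" "P L'" by auto
      then show ?thesis using \<open>?Q L\<close> by (intro exI[of _ L']) auto
    qed
  qed
  then obtain I :: "nat \<Rightarrow> _" where I: "\<forall>n. ?Q (I n) \<and> I (Suc n) \<subset> I n" by (rule exE)
  have "\<forall>n. rsubmod R M (I n) \<and> I n \<subseteq> N \<and> I (Suc n) \<subseteq> I n"
    using I[rule_format] by (simp add: psubset_imp_subset)
  then obtain n where n: "\<forall>m\<ge>n. I m = I n" using dcc unfolding rmod_dcc_def by blast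
  have "I (Suc n) = I n" by (rule n[rule_format]) simp
  then show False using I[rule_format, of n] by simp
qed

locale artinian_comm_module = right_module +
  assumes R_comm: "\<lbrakk>a \<in> carrier R; b \<in> carrier R\<rbrakk> \<Longrightarrow> a \<otimes> b = b \<otimes> a"
    and R_artinian: "artinian_ring R"
begin

lemma ract_mult:
  assumes "a \<in> carrier R" "b \<in> carrier R" "x \<in> carrier M"
  shows "(a \<otimes> b) \<odot>\<^bsub>M\<^esub> x = a \<odot>\<^bsub>M\<^esub> (b \<odot>\<^bsub>M\<^esub> x)"
  unfolding R_comm[OF assms(1,2)] by (rule ract_assoc[OF assms(2,1,3)])

lemma ract_swap:
  assumes "a \<in> carrier R" "b \<in> carrier R" "x \<in> carrier M"
  shows "a \<odot>\<^bsub>M\<^esub> (b \<odot>\<^bsub>M\<^esub> x) = b \<odot>\<^bsub>M\<^esub> (a \<odot>\<^bsub>M\<^esub> x)"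
  unfolding ract_mult[OF assms, symmetric] by (rule ract_assoc[OF assms])

lemma ideal_of_commutativeI:
  assumes "J \<subseteq> carrier R" "\<zero> \<in> J" "\<And>a b. \<lbrakk>a \<in> J; b \<in> J\<rbrakk> \<Longrightarrow> a \<oplus> b \<in> J"
    and "\<And>a b. \<lbrakk>a \<in> carrier R; b \<in> J\<rbrakk> \<Longrightarrow> a \<otimes> b \<in> J"
  shows "ideal J R"
proof (rule idealI)
  show "subgroup J (add_monoid R)"
  proof (rule R.add.subgroupI)
    fix a b assume a: "a \<in> J" and b: "b \<in> J"
    have aR: "a \<in> carrier R" using a assms(1) by blast
    have "(\<ominus> \<one>) \<otimes> a \<in> J" using a by (intro assms(4)) simp_all
    moreover have "(\<ominus> \<one>) \<otimes> a = \<ominus> a" using aR R.l_minus[of \<one> a] by simp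
    ultimately show "\<ominus> a \<in> J" by simp
    show "a \<oplus> b \<in> J" by (rule assms(3)[OF a b])
  qed (use assms(1,2) in auto)
  fix a x assume ax: "a \<in> J" "x \<in> carrier R"
  show xa: "x \<otimes> a \<in> J" by (rule assms(4)[OF ax(2,1)])
  have "a \<in> carrier R" using ax assms(1) by blast
  then show "a \<otimes> x \<in> J" using xa R_comm[of a x] ax by simp
qed (rule R.ring_axioms)

text \<open>
  Induction on the number of generators. A chain \<open>I\<close> in the span of \<open>x\<close> and \<open>G\<close> is controlled
  by its traces on the span of \<open>G\<close> and by the ideals \<open>J\<close> of those scalars that occur as
  coefficients of \<open>x\<close>. Both become stationary, and then \<open>I\<close> is stationary as well: two elements
  with the same coefficient of \<open>x\<close> differ by an element of the span of \<open>G\<close>.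
\<close>

lemma rmod_dcc_rspan:
  assumes "finite G" "G \<subseteq> carrier M"
  shows "rmod_dcc R M (rspan R M G)"
  using assms
proof (induction G)
  case empty
  have "rspan R M {} \<subseteq> {\<zero>\<^bsub>M\<^esub>}" by (intro rspan_least rsubmod_zero) simp
  then have "L = {\<zero>\<^bsub>M\<^esub>}" if "rsubmod R M L" "L \<subseteq> rspan R M {}" for L
    using that rsubmodD(2)[OF that(1)] by blast
  then have "I m = I 0" if "\<forall>n. rsubmod R M (I n) \<and> I n \<subseteq> rspan R M {} \<and> I (Suc n) \<subseteq> I n"
    for I :: "nat \<Rightarrow> 'c set" and m
    using that by metis
  then show ?case unfolding rmod_dcc_def by blast
next
  case (insert x G)
  then have x: "x \<in> carrier M" and G: "G \<subseteq> carrier M" by auto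
  note sp = rsubmodD[OF rsubmod_rspan[OF G]]
  have spM: "m \<in> rspan R M G \<Longrightarrow> m \<in> carrier M" for m using sp(1) by blast
  show ?case
    unfolding rmod_dcc_def
  proof (intro allI impI)
    fix I :: "nat \<Rightarrow> 'c set"
    assume I: "\<forall>n. rsubmod R M (I n) \<and> I n \<subseteq> rspan R M (insert x G) \<and> I (Suc n) \<subseteq> I n"
    \<comment> \<open>the scalars that occur as coefficients of \<open>x\<close> in \<open>I n\<close>\<close>
    define J where "J n = {a \<in> carrier R. \<exists>m\<in>rspan R M G. m \<oplus>\<^bsub>M\<^esub> a \<odot>\<^bsub>M\<^esub> x \<in> I n}" for n
    have "ideal (J n) R" for n
    proof (rule ideal_of_commutativeI)
      note In = rsubmodD[of R M "I n"]
      show "J n \<subseteq> carrier R" by (auto simp: J_def)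
      show "\<zero> \<in> J n"
        using I In(2) sp(2) x by (auto simp: J_def intro!: bexI[of _ "\<zero>\<^bsub>M\<^esub>"])
      fix a b
      {
        assume "a \<in> J n" "b \<in> J n"
        then obtain m k where mk: "a \<in> carrier R" "b \<in> carrier R" "m \<in> rspan R M G" "k \<in> rspan R M G"
          "m \<oplus>\<^bsub>M\<^esub> a \<odot>\<^bsub>M\<^esub> x \<in> I n" "k \<oplus>\<^bsub>M\<^esub> b \<odot>\<^bsub>M\<^esub> x \<in> I n" by (auto simp: J_def)
        then have "(m \<oplus>\<^bsub>M\<^esub> a \<odot>\<^bsub>M\<^esub> x) \<oplus>\<^bsub>M\<^esub> (k \<oplus>\<^bsub>M\<^esub> b \<odot>\<^bsub>M\<^esub> x) \<in> I n" using I In(3) by blast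
        moreover have "(m \<oplus>\<^bsub>M\<^esub> a \<odot>\<^bsub>M\<^esub> x) \<oplus>\<^bsub>M\<^esub> (k \<oplus>\<^bsub>M\<^esub> b \<odot>\<^bsub>M\<^esub> x) =
            (m \<oplus>\<^bsub>M\<^esub> k) \<oplus>\<^bsub>M\<^esub> (a \<oplus> b) \<odot>\<^bsub>M\<^esub> x"
          using mk spM x by (simp add: ract_l_distr ract_closed M.a_ac)
        ultimately show "a \<oplus> b \<in> J n" using mk sp(3) by (auto simp: J_def)
      next
        assume a: "a \<in> carrier R" and "b \<in> J n"
        then obtain m where m: "b \<in> carrier R" "m \<in> rspan R M G"
          "m \<oplus>\<^bsub>M\<^esub> b \<odot>\<^bsub>M\<^esub> x \<in> I n" by (auto simp: J_def)
        then have "a \<odot>\<^bsub>M\<^esub> (m \<oplus>\<^bsub>M\<^esub> b \<odot>\<^bsub>M\<^esub> x) \<in> I n" using I In(4) a by blast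
        moreover have "a \<odot>\<^bsub>M\<^esub> (m \<oplus>\<^bsub>M\<^esub> b \<odot>\<^bsub>M\<^esub> x) = a \<odot>\<^bsub>M\<^esub> m \<oplus>\<^bsub>M\<^esub> (a \<otimes> b) \<odot>\<^bsub>M\<^esub> x"
          using m spM x a by (simp add: ract_r_distr ract_closed ract_mult)
        ultimately show "a \<otimes> b \<in> J n" using m a sp(4) by (auto simp: J_def)
      }
    qed
    moreover have "J (Suc n) \<subseteq> J n" for n using I by (auto simp: J_def)
    ultimately obtain n1 where n1: "\<forall>m\<ge>n1. J m = J n1"
      using R_artinian unfolding artinian_ring_def by blast
    have "rsubmod R M (I n \<inter> rspan R M G)" for n using I rsubmod_Int rsubmod_rspan[OF G] by blast
    then have "\<exists>n. \<forall>m\<ge>n. I m \<inter> rspan R M G = I n \<inter> rspan R M G"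
      using I insert.IH[OF G, unfolded rmod_dcc_def, rule_format, of "\<lambda>n. I n \<inter> rspan R M G"] by blast
    then obtain n2 where n2: "\<forall>m\<ge>n2. I m \<inter> rspan R M G = I n2 \<inter> rspan R M G" by blast
    have decr: "I m \<subseteq> I n" if "n \<le> m" for m n using I lift_Suc_antimono_le[of I] that by blast
    let ?n = "max n1 n2"
    have "I m = I ?n" if m: "m \<ge> ?n" for m
    proof
      show "I m \<subseteq> I ?n" using decr m by blast
      show "I ?n \<subseteq> I m"
      proof
        fix y assume y: "y \<in> I ?n"
        then obtain k a where k: "k \<in> rspan R M G" "a \<in> carrier R" "y = k \<oplus>\<^bsub>M\<^esub> a \<odot>\<^bsub>M\<^esub> x"
          using rspan_insert[OF x G] I by blast
        then have "a \<in> J ?n" using y by (auto simp: J_def)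
        then have "a \<in> J m" using n1 m by (metis max.bounded_iff max.cobounded1)
        then obtain l where l: "l \<in> rspan R M G" "l \<oplus>\<^bsub>M\<^esub> a \<odot>\<^bsub>M\<^esub> x \<in> I m" by (auto simp: J_def)
        have "y \<ominus>\<^bsub>M\<^esub> (l \<oplus>\<^bsub>M\<^esub> a \<odot>\<^bsub>M\<^esub> x) \<in> I ?n"
          using rsubmod_minus y l decr m I by blast
        moreover have e: "y \<ominus>\<^bsub>M\<^esub> (l \<oplus>\<^bsub>M\<^esub> a \<odot>\<^bsub>M\<^esub> x) = k \<ominus>\<^bsub>M\<^esub> l"
        proof -
          have c: "k \<in> carrier M" "l \<in> carrier M" "a \<odot>\<^bsub>M\<^esub> x \<in> carrier M"
            using k l spM x by (auto simp: ract_closed)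
          have "y \<ominus>\<^bsub>M\<^esub> (l \<oplus>\<^bsub>M\<^esub> a \<odot>\<^bsub>M\<^esub> x) =
              (k \<ominus>\<^bsub>M\<^esub> l) \<oplus>\<^bsub>M\<^esub> (a \<odot>\<^bsub>M\<^esub> x \<oplus>\<^bsub>M\<^esub> \<ominus>\<^bsub>M\<^esub> (a \<odot>\<^bsub>M\<^esub> x))"
            unfolding k(3) using c by (simp add: a_minus_def M.minus_add M.a_ac del: M.r_neg)
          then show ?thesis using c by (simp add: M.r_neg)
        qed
        moreover have "k \<ominus>\<^bsub>M\<^esub> l \<in> rspan R M G" using k l rsubmod_minus rsubmod_rspan[OF G] by blast
        ultimately have "k \<ominus>\<^bsub>M\<^esub> l \<in> I m"
          using n2 m by (metis (no_types, lifting) IntD1 IntI max.bounded_iff max.cobounded2)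
        then have "(y \<ominus>\<^bsub>M\<^esub> (l \<oplus>\<^bsub>M\<^esub> a \<odot>\<^bsub>M\<^esub> x)) \<oplus>\<^bsub>M\<^esub> (l \<oplus>\<^bsub>M\<^esub> a \<odot>\<^bsub>M\<^esub> x) \<in> I m"
          using e l I rsubmodD(3) by metis
        moreover have "y \<in> carrier M" "l \<oplus>\<^bsub>M\<^esub> a \<odot>\<^bsub>M\<^esub> x \<in> carrier M"
          using k l spM x by (auto simp: ract_closed)
        ultimately show "y \<in> I m"
          by (simp add: a_minus_def M.a_assoc M.l_neg)
      qed
    qed
    then show "\<exists>n. \<forall>m\<ge>n. I m = I n" by blast
  qed
qed

definition fin_gen :: "'c set \<Rightarrow> bool" where
  "fin_gen N \<longleftrightarrow> (\<exists>G\<subseteq>carrier M. finite G \<and> rspan R M G = N)"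

lemma fin_genI:
  assumes "finite G" "G \<subseteq> N" "rsubmod R M N" "\<And>L. \<lbrakk>rsubmod R M L; G \<subseteq> L; L \<subseteq> N\<rbrakk> \<Longrightarrow> N \<subseteq> L"
  shows "fin_gen N"
proof -
  have G: "G \<subseteq> carrier M" using assms rsubmodD(1) by blast
  have *: "rspan R M G \<subseteq> N" using assms(3,2) by (rule rspan_least)
  have "rspan R M G = N"
    using assms(4)[OF rsubmod_rspan[OF G] rspan_incl *] * by (rule subset_antisym[rotated])
  then show ?thesis using assms(1) G unfolding fin_gen_def by (intro exI[of _ G]) simp
qed

lemma rsubmod_scale:
  assumes "rsubmod R M N" "r \<in> carrier R"
  shows "rsubmod R M ((\<lambda>x. r \<odot>\<^bsub>M\<^esub> x) ` N)"
proof (rule rsubmodI)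
  note N = rsubmodD[OF assms(1)]
  have NM: "x \<in> N \<Longrightarrow> x \<in> carrier M" for x using N(1) by blast
  show "(\<lambda>x. r \<odot>\<^bsub>M\<^esub> x) ` N \<subseteq> carrier M" using NM assms by (auto simp: ract_closed)
  show "\<zero>\<^bsub>M\<^esub> \<in> (\<lambda>x. r \<odot>\<^bsub>M\<^esub> x) ` N" using N(2) assms by (auto intro!: image_eqI[of _ _ "\<zero>\<^bsub>M\<^esub>"])
  fix a x y
  {
    assume "x \<in> (\<lambda>x. r \<odot>\<^bsub>M\<^esub> x) ` N" "y \<in> (\<lambda>x. r \<odot>\<^bsub>M\<^esub> x) ` N"
    then obtain u v where "u \<in> N" "v \<in> N" "x = r \<odot>\<^bsub>M\<^esub> u" "y = r \<odot>\<^bsub>M\<^esub> v" by blast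
    then show "x \<oplus>\<^bsub>M\<^esub> y \<in> (\<lambda>x. r \<odot>\<^bsub>M\<^esub> x) ` N"
      using N(3) assms NM by (auto intro!: image_eqI[of _ _ "u \<oplus>\<^bsub>M\<^esub> v"] simp: ract_r_distr)
  next
    assume "a \<in> carrier R" "x \<in> (\<lambda>x. r \<odot>\<^bsub>M\<^esub> x) ` N"
    then obtain u where u: "u \<in> N" "x = r \<odot>\<^bsub>M\<^esub> u" "a \<in> carrier R" by blast
    then have "a \<odot>\<^bsub>M\<^esub> x = r \<odot>\<^bsub>M\<^esub> (a \<odot>\<^bsub>M\<^esub> u)"
      using assms NM ract_swap[of r a u] by simp
    then show "a \<odot>\<^bsub>M\<^esub> x \<in> (\<lambda>x. r \<odot>\<^bsub>M\<^esub> x) ` N"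
      using u N(4) by blast
  }
qed

lemma rsubmod_annihilated:
  assumes "rsubmod R M N" "r \<in> carrier R"
  shows "rsubmod R M {x \<in> N. r \<odot>\<^bsub>M\<^esub> x = \<zero>\<^bsub>M\<^esub>}"
proof (rule rsubmodI)
  note N = rsubmodD[OF assms(1)]
  have NM: "x \<in> N \<Longrightarrow> x \<in> carrier M" for x using N(1) by blast
  show "{x \<in> N. r \<odot>\<^bsub>M\<^esub> x = \<zero>\<^bsub>M\<^esub>} \<subseteq> carrier M" using NM by auto
  show "\<zero>\<^bsub>M\<^esub> \<in> {x \<in> N. r \<odot>\<^bsub>M\<^esub> x = \<zero>\<^bsub>M\<^esub>}" using N(2) assms by simp
  fix a x y
  {
    assume "x \<in> {x \<in> N. r \<odot>\<^bsub>M\<^esub> x = \<zero>\<^bsub>M\<^esub>}" "y \<in> {x \<in> N. r \<odot>\<^bsub>M\<^esub> x = \<zero>\<^bsub>M\<^esub>}"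
    then show "x \<oplus>\<^bsub>M\<^esub> y \<in> {x \<in> N. r \<odot>\<^bsub>M\<^esub> x = \<zero>\<^bsub>M\<^esub>}"
      using N(3) NM assms by (simp add: ract_r_distr)
  next
    assume a: "a \<in> carrier R" "x \<in> {x \<in> N. r \<odot>\<^bsub>M\<^esub> x = \<zero>\<^bsub>M\<^esub>}"
    then have "r \<odot>\<^bsub>M\<^esub> (a \<odot>\<^bsub>M\<^esub> x) = a \<odot>\<^bsub>M\<^esub> (r \<odot>\<^bsub>M\<^esub> x)"
      using assms NM ract_swap[of r a x] by simp
    then show "a \<odot>\<^bsub>M\<^esub> x \<in> {x \<in> N. r \<odot>\<^bsub>M\<^esub> x = \<zero>\<^bsub>M\<^esub>}" using N(4) a by simp
  }
qed

text \<open>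
  This is the extension \<open>0 \<rightarrow> ker r \<rightarrow> N \<rightarrow> r N \<rightarrow> 0\<close>: generators of \<open>ker r\<close> together with preimages of
  generators of \<open>r N\<close> generate \<open>N\<close>.
\<close>

lemma fin_gen_of_scale:
  assumes N: "rsubmod R M N" and r: "r \<in> carrier R"
    and 1: "fin_gen {x \<in> N. r \<odot>\<^bsub>M\<^esub> x = \<zero>\<^bsub>M\<^esub>}" and 2: "fin_gen ((\<lambda>x. r \<odot>\<^bsub>M\<^esub> x) ` N)"
  shows "fin_gen N"
proof -
  have NM: "x \<in> N \<Longrightarrow> x \<in> carrier M" for x using rsubmodD(1)[OF N] by blast
  obtain G where G: "finite G" "rspan R M G = {x \<in> N. r \<odot>\<^bsub>M\<^esub> x = \<zero>\<^bsub>M\<^esub>}"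
    using 1 by (auto simp: fin_gen_def)
  obtain H where H: "finite H" "rspan R M H = (\<lambda>x. r \<odot>\<^bsub>M\<^esub> x) ` N" using 2 by (auto simp: fin_gen_def)
  then have "H \<subseteq> (\<lambda>x. r \<odot>\<^bsub>M\<^esub> x) ` N" using rspan_incl[of H] by blast
  then obtain H' where H': "finite H'" "H' \<subseteq> N" "H = (\<lambda>x. r \<odot>\<^bsub>M\<^esub> x) ` H'"
    using H(1) finite_subset_image by metis
  show ?thesis
  proof (rule fin_genI)
    show "finite (G \<union> H')" using G H' by simp
    show "G \<union> H' \<subseteq> N" using H' G(2) rspan_incl[of G] by blast
    fix L assume L: "rsubmod R M L" "G \<union> H' \<subseteq> L" "L \<subseteq> N"
    have "rspan R M H \<subseteq> (\<lambda>x. r \<odot>\<^bsub>M\<^esub> x) ` L"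
      using L H' by (intro rspan_least rsubmod_scale r) auto
    then have sc: "(\<lambda>x. r \<odot>\<^bsub>M\<^esub> x) ` N \<subseteq> (\<lambda>x. r \<odot>\<^bsub>M\<^esub> x) ` L" using H by simp
    have ann: "{x \<in> N. r \<odot>\<^bsub>M\<^esub> x = \<zero>\<^bsub>M\<^esub>} \<subseteq> L" using rspan_least[of R M L G] L G(2) by blast
    show "N \<subseteq> L"
    proof
      fix n assume n: "n \<in> N"
      obtain l where l: "l \<in> L" "r \<odot>\<^bsub>M\<^esub> n = r \<odot>\<^bsub>M\<^esub> l" using sc n by blast
      then have c: "n \<in> carrier M" "l \<in> carrier M" "l \<in> N" using n L NM by auto
      have "r \<odot>\<^bsub>M\<^esub> (n \<ominus>\<^bsub>M\<^esub> l) = \<zero>\<^bsub>M\<^esub>"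
        using c r l(2) by (simp add: a_minus_def ract_r_distr ract_minus_right M.r_neg ract_closed)
      then have "n \<ominus>\<^bsub>M\<^esub> l \<in> L" using ann rsubmod_minus[OF N n c(3)] by blast
      then have "(n \<ominus>\<^bsub>M\<^esub> l) \<oplus>\<^bsub>M\<^esub> l \<in> L" using l rsubmodD(3)[OF L(1)] by blast
      then show "n \<in> L" using c by (simp add: a_minus_def M.a_assoc M.l_neg)
    qed
  qed (rule N)
qed

text \<open>
  The chain of the ideals generated by the powers of \<open>r\<close> becomes stationary, so that
  \<open>r^n = s r^(n+1)\<close> for some \<open>s\<close> and \<open>n\<close>. As \<open>r\<close> maps \<open>N\<close> onto itself, every element of \<open>N\<close>
  is a multiple of \<open>r^n\<close>, hence is fixed by \<open>s r\<close>.
\<close>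

lemma exists_scalar_inverse:
  assumes N: "rsubmod R M N" and r: "r \<in> carrier R" and rN: "(\<lambda>x. r \<odot>\<^bsub>M\<^esub> x) ` N = N"
  shows "\<exists>s\<in>carrier R. \<forall>x\<in>N. s \<odot>\<^bsub>M\<^esub> (r \<odot>\<^bsub>M\<^esub> x) = x"
proof -
  have NM: "x \<in> N \<Longrightarrow> x \<in> carrier M" for x using rsubmodD(1)[OF N] by blast
  define I where "I n = {a \<otimes> (r [^] n) | a. a \<in> carrier R}" for n :: nat
  have "ideal (I n) R" for n
  proof (rule ideal_of_commutativeI)
    show "I n \<subseteq> carrier R" using r by (auto simp: I_def)
    show "\<zero> \<in> I n" using r by (auto simp: I_def intro!: exI[of _ \<zero>])
    show "a \<oplus> b \<in> I n" if "a \<in> I n" "b \<in> I n" for a b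
    proof -
      obtain c d where "c \<in> carrier R" "d \<in> carrier R" "a = c \<otimes> (r [^] n)" "b = d \<otimes> (r [^] n)"
        using \<open>a \<in> I n\<close> \<open>b \<in> I n\<close> by (auto simp: I_def)
      then have "a \<oplus> b = (c \<oplus> d) \<otimes> (r [^] n)" "c \<oplus> d \<in> carrier R" using r by (auto simp: R.l_distr)
      then show ?thesis by (auto simp: I_def)
    qed
    show "a \<otimes> b \<in> I n" if "a \<in> carrier R" "b \<in> I n" for a b
    proof -
      obtain c where c: "c \<in> carrier R" "b = c \<otimes> (r [^] n)" using \<open>b \<in> I n\<close> by (auto simp: I_def)
      then have "a \<otimes> b = (a \<otimes> c) \<otimes> (r [^] n)" using r \<open>a \<in> carrier R\<close> by (simp add: R.m_assoc)
      then show ?thesis using c \<open>a \<in> carrier R\<close> by (auto simp: I_def)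
    qed
  qed
  moreover have "I (Suc n) \<subseteq> I n" for n
  proof
    fix y assume "y \<in> I (Suc n)"
    then obtain a where a: "a \<in> carrier R" "y = a \<otimes> (r [^] Suc n)" by (auto simp: I_def)
    then have "y = (a \<otimes> r) \<otimes> (r [^] n)" using r by (simp add: R.m_assoc R_comm)
    then show "y \<in> I n" using a r by (auto simp: I_def)
  qed
  ultimately obtain n where n: "\<forall>m\<ge>n. I m = I n"
    using R_artinian unfolding artinian_ring_def by blast
  have "I (Suc n) = I n" by (rule n[rule_format]) simp
  moreover have "r [^] n \<in> I n" using r by (auto simp: I_def intro!: exI[of _ \<one>])
  ultimately obtain s where s: "s \<in> carrier R" "r [^] n = s \<otimes> (r [^] Suc n)" by (auto simp: I_def)
  have pow: "\<exists>y\<in>N. x = (r [^] k) \<odot>\<^bsub>M\<^esub> y" if "x \<in> N" for x and k :: nat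
    using that
  proof (induction k arbitrary: x)
    case 0
    then show ?case using NM by (auto simp: ract_one)
  next
    case (Suc k)
    then obtain y where y: "y \<in> N" "x = (r [^] k) \<odot>\<^bsub>M\<^esub> y" by blast
    then obtain z where z: "z \<in> N" "y = r \<odot>\<^bsub>M\<^esub> z" using rN by blast
    have "x = (r [^] Suc k) \<odot>\<^bsub>M\<^esub> z"
      using y z r NM by (simp add: ract_mult)
    then show ?case using z by blast
  qed
  have "s \<odot>\<^bsub>M\<^esub> (r \<odot>\<^bsub>M\<^esub> x) = x" if x: "x \<in> N" for x
  proof -
    obtain y where y: "y \<in> N" "x = (r [^] n) \<odot>\<^bsub>M\<^esub> y" using pow[OF x] by blast
    then have yM: "y \<in> carrier M" using NM by blast
    have "s \<odot>\<^bsub>M\<^esub> (r \<odot>\<^bsub>M\<^esub> x) = (((r [^] n) \<otimes> r) \<otimes> s) \<odot>\<^bsub>M\<^esub> y"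
      using y(2) yM s(1) r by (simp add: ract_assoc ract_closed)
    also have "((r [^] n) \<otimes> r) \<otimes> s = r [^] n"
      using s r R_comm[of "(r [^] n) \<otimes> r" s] by simp
    finally show ?thesis using y by simp
  qed
  then show ?thesis using s(1) by blast
qed

text \<open>
  Let \<open>L\<close> be minimal among the submodules that are not finitely generated. By
  \<open>fin_gen_of_scale\<close> and minimality each scalar kills \<open>L\<close> or maps \<open>L\<close> onto \<open>L\<close>, and in the
  second case it is invertible on \<open>L\<close>. So \<open>L\<close> is a vector space over a field all of whose proper
  subspaces are finitely generated. For \<open>x \<noteq> 0\<close> let \<open>K\<close> be a maximal subspace that does not contain
  \<open>x\<close>. Then \<open>K\<close> is a hyperplane with complement spanned by \<open>x\<close>, so that \<open>L\<close> is finitely generated, a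
  contradiction.
\<close>

theorem fin_gen_of_dcc:
  assumes dcc: "rmod_dcc R M (carrier M)" and N: "rsubmod R M N"
  shows "fin_gen N"
proof (rule ccontr)
  assume "\<not> fin_gen N"
  then obtain L where L: "rsubmod R M L" "\<not> fin_gen L"
    and min: "\<And>K. \<lbrakk>rsubmod R M K; K \<subset> L\<rbrakk> \<Longrightarrow> fin_gen K"
    using rmod_dcc_minimal[OF dcc N rsubmodD(1)[OF N], of "\<lambda>L. \<not> fin_gen L"] by blast
  note L' = rsubmodD[OF L(1)]
  have LM: "x \<in> L \<Longrightarrow> x \<in> carrier M" for x using L'(1) by blast
  have alt: "(\<forall>x\<in>L. r \<odot>\<^bsub>M\<^esub> x = \<zero>\<^bsub>M\<^esub>) \<or> (\<lambda>x. r \<odot>\<^bsub>M\<^esub> x) ` L = L" if r: "r \<in> carrier R" for r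
  proof (rule ccontr)
    assume "\<not> ?thesis"
    then have "{x \<in> L. r \<odot>\<^bsub>M\<^esub> x = \<zero>\<^bsub>M\<^esub>} \<subset> L" "(\<lambda>x. r \<odot>\<^bsub>M\<^esub> x) ` L \<subset> L"
      using L'(4)[OF r] by auto
    then have "fin_gen L"
      using fin_gen_of_scale[OF L(1) r] min rsubmod_annihilated[OF L(1) r] rsubmod_scale[OF L(1) r]
      by blast
    then show False using L(2) by simp
  qed
  have "\<exists>x\<in>L. x \<noteq> \<zero>\<^bsub>M\<^esub>"
  proof (rule ccontr)
    assume "\<not> ?thesis"
    then have "L \<subseteq> {\<zero>\<^bsub>M\<^esub>}" by blast
    then have "fin_gen L" using L rsubmodD(2) by (intro fin_genI[of "{}"]) auto
    then show False using L(2) by simp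
  qed
  then obtain x where x: "x \<in> L" "x \<noteq> \<zero>\<^bsub>M\<^esub>" by blast
  define S where "S = {K. rsubmod R M K \<and> K \<subseteq> L \<and> x \<notin> K}"
  have "\<exists>K\<in>S. \<forall>V\<in>S. K \<subseteq> V \<longrightarrow> V = K"
  proof (rule subset_Zorn_nonempty)
    show "S \<noteq> {}" using rsubmod_zero x L'(2) unfolding S_def by blast
    fix c assume c: "c \<noteq> {}" "subset.chain S c"
    then have cS: "K \<in> S" if "K \<in> c" for K using that by (auto simp: subset_chain_def)
    have "rsubmod R M (\<Union>c)"
    proof (rule rsubmodI)
      show "\<Union>c \<subseteq> carrier M" using cS LM by (auto simp: S_def)
      obtain K where "K \<in> c" using c(1) by blast
      moreover from this have "rsubmod R M K" using cS by (simp add: S_def)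
      ultimately show "\<zero>\<^bsub>M\<^esub> \<in> \<Union>c" using rsubmodD(2) by blast
      fix a y z
      {
        assume "y \<in> \<Union>c" "z \<in> \<Union>c"
        then obtain K1 K2 where "K1 \<in> c" "y \<in> K1" "K2 \<in> c" "z \<in> K2" by blast
        moreover have "K1 \<subseteq> K2 \<or> K2 \<subseteq> K1"
          using c(2) \<open>K1 \<in> c\<close> \<open>K2 \<in> c\<close> unfolding subset_chain_def by blast
        ultimately obtain K where K: "K \<in> c" "y \<in> K" "z \<in> K" by blast
        then have "rsubmod R M K" using cS by (simp add: S_def)
        from rsubmodD(3)[OF this K(2,3)] show "y \<oplus>\<^bsub>M\<^esub> z \<in> \<Union>c" using K(1) by blast
      next
        assume "a \<in> carrier R" "y \<in> \<Union>c"
        then obtain K where K: "a \<in> carrier R" "K \<in> c" "y \<in> K" by blast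
        then have "rsubmod R M K" using cS by (simp add: S_def)
        from rsubmodD(4)[OF this K(1,3)] show "a \<odot>\<^bsub>M\<^esub> y \<in> \<Union>c" using K(2) by blast
      }
    qed
    then show "\<Union>c \<in> S" using cS by (auto simp: S_def)
  qed
  then obtain K where KS: "K \<in> S" and mx: "\<forall>V\<in>S. K \<subseteq> V \<longrightarrow> V = K" by blast
  have K: "rsubmod R M K" "K \<subseteq> L" "x \<notin> K" using KS by (simp_all add: S_def)
  have max: "V = K" if "rsubmod R M V" "V \<subseteq> L" "x \<notin> V" "K \<subseteq> V" for V
    using mx that by (simp add: S_def)
  have "K \<subset> L" using K x by blast
  then obtain G where G: "finite G" "G \<subseteq> carrier M" "rspan R M G = K"
    using min K(1) by (auto simp: fin_gen_def)
  have GK: "G \<subseteq> K" using G(3) rspan_incl[of G] by blast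
  have "fin_gen L"
  proof (rule fin_genI)
    show "finite (insert x G)" using G by simp
    show "insert x G \<subseteq> L" using GK K x by blast
    fix V assume V: "rsubmod R M V" "insert x G \<subseteq> V" "V \<subseteq> L"
    then have KV: "K \<subseteq> V" using rspan_least[of R M V G] G(3) by blast
    show "L \<subseteq> V"
    proof
      fix y assume y: "y \<in> L"
      show "y \<in> V"
      proof (cases "y \<in> K")
        case True
        then show ?thesis using KV by blast
      next
        case False
        let ?W = "rspan R M (insert y G)"
        have yG: "insert y G \<subseteq> carrier M" using y LM G by blast
        have "K \<subseteq> ?W"
          using rspan_least[of R M ?W G] rsubmod_rspan[OF yG] rspan_incl[of "insert y G" R M] G(3) by blast
        moreover have "?W \<subseteq> L" using y GK K by (intro rspan_least L(1)) blast
        moreover have "y \<in> ?W" using rspan_incl[of "insert y G"] by blast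
        ultimately have "x \<in> ?W" using max[OF rsubmod_rspan[OF yG]] False by blast
        then obtain k r where k: "k \<in> K" "r \<in> carrier R" "x = k \<oplus>\<^bsub>M\<^esub> r \<odot>\<^bsub>M\<^esub> y"
          using rspan_insert[of y G x] G LM[OF y] by blast
        have kM: "k \<in> carrier M" using k K LM by blast
        have "r \<odot>\<^bsub>M\<^esub> y \<noteq> \<zero>\<^bsub>M\<^esub>" using k K(3) kM by auto
        then have "(\<lambda>x. r \<odot>\<^bsub>M\<^esub> x) ` L = L" using alt[OF k(2)] y by blast
        then obtain s where s: "s \<in> carrier R" "s \<odot>\<^bsub>M\<^esub> (r \<odot>\<^bsub>M\<^esub> y) = y"
          using exists_scalar_inverse[OF L(1) k(2)] y by blast
        have "s \<odot>\<^bsub>M\<^esub> x \<ominus>\<^bsub>M\<^esub> s \<odot>\<^bsub>M\<^esub> k \<in> V"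
          using V KV k s(1) rsubmodD(4)[OF V(1)] by (intro rsubmod_minus[OF V(1)]) auto
        moreover have "s \<odot>\<^bsub>M\<^esub> x = s \<odot>\<^bsub>M\<^esub> k \<oplus>\<^bsub>M\<^esub> y"
          using k s kM LM[OF y] by (simp add: ract_r_distr ract_closed)
        ultimately have "(s \<odot>\<^bsub>M\<^esub> k \<oplus>\<^bsub>M\<^esub> y) \<ominus>\<^bsub>M\<^esub> s \<odot>\<^bsub>M\<^esub> k \<in> V" by simp
        moreover have "s \<odot>\<^bsub>M\<^esub> k \<in> carrier M" using s kM by (simp add: ract_closed)
        ultimately show ?thesis
          using LM[OF y] by (simp add: a_minus_def M.a_comm[of _ y] M.a_assoc M.r_neg)
      qed
    qed
  qed (rule L(1))
  then show False using L(2) by simp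
qed

end

section \<open>Homomorphisms of right modules\<close>

lemma (in right_module) minus_eq_zero_iff [simp]:
  assumes "x \<in> carrier M" "y \<in> carrier M"
  shows "x \<ominus>\<^bsub>M\<^esub> y = \<zero>\<^bsub>M\<^esub> \<longleftrightarrow> x = y"
proof
  have "x = (x \<ominus>\<^bsub>M\<^esub> y) \<oplus>\<^bsub>M\<^esub> y" using assms by (simp add: M.minus_eq M.a_assoc M.l_neg)
  then show "x = y" if "x \<ominus>\<^bsub>M\<^esub> y = \<zero>\<^bsub>M\<^esub>" using assms that by simp
  show "x \<ominus>\<^bsub>M\<^esub> y = \<zero>\<^bsub>M\<^esub>" if "x = y" using assms that by (simp add: M.minus_eq M.r_neg)
qed

lemma fg_mod_simps [simp]:
  "M \<in> Obj (fg_mod \<Lambda>) \<longleftrightarrow> fg_right_module \<Lambda> M"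
  "Hom (fg_mod \<Lambda>) = rmod_hom \<Lambda>"
  "Id (fg_mod \<Lambda>) M = (\<lambda>x\<in>carrier M. x)"
  "Comp (fg_mod \<Lambda>) L M N g f = compose (carrier L) g f"
  "Plus (fg_mod \<Lambda>) M N f g = (\<lambda>x\<in>carrier M. f x \<oplus>\<^bsub>N\<^esub> g x)"
  "Zero (fg_mod \<Lambda>) M N = (\<lambda>x\<in>carrier M. \<zero>\<^bsub>N\<^esub>)"
  by (simp_all add: fg_mod_def)

lemma fg_right_moduleD: "fg_right_module \<Lambda> M \<Longrightarrow> right_module \<Lambda> M"
  by (simp add: fg_right_module_def)

lemma rmod_homI:
  assumes "\<And>x. x \<in> carrier M \<Longrightarrow> h x \<in> carrier N"
    and "\<And>x y. \<lbrakk>x \<in> carrier M; y \<in> carrier M\<rbrakk> \<Longrightarrow> h (x \<oplus>\<^bsub>M\<^esub> y) = h x \<oplus>\<^bsub>N\<^esub> h y"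
    and "\<And>a x. \<lbrakk>a \<in> carrier \<Lambda>; x \<in> carrier M\<rbrakk> \<Longrightarrow> h (a \<odot>\<^bsub>M\<^esub> x) = a \<odot>\<^bsub>N\<^esub> h x"
    and M: "right_module \<Lambda> M"
  shows "restrict h (carrier M) \<in> rmod_hom \<Lambda> M N"
proof -
  interpret right_module \<Lambda> M by fact
  show ?thesis using assms(1-3) by (auto simp: rmod_hom_def ract_closed)
qed

lemma rmod_hom_closed: "\<lbrakk>f \<in> rmod_hom \<Lambda> M N; x \<in> carrier M\<rbrakk> \<Longrightarrow> f x \<in> carrier N"
  and rmod_hom_add: "\<lbrakk>f \<in> rmod_hom \<Lambda> M N; x \<in> carrier M; y \<in> carrier M\<rbrakk>
    \<Longrightarrow> f (x \<oplus>\<^bsub>M\<^esub> y) = f x \<oplus>\<^bsub>N\<^esub> f y"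
  and rmod_hom_ract: "\<lbrakk>f \<in> rmod_hom \<Lambda> M N; a \<in> carrier \<Lambda>; x \<in> carrier M\<rbrakk>
    \<Longrightarrow> f (a \<odot>\<^bsub>M\<^esub> x) = a \<odot>\<^bsub>N\<^esub> f x"
  by (auto simp: rmod_hom_def)

lemma rmod_hom_ext:
  assumes "f \<in> rmod_hom \<Lambda> M N" "g \<in> rmod_hom \<Lambda> M N" "\<And>x. x \<in> carrier M \<Longrightarrow> f x = g x"
  shows "f = g"
proof (rule PiE_ext)
  show "f \<in> carrier M \<rightarrow>\<^sub>E carrier N" "g \<in> carrier M \<rightarrow>\<^sub>E carrier N"
    using assms by (simp_all add: rmod_hom_def)
qed (rule assms(3))

lemma rmod_hom_zero:
  assumes "f \<in> rmod_hom \<Lambda> M N" "right_module \<Lambda> M" "right_module \<Lambda> N"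
  shows "f \<zero>\<^bsub>M\<^esub> = \<zero>\<^bsub>N\<^esub>"
proof -
  interpret M: right_module \<Lambda> M by fact
  interpret N: right_module \<Lambda> N by fact
  have "f (\<zero>\<^bsub>\<Lambda>\<^esub> \<odot>\<^bsub>M\<^esub> \<zero>\<^bsub>M\<^esub>) = \<zero>\<^bsub>\<Lambda>\<^esub> \<odot>\<^bsub>N\<^esub> f \<zero>\<^bsub>M\<^esub>"
    by (rule rmod_hom_ract[OF assms(1)]) simp_all
  then show ?thesis using rmod_hom_closed[OF assms(1)] by simp
qed

lemma rmod_hom_minus:
  assumes f: "f \<in> rmod_hom \<Lambda> M N" "right_module \<Lambda> M" "right_module \<Lambda> N"
    and x: "x \<in> carrier M" "y \<in> carrier M"
  shows "f (x \<ominus>\<^bsub>M\<^esub> y) = f x \<ominus>\<^bsub>N\<^esub> f y"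
proof -
  interpret M: right_module \<Lambda> M by fact
  interpret N: right_module \<Lambda> N by fact
  have "f (\<ominus>\<^bsub>M\<^esub> y) = \<ominus>\<^bsub>N\<^esub> f y"
    using rmod_hom_ract[OF f(1), of "\<ominus>\<^bsub>\<Lambda>\<^esub> \<one>\<^bsub>\<Lambda>\<^esub>" y] x rmod_hom_closed[OF f(1)]
    by (simp add: M.ract_minus_one N.ract_minus_one)
  then show ?thesis using x rmod_hom_add[OF f(1)] by (simp add: a_minus_def)
qed

lemma rmod_hom_Comp:
  assumes "f \<in> rmod_hom \<Lambda> L M" "g \<in> rmod_hom \<Lambda> M N" "right_module \<Lambda> L"
  shows "compose (carrier L) g f \<in> rmod_hom \<Lambda> L N"
  unfolding compose_def using assms
  by (intro rmod_homI) (auto simp: rmod_hom_closed rmod_hom_add rmod_hom_ract)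

lemma rmod_hom_Id: "right_module \<Lambda> M \<Longrightarrow> (\<lambda>x\<in>carrier M. x) \<in> rmod_hom \<Lambda> M M"
  by (intro rmod_homI) auto

lemma rmod_hom_Zero:
  assumes "right_module \<Lambda> M" "right_module \<Lambda> N"
  shows "(\<lambda>x\<in>carrier M. \<zero>\<^bsub>N\<^esub>) \<in> rmod_hom \<Lambda> M N"
proof -
  interpret N: right_module \<Lambda> N by fact
  show ?thesis using assms by (intro rmod_homI) auto
qed

lemma rmod_hom_Plus:
  assumes f: "f \<in> rmod_hom \<Lambda> M N" "g \<in> rmod_hom \<Lambda> M N" and M: "right_module \<Lambda> M"
    and N: "right_module \<Lambda> N"
  shows "(\<lambda>x\<in>carrier M. f x \<oplus>\<^bsub>N\<^esub> g x) \<in> rmod_hom \<Lambda> M N"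
proof -
  interpret N: right_module \<Lambda> N by fact
  show ?thesis
    using f M by (intro rmod_homI)
      (simp_all add: rmod_hom_closed rmod_hom_add rmod_hom_ract N.M.a_ac N.ract_r_distr)
qed

lemma rmod_hom_neg:
  assumes f: "f \<in> rmod_hom \<Lambda> M N" and M: "right_module \<Lambda> M" and N: "right_module \<Lambda> N"
  shows "(\<lambda>x\<in>carrier M. \<ominus>\<^bsub>N\<^esub> f x) \<in> rmod_hom \<Lambda> M N"
proof -
  interpret N: right_module \<Lambda> N by fact
  show ?thesis
    using f M by (intro rmod_homI)
      (simp_all add: rmod_hom_closed rmod_hom_add rmod_hom_ract N.M.minus_add N.ract_minus_right)
qed

lemma preadditive_fg_mod: "preadditive (fg_mod \<Lambda>)"
proof
  show "Id (fg_mod \<Lambda>) A \<in> Hom (fg_mod \<Lambda>) A A" if "A \<in> Obj (fg_mod \<Lambda>)" for A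
    using that by (simp add: rmod_hom_Id fg_right_moduleD)
next
  fix f g h f' g' A B D E
  show "Comp (fg_mod \<Lambda>) A B D g f \<in> Hom (fg_mod \<Lambda>) A D"
    if "f \<in> Hom (fg_mod \<Lambda>) A B" "g \<in> Hom (fg_mod \<Lambda>) B D" "A \<in> Obj (fg_mod \<Lambda>)"
    using that by (simp add: rmod_hom_Comp fg_right_moduleD)
  show "Comp (fg_mod \<Lambda>) A B E (Comp (fg_mod \<Lambda>) B D E h g) f =
      Comp (fg_mod \<Lambda>) A D E h (Comp (fg_mod \<Lambda>) A B D g f)"
    if "f \<in> Hom (fg_mod \<Lambda>) A B"
    using that by (auto simp: fun_eq_iff compose_def restrict_def rmod_hom_closed)
  show "Comp (fg_mod \<Lambda>) A A B f (Id (fg_mod \<Lambda>) A) = f"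
    "Comp (fg_mod \<Lambda>) A B B (Id (fg_mod \<Lambda>) B) f = f"
    if "f \<in> Hom (fg_mod \<Lambda>) A B" "A \<in> Obj (fg_mod \<Lambda>)" "B \<in> Obj (fg_mod \<Lambda>)"
    using that
    by (auto intro!: rmod_hom_ext[of _ \<Lambda> A B] rmod_hom_Comp rmod_hom_Id fg_right_moduleD
        simp: compose_eq rmod_hom_closed)
  show "Plus (fg_mod \<Lambda>) A B f g \<in> Hom (fg_mod \<Lambda>) A B"
    if "f \<in> Hom (fg_mod \<Lambda>) A B" "g \<in> Hom (fg_mod \<Lambda>) A B" "A \<in> Obj (fg_mod \<Lambda>)" "B \<in> Obj (fg_mod \<Lambda>)"
    using that by (simp add: rmod_hom_Plus fg_right_moduleD)
  show "Zero (fg_mod \<Lambda>) A B \<in> Hom (fg_mod \<Lambda>) A B" if "A \<in> Obj (fg_mod \<Lambda>)" "B \<in> Obj (fg_mod \<Lambda>)"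
    using that by (simp add: rmod_hom_Zero fg_right_moduleD)
  {
    assume fg: "f \<in> Hom (fg_mod \<Lambda>) A B" "A \<in> Obj (fg_mod \<Lambda>)" "B \<in> Obj (fg_mod \<Lambda>)"
    then interpret B: right_module \<Lambda> B by (simp add: fg_right_moduleD)
    note fc = rmod_hom_closed[of f \<Lambda> A B]
    show "Plus (fg_mod \<Lambda>) A B f (Zero (fg_mod \<Lambda>) A B) = f"
    proof (rule rmod_hom_ext)
      show "Plus (fg_mod \<Lambda>) A B f (Zero (fg_mod \<Lambda>) A B) \<in> rmod_hom \<Lambda> A B"
        using fg rmod_hom_Zero[of \<Lambda> A B] by (simp only: fg_mod_simps rmod_hom_Plus fg_right_moduleD)
      show "f \<in> rmod_hom \<Lambda> A B" using fg by simp
    qed (use fg in \<open>simp add: fc\<close>)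
    show "\<exists>g\<in>Hom (fg_mod \<Lambda>) A B. Plus (fg_mod \<Lambda>) A B f g = Zero (fg_mod \<Lambda>) A B"
    proof (rule bexI)
      show "(\<lambda>x\<in>carrier A. \<ominus>\<^bsub>B\<^esub> f x) \<in> Hom (fg_mod \<Lambda>) A B"
        using fg rmod_hom_neg[of f \<Lambda> A B] by (simp add: fg_right_moduleD)
      show "Plus (fg_mod \<Lambda>) A B f (\<lambda>x\<in>carrier A. \<ominus>\<^bsub>B\<^esub> f x) = Zero (fg_mod \<Lambda>) A B"
        using fg by (auto simp: fun_eq_iff restrict_def fc B.M.r_neg)
    qed
    assume g: "g \<in> Hom (fg_mod \<Lambda>) A B"
    note gc = rmod_hom_closed[of g \<Lambda> A B]
    show "Plus (fg_mod \<Lambda>) A B f g = Plus (fg_mod \<Lambda>) A B g f"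
      using fg g by (auto simp: fun_eq_iff restrict_def fc gc B.M.a_ac)
    assume h: "h \<in> Hom (fg_mod \<Lambda>) A B"
    show "Plus (fg_mod \<Lambda>) A B (Plus (fg_mod \<Lambda>) A B f g) h = Plus (fg_mod \<Lambda>) A B f (Plus (fg_mod \<Lambda>) A B g h)"
      using fg g h rmod_hom_closed[of h \<Lambda> A B] by (auto simp: fun_eq_iff restrict_def fc gc B.M.a_ac)
  }
  show "Comp (fg_mod \<Lambda>) A B D g (Plus (fg_mod \<Lambda>) A B f f') =
      Plus (fg_mod \<Lambda>) A D (Comp (fg_mod \<Lambda>) A B D g f) (Comp (fg_mod \<Lambda>) A B D g f')"
    if "f \<in> Hom (fg_mod \<Lambda>) A B" "f' \<in> Hom (fg_mod \<Lambda>) A B" "g \<in> Hom (fg_mod \<Lambda>) B D"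
    using that by (auto simp: fun_eq_iff restrict_def compose_def rmod_hom_closed rmod_hom_add)
  show "Comp (fg_mod \<Lambda>) A B D (Plus (fg_mod \<Lambda>) B D g g') f =
      Plus (fg_mod \<Lambda>) A D (Comp (fg_mod \<Lambda>) A B D g f) (Comp (fg_mod \<Lambda>) A B D g' f)"
    if "f \<in> Hom (fg_mod \<Lambda>) A B"
    using that by (auto simp: fun_eq_iff restrict_def compose_def rmod_hom_closed)
qed

text \<open>
  The kernel property of an injective homomorphism.
\<close>

lemma rmod_hom_lift:
  assumes m: "m \<in> rmod_hom \<Lambda> A B" "inj_on m (carrier A)" and h: "h \<in> rmod_hom \<Lambda> T B"
    and im: "\<And>x. x \<in> carrier T \<Longrightarrow> h x \<in> m ` carrier A"
    and A: "right_module \<Lambda> A" and T: "right_module \<Lambda> T"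
  shows "\<exists>u\<in>rmod_hom \<Lambda> T A. \<forall>x\<in>carrier T. m (u x) = h x"
proof -
  interpret A: right_module \<Lambda> A by fact
  interpret T: right_module \<Lambda> T by fact
  define u where "u x = inv_into (carrier A) m (h x)" for x
  have u: "u x \<in> carrier A" "m (u x) = h x" if "x \<in> carrier T" for x
    unfolding u_def using im[OF that] inv_into_into[of "h x" m "carrier A"] f_inv_into_f[of "h x" m "carrier A"] by auto
  have eq: "x = y" if "x \<in> carrier A" "y \<in> carrier A" "m x = m y" for x y
    using that m(2) by (auto dest: inj_onD)
  have "restrict u (carrier T) \<in> rmod_hom \<Lambda> T A"
  proof (rule rmod_homI)
    fix x y assume xy: "x \<in> carrier T" "y \<in> carrier T"
    show "u (x \<oplus>\<^bsub>T\<^esub> y) = u x \<oplus>\<^bsub>A\<^esub> u y"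
      using xy u by (intro eq) (simp_all add: rmod_hom_add[OF m(1)] rmod_hom_add[OF h])
  next
    fix a x assume ax: "a \<in> carrier \<Lambda>" "x \<in> carrier T"
    show "u (a \<odot>\<^bsub>T\<^esub> x) = a \<odot>\<^bsub>A\<^esub> u x"
      using ax u by (intro eq) (simp_all add: rmod_hom_ract[OF m(1)] rmod_hom_ract[OF h]
          A.ract_closed T.ract_closed)
  qed (use u T in auto)
  then show ?thesis using u by (intro bexI[of _ "restrict u (carrier T)"]) simp_all
qed

text \<open>
  The cokernel property of a surjective homomorphism.
\<close>

lemma rmod_hom_descend:
  assumes p: "p \<in> rmod_hom \<Lambda> B D" "p ` carrier B = carrier D" and h: "h \<in> rmod_hom \<Lambda> B T"
    and ker: "\<And>x. \<lbrakk>x \<in> carrier B; p x = \<zero>\<^bsub>D\<^esub>\<rbrakk> \<Longrightarrow> h x = \<zero>\<^bsub>T\<^esub>"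
    and B: "right_module \<Lambda> B" and D: "right_module \<Lambda> D" and T: "right_module \<Lambda> T"
  shows "\<exists>u\<in>rmod_hom \<Lambda> D T. \<forall>x\<in>carrier B. u (p x) = h x"
proof -
  interpret B: right_module \<Lambda> B by fact
  interpret D: right_module \<Lambda> D by fact
  interpret T: right_module \<Lambda> T by fact
  define s where "s d = inv_into (carrier B) p d" for d
  have s: "s d \<in> carrier B" "p (s d) = d" if "d \<in> carrier D" for d
    unfolding s_def using that p(2) inv_into_into[of d p "carrier B"] f_inv_into_f[of d p "carrier B"] by auto
  have eq: "h x = h y" if "x \<in> carrier B" "y \<in> carrier B" "p x = p y" for x y
  proof -
    have "p (x \<ominus>\<^bsub>B\<^esub> y) = \<zero>\<^bsub>D\<^esub>"
      using that rmod_hom_closed[OF p(1)] by (simp add: rmod_hom_minus[OF p(1) B D])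
    then have "h x \<ominus>\<^bsub>T\<^esub> h y = \<zero>\<^bsub>T\<^esub>" using ker that by (simp add: rmod_hom_minus[OF h B T, symmetric])
    then show ?thesis using rmod_hom_closed[OF h] that by simp
  qed
  have "restrict (\<lambda>d. h (s d)) (carrier D) \<in> rmod_hom \<Lambda> D T"
  proof (rule rmod_homI)
    fix x y assume xy: "x \<in> carrier D" "y \<in> carrier D"
    have "h (s (x \<oplus>\<^bsub>D\<^esub> y)) = h (s x \<oplus>\<^bsub>B\<^esub> s y)"
      using xy s by (intro eq) (simp_all add: rmod_hom_add[OF p(1)])
    then show "h (s (x \<oplus>\<^bsub>D\<^esub> y)) = h (s x) \<oplus>\<^bsub>T\<^esub> h (s y)"
      using xy s by (simp add: rmod_hom_add[OF h])
  next
    fix a x assume ax: "a \<in> carrier \<Lambda>" "x \<in> carrier D"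
    have "h (s (a \<odot>\<^bsub>D\<^esub> x)) = h (a \<odot>\<^bsub>B\<^esub> s x)"
      using ax s by (intro eq) (simp_all add: rmod_hom_ract[OF p(1)] B.ract_closed D.ract_closed)
    then show "h (s (a \<odot>\<^bsub>D\<^esub> x)) = a \<odot>\<^bsub>T\<^esub> h (s x)"
      using ax s by (simp add: rmod_hom_ract[OF h])
  qed (use s D rmod_hom_closed[OF h] in auto)
  moreover have "h (s (p x)) = h x" if "x \<in> carrier B" for x
    using that s rmod_hom_closed[OF p(1)] by (intro eq) auto
  ultimately show ?thesis
    using rmod_hom_closed[OF p(1)]
    by (intro bexI[of _ "restrict (\<lambda>d. h (s d)) (carrier D)"]) simp_all
qed

lemma rsubmod_kernel:
  assumes "f \<in> rmod_hom \<Lambda> M N" "right_module \<Lambda> M" "right_module \<Lambda> N"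
  shows "rsubmod \<Lambda> M {x \<in> carrier M. f x = \<zero>\<^bsub>N\<^esub>}"
proof -
  interpret M: right_module \<Lambda> M by fact
  interpret N: right_module \<Lambda> N by fact
  show ?thesis
    using assms
    by (intro rsubmodI) (auto simp: rmod_hom_zero rmod_hom_add rmod_hom_ract M.ract_closed)
qed

lemma rsubmod_image:
  assumes f: "f \<in> rmod_hom \<Lambda> M N" and M: "right_module \<Lambda> M" and N: "right_module \<Lambda> N"
    and L: "rsubmod \<Lambda> M L"
  shows "rsubmod \<Lambda> N (f ` L)"
proof (rule rsubmodI)
  note L' = rsubmodD[OF L]
  have LM: "x \<in> L \<Longrightarrow> x \<in> carrier M" for x using L'(1) by blast
  show "f ` L \<subseteq> carrier N" using LM rmod_hom_closed[OF f] by auto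
  show "\<zero>\<^bsub>N\<^esub> \<in> f ` L" using L'(2) rmod_hom_zero[OF f M N] by force
  fix a x y
  {
    assume "x \<in> f ` L" "y \<in> f ` L"
    then obtain u v where "u \<in> L" "v \<in> L" "x = f u" "y = f v" by blast
    then show "x \<oplus>\<^bsub>N\<^esub> y \<in> f ` L"
      using L'(3) LM by (intro image_eqI[of _ _ "u \<oplus>\<^bsub>M\<^esub> v"]) (simp_all add: rmod_hom_add[OF f])
  next
    assume "a \<in> carrier \<Lambda>" "x \<in> f ` L"
    then obtain u where "a \<in> carrier \<Lambda>" "u \<in> L" "x = f u" by blast
    then show "a \<odot>\<^bsub>N\<^esub> x \<in> f ` L"
      using L'(4) LM by (intro image_eqI[of _ _ "a \<odot>\<^bsub>M\<^esub> u"]) (simp_all add: rmod_hom_ract[OF f])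
  }
qed

lemma rsubmod_vimage:
  assumes f: "f \<in> rmod_hom \<Lambda> M N" and M: "right_module \<Lambda> M" and N: "right_module \<Lambda> N"
    and L: "rsubmod \<Lambda> N L"
  shows "rsubmod \<Lambda> M {x \<in> carrier M. f x \<in> L}"
proof -
  interpret M: right_module \<Lambda> M by fact
  show ?thesis
    using rsubmodD[OF L] f M N
    by (intro rsubmodI) (auto simp: rmod_hom_zero rmod_hom_add rmod_hom_ract M.ract_closed)
qed

lemma fg_right_module_image:
  assumes M: "fg_right_module \<Lambda> M" and N: "right_module \<Lambda> N" and f: "f \<in> rmod_hom \<Lambda> M N"
    and surj: "f ` carrier M = carrier N"
  shows "fg_right_module \<Lambda> N"
proof -
  interpret M: right_module \<Lambda> M using M by (rule fg_right_moduleD)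
  interpret N: right_module \<Lambda> N by fact
  obtain G where G: "G \<subseteq> carrier M" "finite G" "rspan \<Lambda> M G = carrier M"
    using M by (auto simp: fg_right_module_iff_rspan)
  have fG: "f ` G \<subseteq> carrier N" using G surj by blast
  let ?L = "rspan \<Lambda> N (f ` G)"
  note fL = N.rsubmod_rspan[OF fG]
  have "rspan \<Lambda> M G \<subseteq> {x \<in> carrier M. f x \<in> ?L}"
  proof (rule rspan_least)
    show "rsubmod \<Lambda> M {x \<in> carrier M. f x \<in> ?L}"
      by (rule rsubmod_vimage[OF f fg_right_moduleD[OF M] N fL])
    show "G \<subseteq> {x \<in> carrier M. f x \<in> ?L}" using G(1) rspan_incl[of "f ` G" \<Lambda> N] by auto
  qed
  then have "f ` carrier M \<subseteq> ?L" unfolding G(3) by auto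
  then have "?L = carrier N" using rsubmodD(1)[OF fL] unfolding surj by simp
  then show ?thesis
    using N fG G(2) unfolding fg_right_module_iff_rspan by (intro conjI exI[of _ "f ` G"]) simp_all
qed

section \<open>Submodules, quotients and products\<close>

lemma (in right_module) right_module_submodule:
  assumes "rsubmod R M K"
  shows "right_module R (M\<lparr>carrier := K\<rparr>)"
proof -
  note K = rsubmodD[OF assms]
  have KM: "x \<in> K \<Longrightarrow> x \<in> carrier M" for x using K(1) by blast
  interpret K: abelian_group "M\<lparr>carrier := K\<rparr>"
  proof (rule abelian_groupI)
    fix x assume "x \<in> carrier (M\<lparr>carrier := K\<rparr>)"
    then show "\<exists>y\<in>carrier (M\<lparr>carrier := K\<rparr>). y \<oplus>\<^bsub>M\<lparr>carrier := K\<rparr>\<^esub> x = \<zero>\<^bsub>M\<lparr>carrier := K\<rparr>\<^esub>"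
      using rsubmod_neg[OF assms, of x] KM by (intro bexI[of _ "\<ominus>\<^bsub>M\<^esub> x"]) (simp_all add: M.l_neg)
  qed (use K KM in \<open>simp_all add: M.a_ac\<close>)
  show ?thesis
    using K KM by unfold_locales (simp_all add: ract_l_distr ract_r_distr ract_assoc ract_one)
qed

lemma rsubmod_submodule:
  "K \<subseteq> carrier M \<Longrightarrow> rsubmod R (M\<lparr>carrier := K\<rparr>) L \<longleftrightarrow> rsubmod R M L \<and> L \<subseteq> K"
  by (auto simp: rsubmod_def)

text \<open>
  The quotient is carried by a set of representatives of the cosets, not by the cosets
  themselves: its elements are then of the same type as those of \<open>M\<close>, and it is again an object
  of the category if \<open>M\<close> is one.
\<close>

lemma (in right_module) quotient_exists:
  assumes L: "rsubmod R M L"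
  shows "\<exists>(Q :: ('a, 'b) module). right_module R Q \<and>
    (\<exists>p\<in>rmod_hom R M Q. p ` carrier M = carrier Q \<and> (\<forall>x\<in>carrier M. p x = \<zero>\<^bsub>Q\<^esub> \<longleftrightarrow> x \<in> L))"
proof -
  note L' = rsubmodD[OF L] and Ln = rsubmod_neg[OF L] and Lm = rsubmod_minus[OF L]
  have LM: "x \<in> L \<Longrightarrow> x \<in> carrier M" for x using L'(1) by blast
  \<comment> \<open>a choice of one element in each coset of \<open>L\<close>\<close>
  define rep where "rep x = (SOME y. y \<in> carrier M \<and> y \<ominus>\<^bsub>M\<^esub> x \<in> L)" for x
  have rep: "rep x \<in> carrier M" "rep x \<ominus>\<^bsub>M\<^esub> x \<in> L" if "x \<in> carrier M" for x
  proof -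
    have "x \<in> carrier M \<and> x \<ominus>\<^bsub>M\<^esub> x \<in> L" using that L'(2) by (simp add: M.minus_eq M.r_neg)
    then have "rep x \<in> carrier M \<and> rep x \<ominus>\<^bsub>M\<^esub> x \<in> L" unfolding rep_def by (rule someI)
    then show "rep x \<in> carrier M" "rep x \<ominus>\<^bsub>M\<^esub> x \<in> L" by simp_all
  qed
  have shift: "u \<ominus>\<^bsub>M\<^esub> y = (u \<ominus>\<^bsub>M\<^esub> x) \<oplus>\<^bsub>M\<^esub> (x \<ominus>\<^bsub>M\<^esub> y)"
    if "u \<in> carrier M" "x \<in> carrier M" "y \<in> carrier M" for u x y
  proof -
    have "(u \<ominus>\<^bsub>M\<^esub> x) \<oplus>\<^bsub>M\<^esub> (x \<ominus>\<^bsub>M\<^esub> y) = u \<oplus>\<^bsub>M\<^esub> ((\<ominus>\<^bsub>M\<^esub> x \<oplus>\<^bsub>M\<^esub> x) \<oplus>\<^bsub>M\<^esub> \<ominus>\<^bsub>M\<^esub> y)"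
      using that by (simp only: M.minus_eq M.a_assoc M.a_inv_closed M.a_closed)
    then show ?thesis using that by (simp add: M.l_neg M.minus_eq)
  qed
  have swap: "y \<ominus>\<^bsub>M\<^esub> x \<in> L" if "x \<ominus>\<^bsub>M\<^esub> y \<in> L" "x \<in> carrier M" "y \<in> carrier M" for x y
  proof -
    have "y \<ominus>\<^bsub>M\<^esub> x = \<ominus>\<^bsub>M\<^esub> (x \<ominus>\<^bsub>M\<^esub> y)" using that by (simp add: M.minus_eq M.minus_add M.a_comm)
    then show ?thesis using Ln[OF that(1)] by simp
  qed
  have rep_eq: "rep x = rep y" if "x \<in> carrier M" "y \<in> carrier M" "x \<ominus>\<^bsub>M\<^esub> y \<in> L" for x y
  proof -
    have "(u \<in> carrier M \<and> u \<ominus>\<^bsub>M\<^esub> x \<in> L) = (u \<in> carrier M \<and> u \<ominus>\<^bsub>M\<^esub> y \<in> L)" for u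
      using shift[of u x y] shift[of u y x] L'(3) swap[OF that(3,1,2)] that by metis
    then show ?thesis by (simp add: rep_def)
  qed
  have rep_iff: "rep x = rep y \<longleftrightarrow> x \<ominus>\<^bsub>M\<^esub> y \<in> L" if "x \<in> carrier M" "y \<in> carrier M" for x y
  proof
    assume "rep x = rep y"
    then have "x \<ominus>\<^bsub>M\<^esub> rep x \<in> L" "rep x \<ominus>\<^bsub>M\<^esub> y \<in> L" using rep[OF that(1)] rep[OF that(2)] swap that by auto
    then have "(x \<ominus>\<^bsub>M\<^esub> rep x) \<oplus>\<^bsub>M\<^esub> (rep x \<ominus>\<^bsub>M\<^esub> y) \<in> L" by (rule L'(3))
    then show "x \<ominus>\<^bsub>M\<^esub> y \<in> L" using shift[of x "rep x" y] rep[OF that(1)] that by simp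
  qed (rule rep_eq[OF that])
  have add_cong: "(u \<oplus>\<^bsub>M\<^esub> v) \<ominus>\<^bsub>M\<^esub> (x \<oplus>\<^bsub>M\<^esub> y) \<in> L"
    if "u \<in> carrier M" "v \<in> carrier M" "x \<in> carrier M" "y \<in> carrier M" "u \<ominus>\<^bsub>M\<^esub> x \<in> L" "v \<ominus>\<^bsub>M\<^esub> y \<in> L" for u v x y
  proof -
    have "(u \<oplus>\<^bsub>M\<^esub> v) \<ominus>\<^bsub>M\<^esub> (x \<oplus>\<^bsub>M\<^esub> y) = (u \<ominus>\<^bsub>M\<^esub> x) \<oplus>\<^bsub>M\<^esub> (v \<ominus>\<^bsub>M\<^esub> y)"
      using that(1-4) by (simp add: M.minus_eq M.minus_add M.a_ac)
    then show ?thesis using L'(3)[OF that(5,6)] by simp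
  qed
  have self: "x \<ominus>\<^bsub>M\<^esub> x \<in> L" if "x \<in> carrier M" for x using that L'(2) by (simp add: M.minus_eq M.r_neg)
  have r1: "rep (rep x \<oplus>\<^bsub>M\<^esub> y) = rep (x \<oplus>\<^bsub>M\<^esub> y)" "rep (y \<oplus>\<^bsub>M\<^esub> rep x) = rep (y \<oplus>\<^bsub>M\<^esub> x)"
    if "x \<in> carrier M" "y \<in> carrier M" for x y
    using that rep[OF that(1)] self[OF that(2)] add_cong by (auto intro!: rep_eq)
  have r0: "rep (rep x) = rep x" if "x \<in> carrier M" for x
    using that rep by (intro rep_eq)
  have r2: "rep (a \<odot>\<^bsub>M\<^esub> rep x) = rep (a \<odot>\<^bsub>M\<^esub> x)" if "x \<in> carrier M" "a \<in> carrier R" for x a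
  proof (rule rep_eq)
    have "a \<odot>\<^bsub>M\<^esub> (rep x \<ominus>\<^bsub>M\<^esub> x) \<in> L" using rep(2)[OF that(1)] L'(4) that by blast
    then show "a \<odot>\<^bsub>M\<^esub> rep x \<ominus>\<^bsub>M\<^esub> a \<odot>\<^bsub>M\<^esub> x \<in> L"
      using that rep(1)[OF that(1)] by (simp add: M.minus_eq ract_r_distr ract_minus_right)
  qed (use that rep in \<open>simp_all add: ract_closed\<close>)
  define Q :: "('a, 'b) module" where
    "Q = \<lparr>partial_object.carrier = rep ` carrier M, monoid.mult = (\<lambda>x y. x), monoid.one = rep \<zero>\<^bsub>M\<^esub>,
      ring.zero = rep \<zero>\<^bsub>M\<^esub>, ring.add = (\<lambda>x y. rep (x \<oplus>\<^bsub>M\<^esub> y)), module.smult = (\<lambda>a x. rep (a \<odot>\<^bsub>M\<^esub> x))\<rparr>"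
  have Q_simps [simp]: "carrier Q = rep ` carrier M" "\<zero>\<^bsub>Q\<^esub> = rep \<zero>\<^bsub>M\<^esub>"
    "\<And>x y. x \<oplus>\<^bsub>Q\<^esub> y = rep (x \<oplus>\<^bsub>M\<^esub> y)" "\<And>a x. a \<odot>\<^bsub>Q\<^esub> x = rep (a \<odot>\<^bsub>M\<^esub> x)"
    by (simp_all add: Q_def)
  interpret Q: abelian_group Q
  proof (rule abelian_groupI)
    fix x assume "x \<in> carrier Q"
    then obtain m where m: "m \<in> carrier M" "x = rep m" by auto
    then show "\<exists>y\<in>carrier Q. y \<oplus>\<^bsub>Q\<^esub> x = \<zero>\<^bsub>Q\<^esub>"
      using rep(1) by (intro bexI[of _ "rep (\<ominus>\<^bsub>M\<^esub> m)"]) (auto simp: r1 M.l_neg)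
  next
    fix x y assume "x \<in> carrier Q" "y \<in> carrier Q"
    then have "x \<in> carrier M" "y \<in> carrier M" using rep(1) by auto
    then have "x \<oplus>\<^bsub>M\<^esub> y = y \<oplus>\<^bsub>M\<^esub> x" by (rule M.a_comm)
    then show "x \<oplus>\<^bsub>Q\<^esub> y = y \<oplus>\<^bsub>Q\<^esub> x" by simp
  next
    fix x y z assume "x \<in> carrier Q" "y \<in> carrier Q" "z \<in> carrier Q"
    then have xyz: "x \<in> carrier M" "y \<in> carrier M" "z \<in> carrier M" using rep(1) by auto
    then have "rep (rep (x \<oplus>\<^bsub>M\<^esub> y) \<oplus>\<^bsub>M\<^esub> z) = rep (x \<oplus>\<^bsub>M\<^esub> rep (y \<oplus>\<^bsub>M\<^esub> z))"
      by (simp add: r1 M.a_assoc)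
    then show "x \<oplus>\<^bsub>Q\<^esub> y \<oplus>\<^bsub>Q\<^esub> z = x \<oplus>\<^bsub>Q\<^esub> (y \<oplus>\<^bsub>Q\<^esub> z)" by simp
  next
    fix x y assume "x \<in> carrier Q" "y \<in> carrier Q"
    then have "x \<in> carrier M" "y \<in> carrier M" using rep(1) by auto
    then show "x \<oplus>\<^bsub>Q\<^esub> y \<in> carrier Q" by simp
  next
    show "\<zero>\<^bsub>Q\<^esub> \<in> carrier Q" by simp
  next
    fix x assume "x \<in> carrier Q"
    then obtain m where m: "m \<in> carrier M" "x = rep m" by auto
    then show "\<zero>\<^bsub>Q\<^esub> \<oplus>\<^bsub>Q\<^esub> x = x" using rep(1)[OF m(1)] by (simp add: r0 r1)
  qed
  have Q: "right_module R Q"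
  proof (unfold_locales, goal_cases)
    case (1 a x)
    then have "x \<in> carrier M" using rep(1) by auto
    then show ?case using 1 by (simp add: ract_closed)
  next
    case (2 a b x)
    then have "x \<in> carrier M" using rep(1) by auto
    then show ?case using 2 by (simp add: r1 rep(1) ract_closed ract_l_distr del: Q_simps(1))
  next
    case (3 a x y)
    then have "x \<in> carrier M" "y \<in> carrier M" using rep(1) by auto
    then show ?case using 3 by (simp add: r1 r2 rep(1) ract_closed ract_r_distr del: Q_simps(1))
  next
    case (4 a b x)
    then have "x \<in> carrier M" using rep(1) by auto
    then show ?case using 4 by (simp add: r2 ract_closed ract_assoc del: Q_simps(1))
  next
    case (5 x)
    then obtain m where "m \<in> carrier M" "x = rep m" by auto
    then show ?case using rep(1)[of m] by (simp add: r0 ract_one)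
  qed
  moreover have "restrict rep (carrier M) \<in> rmod_hom R M Q"
    by (rule rmod_homI) (simp_all add: r1 r2 rep(1) ract_closed right_module_axioms)
  moreover have "restrict rep (carrier M) ` carrier M = carrier Q" by auto
  moreover have "x \<ominus>\<^bsub>M\<^esub> \<zero>\<^bsub>M\<^esub> = x" if "x \<in> carrier M" for x using that by (simp add: M.minus_eq)
  then have "\<forall>x\<in>carrier M. restrict rep (carrier M) x = \<zero>\<^bsub>Q\<^esub> \<longleftrightarrow> x \<in> L"
    by (simp add: rep_iff)
  ultimately show ?thesis by blast
qed

definition rmod_prod :: "('a, 'm, 'x) module_scheme \<Rightarrow> ('a, 'n, 'y) module_scheme \<Rightarrow> ('a, 'm \<times> 'n) module" where
  "rmod_prod A B = \<lparr>partial_object.carrier = carrier A \<times> carrier B, monoid.mult = (\<lambda>x y. x),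
     monoid.one = (\<zero>\<^bsub>A\<^esub>, \<zero>\<^bsub>B\<^esub>), ring.zero = (\<zero>\<^bsub>A\<^esub>, \<zero>\<^bsub>B\<^esub>),
     ring.add = (\<lambda>(a, b) (c, d). (a \<oplus>\<^bsub>A\<^esub> c, b \<oplus>\<^bsub>B\<^esub> d)),
     module.smult = (\<lambda>r (a, b). (r \<odot>\<^bsub>A\<^esub> a, r \<odot>\<^bsub>B\<^esub> b))\<rparr>"

lemma rmod_prod_simps [simp]:
  "carrier (rmod_prod A B) = carrier A \<times> carrier B"
  "\<zero>\<^bsub>rmod_prod A B\<^esub> = (\<zero>\<^bsub>A\<^esub>, \<zero>\<^bsub>B\<^esub>)"
  "(a, b) \<oplus>\<^bsub>rmod_prod A B\<^esub> (c, d) = (a \<oplus>\<^bsub>A\<^esub> c, b \<oplus>\<^bsub>B\<^esub> d)"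
  "r \<odot>\<^bsub>rmod_prod A B\<^esub> (a, b) = (r \<odot>\<^bsub>A\<^esub> a, r \<odot>\<^bsub>B\<^esub> b)"
  by (simp_all add: rmod_prod_def)

lemma right_module_prod:
  assumes "right_module \<Lambda> A" "right_module \<Lambda> B"
  shows "right_module \<Lambda> (rmod_prod A B)"
proof -
  interpret A: right_module \<Lambda> A by fact
  interpret B: right_module \<Lambda> B by fact
  interpret P: abelian_group "rmod_prod A B"
  proof (rule abelian_groupI)
    fix x assume "x \<in> carrier (rmod_prod A B)"
    then obtain a b where "a \<in> carrier A" "b \<in> carrier B" "x = (a, b)" by auto
    then show "\<exists>y\<in>carrier (rmod_prod A B). y \<oplus>\<^bsub>rmod_prod A B\<^esub> x = \<zero>\<^bsub>rmod_prod A B\<^esub>"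
      by (intro bexI[of _ "(\<ominus>\<^bsub>A\<^esub> a, \<ominus>\<^bsub>B\<^esub> b)"]) (simp_all add: A.M.l_neg B.M.l_neg)
  qed (auto simp: A.M.a_ac B.M.a_ac)
  show ?thesis
    by unfold_locales
      (auto simp: A.ract_closed B.ract_closed A.ract_l_distr B.ract_l_distr A.ract_r_distr
        B.ract_r_distr A.ract_assoc B.ract_assoc A.ract_one B.ract_one)
qed

lemma fg_right_module_prod:
  assumes A: "fg_right_module \<Lambda> A" and B: "fg_right_module \<Lambda> B"
  shows "fg_right_module \<Lambda> (rmod_prod A B)"
proof -
  note rm = right_module_prod[OF A[THEN fg_right_moduleD] B[THEN fg_right_moduleD]]
  interpret A: right_module \<Lambda> A using A by (rule fg_right_moduleD)
  interpret B: right_module \<Lambda> B using B by (rule fg_right_moduleD)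
  interpret P: right_module \<Lambda> "rmod_prod A B" by (rule rm)
  obtain G where G: "G \<subseteq> carrier A" "finite G" "rspan \<Lambda> A G = carrier A"
    using A by (auto simp: fg_right_module_iff_rspan)
  obtain H where H: "H \<subseteq> carrier B" "finite H" "rspan \<Lambda> B H = carrier B"
    using B by (auto simp: fg_right_module_iff_rspan)
  let ?F = "(\<lambda>a. (a, \<zero>\<^bsub>B\<^esub>)) ` G \<union> (\<lambda>b. (\<zero>\<^bsub>A\<^esub>, b)) ` H"
  have F: "?F \<subseteq> carrier (rmod_prod A B)" using G H by auto
  define L where "L = rspan \<Lambda> (rmod_prod A B) ?F"
  have Ls: "rsubmod \<Lambda> (rmod_prod A B) L" unfolding L_def by (rule P.rsubmod_rspan[OF F])
  note L' = rsubmodD[OF Ls]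
  have FL: "?F \<subseteq> L" unfolding L_def by (rule rspan_incl)
  have L0: "(\<zero>\<^bsub>A\<^esub>, \<zero>\<^bsub>B\<^esub>) \<in> L" using L'(2) by simp
  have La: "(a \<oplus>\<^bsub>A\<^esub> c, b \<oplus>\<^bsub>B\<^esub> d) \<in> L" if "(a, b) \<in> L" "(c, d) \<in> L" for a b c d
    using L'(3)[OF that] by simp
  have Lr: "(r \<odot>\<^bsub>A\<^esub> a, r \<odot>\<^bsub>B\<^esub> b) \<in> L" if "r \<in> carrier \<Lambda>" "(a, b) \<in> L" for r a b
    using L'(4)[OF that] by simp
  have "rspan \<Lambda> A G \<subseteq> {a \<in> carrier A. (a, \<zero>\<^bsub>B\<^esub>) \<in> L}"
  proof (rule rspan_least)
    show "rsubmod \<Lambda> A {a \<in> carrier A. (a, \<zero>\<^bsub>B\<^esub>) \<in> L}"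
    proof (rule rsubmodI)
      fix x y assume "x \<in> {a \<in> carrier A. (a, \<zero>\<^bsub>B\<^esub>) \<in> L}" "y \<in> {a \<in> carrier A. (a, \<zero>\<^bsub>B\<^esub>) \<in> L}"
      then show "x \<oplus>\<^bsub>A\<^esub> y \<in> {a \<in> carrier A. (a, \<zero>\<^bsub>B\<^esub>) \<in> L}" using La[of x "\<zero>\<^bsub>B\<^esub>" y "\<zero>\<^bsub>B\<^esub>"] by simp
    next
      fix r x assume "r \<in> carrier \<Lambda>" "x \<in> {a \<in> carrier A. (a, \<zero>\<^bsub>B\<^esub>) \<in> L}"
      then show "r \<odot>\<^bsub>A\<^esub> x \<in> {a \<in> carrier A. (a, \<zero>\<^bsub>B\<^esub>) \<in> L}"
        using Lr[of r x "\<zero>\<^bsub>B\<^esub>"] by (simp add: A.ract_closed)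
    qed (use L0 in auto)
    show "G \<subseteq> {a \<in> carrier A. (a, \<zero>\<^bsub>B\<^esub>) \<in> L}" using G FL by auto
  qed
  then have 1: "(a, \<zero>\<^bsub>B\<^esub>) \<in> L" if "a \<in> carrier A" for a using that unfolding G(3) by auto
  have "rspan \<Lambda> B H \<subseteq> {b \<in> carrier B. (\<zero>\<^bsub>A\<^esub>, b) \<in> L}"
  proof (rule rspan_least)
    show "rsubmod \<Lambda> B {b \<in> carrier B. (\<zero>\<^bsub>A\<^esub>, b) \<in> L}"
    proof (rule rsubmodI)
      fix x y assume "x \<in> {b \<in> carrier B. (\<zero>\<^bsub>A\<^esub>, b) \<in> L}" "y \<in> {b \<in> carrier B. (\<zero>\<^bsub>A\<^esub>, b) \<in> L}"
      then show "x \<oplus>\<^bsub>B\<^esub> y \<in> {b \<in> carrier B. (\<zero>\<^bsub>A\<^esub>, b) \<in> L}" using La[of "\<zero>\<^bsub>A\<^esub>" x "\<zero>\<^bsub>A\<^esub>" y] by simp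
    next
      fix r x assume "r \<in> carrier \<Lambda>" "x \<in> {b \<in> carrier B. (\<zero>\<^bsub>A\<^esub>, b) \<in> L}"
      then show "r \<odot>\<^bsub>B\<^esub> x \<in> {b \<in> carrier B. (\<zero>\<^bsub>A\<^esub>, b) \<in> L}"
        using Lr[of r "\<zero>\<^bsub>A\<^esub>" x] by (simp add: B.ract_closed)
    qed (use L0 in auto)
    show "H \<subseteq> {b \<in> carrier B. (\<zero>\<^bsub>A\<^esub>, b) \<in> L}" using H FL by auto
  qed
  then have 2: "(\<zero>\<^bsub>A\<^esub>, b) \<in> L" if "b \<in> carrier B" for b using that unfolding H(3) by auto
  have "(a, b) \<in> L" if "a \<in> carrier A" "b \<in> carrier B" for a b
    using La[OF 1[OF that(1)] 2[OF that(2)]] that by simp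
  then have "L = carrier (rmod_prod A B)" using L'(1) by auto
  then show ?thesis
    using rm F G(2) H(2) unfolding fg_right_module_iff_rspan L_def by (intro conjI exI[of _ ?F]) simp_all
qed

lemma fg_mod_zero_exists:
  assumes "ring \<Lambda>"
  shows "\<exists>Z. zero_object (fg_mod \<Lambda>) Z"
proof -
  interpret ring \<Lambda> by fact
  define Z :: "'a rmod" where
    "Z = \<lparr>partial_object.carrier = {{}}, monoid.mult = (\<lambda>x y. x), monoid.one = {}, ring.zero = {},
      ring.add = (\<lambda>x y. {}), module.smult = (\<lambda>a x. {})\<rparr>"
  have Z [simp]: "carrier Z = {{}}" "\<zero>\<^bsub>Z\<^esub> = {}" "\<And>x y. x \<oplus>\<^bsub>Z\<^esub> y = {}" "\<And>a x. a \<odot>\<^bsub>Z\<^esub> x = {}"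
    by (simp_all add: Z_def)
  interpret Z: abelian_group Z by (rule abelian_groupI) auto
  have rm: "right_module \<Lambda> Z" by unfold_locales auto
  then interpret Zm: right_module \<Lambda> Z .
  have "rsubmod \<Lambda> Z (rspan \<Lambda> Z {})" by (rule Zm.rsubmod_rspan) simp
  then have "rspan \<Lambda> Z {} = carrier Z" using rsubmodD(1,2)[of \<Lambda> Z "rspan \<Lambda> Z {}"] by auto
  then have "fg_right_module \<Lambda> Z"
    using rm unfolding fg_right_module_iff_rspan by (intro conjI exI[of _ "{}"]) simp_all
  then have "zero_object (fg_mod \<Lambda>) Z"
    by (subst preadditive.zero_object_iff[OF preadditive_fg_mod]) (auto simp: fun_eq_iff restrict_def)
  then show ?thesis by blast
qed

text \<open>
  The product module has elements of another type and is replaced by a copy in the category.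
\<close>

lemma fg_mod_biproduct_exists:
  assumes A: "A \<in> Obj (fg_mod \<Lambda>)" and B: "B \<in> Obj (fg_mod \<Lambda>)"
  shows "\<exists>S i j p q. biproduct (fg_mod \<Lambda>) S A B i j p q"
proof -
  note rA = A[simplified, THEN fg_right_moduleD] and rB = B[simplified, THEN fg_right_moduleD]
  let ?P = "rmod_prod A B"
  note rP = right_module_prod[OF rA rB]
  interpret A: right_module \<Lambda> A by (rule rA)
  interpret B: right_module \<Lambda> B by (rule rB)
  obtain S f where S: "S \<in> Obj (fg_mod \<Lambda>)" and f: "f \<in> rmod_hom \<Lambda> ?P S"
    and bij: "bij_betw f (carrier ?P) (carrier S)"
    using fg_right_module_represented[OF fg_right_module_prod] A B by (metis fg_mod_simps(1))
  note rS = S[simplified, THEN fg_right_moduleD]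
  interpret S: right_module \<Lambda> S by (rule rS)
  have f_inj: "inj_on f (carrier ?P)" and f_surj: "f ` carrier ?P = carrier S"
    using bij by (auto simp: bij_betw_def)
  obtain u where u: "u \<in> rmod_hom \<Lambda> S ?P" "\<And>x. x \<in> carrier S \<Longrightarrow> f (u x) = x"
    using rmod_hom_lift[OF f f_inj rmod_hom_Id[OF rS] _ rP rS] f_surj by auto
  note fc = rmod_hom_closed[OF f] and uc = rmod_hom_closed[OF u(1)]
  have uf: "u (f x) = x" if "x \<in> carrier ?P" for x
    by (rule inj_onD[OF f_inj u(2)[OF fc[OF that]] uc[OF fc[OF that]] that])
  have ua: "u (x \<oplus>\<^bsub>S\<^esub> y) = (fst (u x) \<oplus>\<^bsub>A\<^esub> fst (u y), snd (u x) \<oplus>\<^bsub>B\<^esub> snd (u y))"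
    if "x \<in> carrier S" "y \<in> carrier S" for x y
    using rmod_hom_add[OF u(1) that] by (metis prod.collapse rmod_prod_simps(3))
  have ur: "u (a \<odot>\<^bsub>S\<^esub> x) = (a \<odot>\<^bsub>A\<^esub> fst (u x), a \<odot>\<^bsub>B\<^esub> snd (u x))"
    if "a \<in> carrier \<Lambda>" "x \<in> carrier S" for a x
    using rmod_hom_ract[OF u(1) that] by (metis prod.collapse rmod_prod_simps(4))
  have ucf: "fst (u x) \<in> carrier A" "snd (u x) \<in> carrier B" if "x \<in> carrier S" for x
    using uc[OF that] by auto
  have fa: "f (a, b) \<oplus>\<^bsub>S\<^esub> f (c, d) = f (a \<oplus>\<^bsub>A\<^esub> c, b \<oplus>\<^bsub>B\<^esub> d)"
    if "a \<in> carrier A" "b \<in> carrier B" "c \<in> carrier A" "d \<in> carrier B" for a b c d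
    using rmod_hom_add[OF f, of "(a, b)" "(c, d)"] that by simp
  have fr: "f (r \<odot>\<^bsub>A\<^esub> a, r \<odot>\<^bsub>B\<^esub> b) = r \<odot>\<^bsub>S\<^esub> f (a, b)"
    if "r \<in> carrier \<Lambda>" "a \<in> carrier A" "b \<in> carrier B" for r a b
    using rmod_hom_ract[OF f, of r "(a, b)"] that by simp
  define i where "i = (\<lambda>a\<in>carrier A. f (a, \<zero>\<^bsub>B\<^esub>))"
  define j where "j = (\<lambda>b\<in>carrier B. f (\<zero>\<^bsub>A\<^esub>, b))"
  define p where "p = (\<lambda>x\<in>carrier S. fst (u x))"
  define q where "q = (\<lambda>x\<in>carrier S. snd (u x))"
  have i: "i \<in> rmod_hom \<Lambda> A S" unfolding i_def
    by (rule rmod_homI) (simp_all add: fc fa rA fr[symmetric])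
  have j: "j \<in> rmod_hom \<Lambda> B S" unfolding j_def
    by (rule rmod_homI) (simp_all add: fc fa rB fr[symmetric])
  have p: "p \<in> rmod_hom \<Lambda> S A" unfolding p_def
    by (rule rmod_homI) (simp_all add: ucf ua ur rS)
  have q: "q \<in> rmod_hom \<Lambda> S B" unfolding q_def
    by (rule rmod_homI) (simp_all add: ucf ua ur rS)
  have sum: "f (fst (u x), \<zero>\<^bsub>B\<^esub>) \<oplus>\<^bsub>S\<^esub> f (\<zero>\<^bsub>A\<^esub>, snd (u x)) = x" if "x \<in> carrier S" for x
    using that ucf[OF that] u(2)[OF that] by (simp add: fa)
  have eqs: "compose (carrier A) p i = (\<lambda>x\<in>carrier A. x)" "compose (carrier B) q j = (\<lambda>x\<in>carrier B. x)"
    "compose (carrier B) p j = (\<lambda>x\<in>carrier B. \<zero>\<^bsub>A\<^esub>)" "compose (carrier A) q i = (\<lambda>x\<in>carrier A. \<zero>\<^bsub>B\<^esub>)"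
    "(\<lambda>x\<in>carrier S. compose (carrier S) i p x \<oplus>\<^bsub>S\<^esub> compose (carrier S) j q x) = (\<lambda>x\<in>carrier S. x)"
    by (auto simp: fun_eq_iff compose_def restrict_def p_def q_def i_def j_def fc uf ucf sum)
  have "biproduct (fg_mod \<Lambda>) S A B i j p q"
    unfolding biproduct_def using S A B i j p q eqs by simp
  then show ?thesis by blast
qed

section \<open>The category of finitely generated modules over an Artin algebra\<close>

text \<open>
  If \<open>H\<close> generates the algebra over the base ring \<open>R\<close> and \<open>G\<close> generates \<open>M\<close> over the algebra, then
  the products \<open>g h\<close> generate \<open>M\<close> over \<open>R\<close>. So \<open>M\<close> has the descending chain condition over \<open>R\<close>,
  and its submodules are finitely generated over \<open>R\<close> and all the more over the algebra.
\<close>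

lemma artin_algebra_submodule_fg:
  fixes R :: "('r, 's) ring_scheme" and M :: "('a, 'm, 'z) module_scheme"
  assumes alg: "artin_algebra R \<phi> \<Lambda>" and M: "fg_right_module \<Lambda> M" and K: "rsubmod \<Lambda> M K"
  shows "fg_right_module \<Lambda> (M\<lparr>carrier := K\<rparr>)"
proof -
  interpret M: right_module \<Lambda> M using M by (rule fg_right_moduleD)
  interpret R: cring R using alg by (simp add: artin_algebra_def)
  interpret \<phi>: ring_hom_ring R \<Lambda> \<phi>
    using alg by (intro ring_hom_ringI2) (auto simp: artin_algebra_def cring.axioms)
  have central: "\<phi> r \<otimes>\<^bsub>\<Lambda>\<^esub> a = a \<otimes>\<^bsub>\<Lambda>\<^esub> \<phi> r" if "r \<in> carrier R" "a \<in> carrier \<Lambda>" for r a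
    using alg that by (simp add: artin_algebra_def)
  obtain H where H: "H \<subseteq> carrier \<Lambda>" "finite H"
    and gen: "\<And>a. a \<in> carrier \<Lambda> \<Longrightarrow> \<exists>c\<in>H \<rightarrow> carrier R. a = (\<Oplus>\<^bsub>\<Lambda>\<^esub>g\<in>H. \<phi> (c g) \<otimes>\<^bsub>\<Lambda>\<^esub> g)"
    using alg unfolding artin_algebra_def by auto
  obtain G where G: "G \<subseteq> carrier M" "finite G" "rspan \<Lambda> M G = carrier M"
    using M by (auto simp: fg_right_module_iff_rspan)
  define N :: "('r, 'm) module" where
    "N = \<lparr>partial_object.carrier = carrier M, monoid.mult = (\<lambda>x y. x), monoid.one = \<zero>\<^bsub>M\<^esub>,
      ring.zero = \<zero>\<^bsub>M\<^esub>, ring.add = (\<lambda>x y. x \<oplus>\<^bsub>M\<^esub> y), module.smult = (\<lambda>r x. \<phi> r \<odot>\<^bsub>M\<^esub> x)\<rparr>"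
  have N [simp]: "carrier N = carrier M" "\<zero>\<^bsub>N\<^esub> = \<zero>\<^bsub>M\<^esub>" "\<And>x y. x \<oplus>\<^bsub>N\<^esub> y = x \<oplus>\<^bsub>M\<^esub> y"
    "\<And>r x. r \<odot>\<^bsub>N\<^esub> x = \<phi> r \<odot>\<^bsub>M\<^esub> x"
    by (simp_all add: N_def)
  interpret N: abelian_group N
  proof (rule abelian_groupI)
    fix x assume "x \<in> carrier N"
    then show "\<exists>y\<in>carrier N. y \<oplus>\<^bsub>N\<^esub> x = \<zero>\<^bsub>N\<^esub>"
      by (intro bexI[of _ "\<ominus>\<^bsub>M\<^esub> x"]) (simp_all add: M.M.l_neg)
  qed (simp_all add: M.M.a_ac)
  interpret N: artinian_comm_module R N
  proof (unfold_locales, goal_cases)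
    case (4 a b x)
    then show ?case by (simp add: M.ract_assoc)
  qed (use alg in \<open>simp_all add: M.ract_closed M.ract_l_distr M.ract_r_distr M.ract_one R.m_comm
      artin_algebra_def\<close>)
  have sub: "rsubmod R N L" if "rsubmod \<Lambda> M L" for L
    using that by (simp add: rsubmod_def)
  let ?F = "(\<lambda>(h, g). h \<odot>\<^bsub>M\<^esub> g) ` (H \<times> G)"
  have F: "finite ?F" "?F \<subseteq> carrier N" using G H by (auto intro!: M.ract_closed)
  have FN: "rspan R N ?F = carrier N"
  proof
    show "rspan R N ?F \<subseteq> carrier N" using rsubmodD(1)[OF N.rsubmod_rspan[OF F(2)]] .
    define L where "L = rspan R N ?F"
    have "rsubmod R N L" unfolding L_def by (rule N.rsubmod_rspan[OF F(2)])
    note L = rsubmodD[OF this, simplified]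
    have FL: "h \<odot>\<^bsub>M\<^esub> g \<in> L" if "h \<in> H" "g \<in> G" for h g
      using that rspan_incl[of ?F R N] unfolding L_def by auto
    have ag: "a \<odot>\<^bsub>M\<^esub> g \<in> L" if a: "a \<in> carrier \<Lambda>" and g: "g \<in> G" for a g
    proof -
      obtain c where c: "c \<in> H \<rightarrow> carrier R" "a = (\<Oplus>\<^bsub>\<Lambda>\<^esub>h\<in>H. \<phi> (c h) \<otimes>\<^bsub>\<Lambda>\<^esub> h)"
        using gen[OF a] by blast
      have gM: "g \<in> carrier M" using g G by blast
      have "(\<Oplus>\<^bsub>\<Lambda>\<^esub>h\<in>H'. \<phi> (c h) \<otimes>\<^bsub>\<Lambda>\<^esub> h) \<odot>\<^bsub>M\<^esub> g \<in> L" if "finite H'" "H' \<subseteq> H" for H'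
        using that
      proof (induction H')
        case empty
        then show ?case using L(2) gM by simp
      next
        case (insert h H')
        have h: "h \<in> H" "h \<in> carrier \<Lambda>" "c h \<in> carrier R" using insert.prems H c(1) by auto
        have fin: "(\<lambda>h. \<phi> (c h) \<otimes>\<^bsub>\<Lambda>\<^esub> h) \<in> H' \<rightarrow> carrier \<Lambda>"
          using insert.prems H(1) c(1) by (auto simp: subset_iff Pi_iff)
        then have sum: "(\<Oplus>\<^bsub>\<Lambda>\<^esub>h\<in>insert h H'. \<phi> (c h) \<otimes>\<^bsub>\<Lambda>\<^esub> h) \<odot>\<^bsub>M\<^esub> g =
            (\<phi> (c h) \<otimes>\<^bsub>\<Lambda>\<^esub> h) \<odot>\<^bsub>M\<^esub> g \<oplus>\<^bsub>M\<^esub> (\<Oplus>\<^bsub>\<Lambda>\<^esub>h\<in>H'. \<phi> (c h) \<otimes>\<^bsub>\<Lambda>\<^esub> h) \<odot>\<^bsub>M\<^esub> g"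
          using insert.hyps h gM by (simp add: M.ract_l_distr)
        have "(\<phi> (c h) \<otimes>\<^bsub>\<Lambda>\<^esub> h) \<odot>\<^bsub>M\<^esub> g = \<phi> (c h) \<odot>\<^bsub>M\<^esub> (h \<odot>\<^bsub>M\<^esub> g)"
          using h gM by (simp add: central M.ract_assoc)
        then have "(\<phi> (c h) \<otimes>\<^bsub>\<Lambda>\<^esub> h) \<odot>\<^bsub>M\<^esub> g \<in> L" using L(4) FL h g by simp
        moreover have "(\<Oplus>\<^bsub>\<Lambda>\<^esub>h\<in>H'. \<phi> (c h) \<otimes>\<^bsub>\<Lambda>\<^esub> h) \<odot>\<^bsub>M\<^esub> g \<in> L" using insert by simp
        ultimately show ?case unfolding sum by (rule L(3))
      qed
      then show ?thesis using c(2) H(2) by simp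
    qed
    \<comment> \<open>The elements all of whose multiples lie in \<open>L\<close> are a submodule over \<open>\<Lambda>\<close>, and \<open>1\<close> is among the multipliers.\<close>
    have "rspan \<Lambda> M G \<subseteq> {x \<in> carrier M. \<forall>a\<in>carrier \<Lambda>. a \<odot>\<^bsub>M\<^esub> x \<in> L}"
    proof (rule rspan_least)
      show "rsubmod \<Lambda> M {x \<in> carrier M. \<forall>a\<in>carrier \<Lambda>. a \<odot>\<^bsub>M\<^esub> x \<in> L}"
        by (rule rsubmodI)
          (auto simp: L M.ract_r_distr M.ract_closed M.ract_assoc[symmetric])
      show "G \<subseteq> {x \<in> carrier M. \<forall>a\<in>carrier \<Lambda>. a \<odot>\<^bsub>M\<^esub> x \<in> L}" using ag G(1) by auto
    qed
    then have "x \<in> L" if "x \<in> carrier M" for x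
      using that M.ract_one[OF that] unfolding G(3) by force
    then show "carrier N \<subseteq> rspan R N ?F" unfolding L_def by auto
  qed
  have "rmod_dcc R N (carrier N)" using N.rmod_dcc_rspan[OF F] unfolding FN .
  then have "N.fin_gen K" using N.fin_gen_of_dcc sub[OF K] by blast
  then obtain E where E: "finite E" "rspan R N E = K" by (auto simp: N.fin_gen_def)
  have EK: "E \<subseteq> K" using rspan_incl[of E R N] E(2) by simp
  note KM = rsubmodD(1)[OF K]
  interpret K: right_module \<Lambda> "M\<lparr>carrier := K\<rparr>" by (rule M.right_module_submodule[OF K])
  have "rspan \<Lambda> (M\<lparr>carrier := K\<rparr>) E = carrier (M\<lparr>carrier := K\<rparr>)"
  proof
    have EK': "E \<subseteq> carrier (M\<lparr>carrier := K\<rparr>)" using EK by simp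
    note rs = K.rsubmod_rspan[OF EK']
    show "rspan \<Lambda> (M\<lparr>carrier := K\<rparr>) E \<subseteq> carrier (M\<lparr>carrier := K\<rparr>)" by (rule rsubmodD(1)[OF rs])
    have "rsubmod R N (rspan \<Lambda> (M\<lparr>carrier := K\<rparr>) E)"
      using rs sub unfolding rsubmod_submodule[OF KM] by blast
    from rspan_least[OF this rspan_incl] show "carrier (M\<lparr>carrier := K\<rparr>) \<subseteq> rspan \<Lambda> (M\<lparr>carrier := K\<rparr>) E"
      using E(2) by simp
  qed
  then show ?thesis
    using K.right_module_axioms E(1) EK unfolding fg_right_module_iff_rspan
    by (intro conjI exI[of _ E]) simp_all
qed

locale artin_alg =
  fixes R :: "('r, 's) ring_scheme" and \<phi> :: "'r \<Rightarrow> 'a" and \<Lambda> :: "('a, 't) ring_scheme"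
  assumes artin: "artin_algebra R \<phi> \<Lambda>"

sublocale artin_alg \<subseteq> preadditive_zero "fg_mod \<Lambda>"
proof -
  interpret preadditive "fg_mod \<Lambda>" by (rule preadditive_fg_mod)
  have "ring \<Lambda>" using artin by (simp add: artin_algebra_def)
  then show "preadditive_zero (fg_mod \<Lambda>)" by unfold_locales (rule fg_mod_zero_exists)
qed

text \<open>
  Short exactness in terms of elements; \<open>short_exact_iff_ses\<close> compares it with
  \<^const>\<open>short_exact\<close>.
\<close>

definition ses :: "('a, 't) ring_scheme \<Rightarrow> 'a rmod \<Rightarrow> 'a rmor \<Rightarrow> 'a rmod \<Rightarrow> 'a rmor \<Rightarrow> 'a rmod \<Rightarrow> bool" where
  "ses \<Lambda> A i B p D \<longleftrightarrow> fg_right_module \<Lambda> A \<and> fg_right_module \<Lambda> B \<and> fg_right_module \<Lambda> D \<and>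
     i \<in> rmod_hom \<Lambda> A B \<and> p \<in> rmod_hom \<Lambda> B D \<and> inj_on i (carrier A) \<and> p ` carrier B = carrier D \<and>
     i ` carrier A = {x \<in> carrier B. p x = \<zero>\<^bsub>D\<^esub>}"

lemma compose_eqD: "\<lbrakk>compose A g f = h; x \<in> A\<rbrakk> \<Longrightarrow> g (f x) = h x"
  by (auto simp: compose_def)

lemma compose_eq_iff:
  assumes "f \<in> rmod_hom \<Lambda> A B" "g \<in> rmod_hom \<Lambda> B D" "h \<in> rmod_hom \<Lambda> A D" "right_module \<Lambda> A"
  shows "compose (carrier A) g f = h \<longleftrightarrow> (\<forall>x\<in>carrier A. g (f x) = h x)"
proof
  assume "compose (carrier A) g f = h"
  then show "\<forall>x\<in>carrier A. g (f x) = h x" by (auto simp: compose_eq)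
next
  assume "\<forall>x\<in>carrier A. g (f x) = h x"
  then show "compose (carrier A) g f = h"
    by (intro rmod_hom_ext[OF rmod_hom_Comp[OF assms(1,2,4)] assms(3)]) (simp add: compose_eq)
qed

lemma ses_short_exact:
  assumes "ses \<Lambda> A i B p D"
  shows "short_exact (fg_mod \<Lambda>) (A, i, B, p, D)"
proof -
  have ob: "fg_right_module \<Lambda> A" "fg_right_module \<Lambda> B" "fg_right_module \<Lambda> D"
    and i: "i \<in> rmod_hom \<Lambda> A B" "inj_on i (carrier A)"
    and p: "p \<in> rmod_hom \<Lambda> B D" "p ` carrier B = carrier D"
    and ex: "i ` carrier A = {x \<in> carrier B. p x = \<zero>\<^bsub>D\<^esub>}"
    using assms by (auto simp: ses_def)
  note rm = ob[THEN fg_right_moduleD]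
  have pi: "compose (carrier A) p i = (\<lambda>x\<in>carrier A. \<zero>\<^bsub>D\<^esub>)"
    using ex by (subst compose_eq_iff[OF i(1) p(1) rmod_hom_Zero[OF rm(1,3)] rm(1)]) auto
  have "is_kernel (fg_mod \<Lambda>) A i B p D"
  proof (rule is_kernelI)
    fix T t assume T: "T \<in> Obj (fg_mod \<Lambda>)" "t \<in> Hom (fg_mod \<Lambda>) T B"
      "Comp (fg_mod \<Lambda>) T B D p t = Zero (fg_mod \<Lambda>) T D"
    then have t: "right_module \<Lambda> T" "t \<in> rmod_hom \<Lambda> T B" by (auto simp: fg_right_moduleD)
    have "p (t x) = \<zero>\<^bsub>D\<^esub>" if "x \<in> carrier T" for x
      using compose_eqD[of "carrier T" p t _ x] T(3) that by simp
    then have "t x \<in> i ` carrier A" if "x \<in> carrier T" for x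
      using that rmod_hom_closed[OF t(2)] unfolding ex by simp
    then obtain u where u: "u \<in> rmod_hom \<Lambda> T A" "\<forall>x\<in>carrier T. i (u x) = t x"
      using rmod_hom_lift[OF i t(2) _ rm(1) t(1)] by blast
    then have "compose (carrier T) i u = t" by (simp add: compose_eq_iff[OF u(1) i(1) t(2,1)])
    then show "\<exists>u\<in>Hom (fg_mod \<Lambda>) T A. Comp (fg_mod \<Lambda>) T A B i u = t" using u(1) by auto
  next
    fix T u v assume T: "u \<in> Hom (fg_mod \<Lambda>) T A" "v \<in> Hom (fg_mod \<Lambda>) T A"
      "Comp (fg_mod \<Lambda>) T A B i u = Comp (fg_mod \<Lambda>) T A B i v"
    have "i (u x) = i (v x)" if "x \<in> carrier T" for x
      using compose_eqD[of "carrier T" i u "compose (carrier T) i v" x] T(3) that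
      by (simp add: compose_eq)
    then have "u x = v x" if "x \<in> carrier T" for x
      using that T(1,2) inj_onD[OF i(2)] rmod_hom_closed[of _ \<Lambda> T A] by simp
    then show "u = v" using T(1,2) rmod_hom_ext[of u \<Lambda> T A v] by simp
  qed (use i pi in simp_all)
  moreover have "is_cokernel (fg_mod \<Lambda>) A i B p D"
  proof (rule is_cokernelI)
    fix T t assume T: "T \<in> Obj (fg_mod \<Lambda>)" "t \<in> Hom (fg_mod \<Lambda>) B T"
      "Comp (fg_mod \<Lambda>) A B T t i = Zero (fg_mod \<Lambda>) A T"
    then have t: "right_module \<Lambda> T" "t \<in> rmod_hom \<Lambda> B T" by (auto simp: fg_right_moduleD)
    have ti: "t (i x) = \<zero>\<^bsub>T\<^esub>" if "x \<in> carrier A" for x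
      using compose_eqD[of "carrier A" t i _ x] T(3) that by simp
    have "t x = \<zero>\<^bsub>T\<^esub>" if "x \<in> carrier B" "p x = \<zero>\<^bsub>D\<^esub>" for x
    proof -
      have "x \<in> i ` carrier A" using that ex by simp
      then show ?thesis using ti by auto
    qed
    then obtain u where u: "u \<in> rmod_hom \<Lambda> D T" "\<forall>x\<in>carrier B. u (p x) = t x"
      using rmod_hom_descend[OF p t(2) _ rm(2,3) t(1)] by blast
    then have "compose (carrier B) u p = t" by (simp add: compose_eq_iff[OF p(1) u(1) t(2) rm(2)])
    then show "\<exists>u\<in>Hom (fg_mod \<Lambda>) D T. Comp (fg_mod \<Lambda>) B D T u p = t" using u(1) by auto
  next
    fix T u v assume T: "u \<in> Hom (fg_mod \<Lambda>) D T" "v \<in> Hom (fg_mod \<Lambda>) D T"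
      "Comp (fg_mod \<Lambda>) B D T u p = Comp (fg_mod \<Lambda>) B D T v p"
    have "u (p x) = v (p x)" if "x \<in> carrier B" for x
      using compose_eqD[of "carrier B" u p "compose (carrier B) v p" x] T(3) that
      by (simp add: compose_eq)
    then have "u y = v y" if "y \<in> carrier D" for y
      using that unfolding p(2)[symmetric] by auto
    then show "u = v" using T(1,2) rmod_hom_ext[of u \<Lambda> D T v] by simp
  qed (use p pi in simp_all)
  ultimately show ?thesis using ob by (simp add: short_exact_def)
qed

context artin_alg
begin

lemma kernel_exists:
  fixes M N :: "'a rmod"
  assumes f: "f \<in> rmod_hom \<Lambda> M N" and M: "fg_right_module \<Lambda> M" and N: "fg_right_module \<Lambda> N"
  shows "\<exists>(K :: 'a rmod) k. fg_right_module \<Lambda> K \<and> k \<in> rmod_hom \<Lambda> K M \<and> inj_on k (carrier K) \<and>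
    k ` carrier K = {x \<in> carrier M. f x = \<zero>\<^bsub>N\<^esub>}"
proof -
  let ?K = "{x \<in> carrier M. f x = \<zero>\<^bsub>N\<^esub>}"
  have sub: "rsubmod \<Lambda> M ?K" by (intro rsubmod_kernel f fg_right_moduleD M N)
  let ?MK = "M\<lparr>carrier := ?K\<rparr>"
  have K: "fg_right_module \<Lambda> ?MK" by (rule artin_algebra_submodule_fg[OF artin M sub])
  have "(\<lambda>x\<in>carrier ?MK. x) \<in> rmod_hom \<Lambda> ?MK M"
    by (rule rmod_homI[OF _ _ _ fg_right_moduleD[OF K]]) simp_all
  then show ?thesis
    using K by (intro exI[of _ ?MK] exI[of _ "\<lambda>x\<in>carrier ?MK. x"]) (simp add: inj_on_def)
qed

lemma cokernel_exists:
  fixes M N :: "'a rmod"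
  assumes f: "f \<in> rmod_hom \<Lambda> M N" and M: "fg_right_module \<Lambda> M" and N: "fg_right_module \<Lambda> N"
  shows "\<exists>(Q :: 'a rmod) p. fg_right_module \<Lambda> Q \<and> p \<in> rmod_hom \<Lambda> N Q \<and> p ` carrier N = carrier Q \<and>
    {x \<in> carrier N. p x = \<zero>\<^bsub>Q\<^esub>} = f ` carrier M"
proof -
  interpret M: right_module \<Lambda> M using M by (rule fg_right_moduleD)
  interpret N: right_module \<Lambda> N using N by (rule fg_right_moduleD)
  have sub: "rsubmod \<Lambda> N (f ` carrier M)"
    by (intro rsubmod_image[OF f] M.right_module_axioms N.right_module_axioms M.rsubmod_carrier)
  obtain Q :: "'a rmod" where Q1: "right_module \<Lambda> Q"
    and ex: "\<exists>p\<in>rmod_hom \<Lambda> N Q. p ` carrier N = carrier Q \<and>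
      (\<forall>x\<in>carrier N. p x = \<zero>\<^bsub>Q\<^esub> \<longleftrightarrow> x \<in> f ` carrier M)"
    using N.quotient_exists[OF sub] by (elim exE conjE) (rule that)
  from ex obtain p where Q: "p \<in> rmod_hom \<Lambda> N Q" "p ` carrier N = carrier Q"
    "\<forall>x\<in>carrier N. p x = \<zero>\<^bsub>Q\<^esub> \<longleftrightarrow> x \<in> f ` carrier M"
    by (elim bexE conjE) (rule that)
  have "fg_right_module \<Lambda> Q" by (rule fg_right_module_image[OF N Q1 Q(1,2)])
  moreover have "{x \<in> carrier N. p x = \<zero>\<^bsub>Q\<^esub>} = f ` carrier M"
    using Q(3) rsubmodD(1)[OF sub] by auto
  ultimately show ?thesis using Q(1,2) by (intro exI[of _ Q] exI[of _ p]) simp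
qed

text \<open>
  The inclusion of the kernel and the zero map have the same composite with \<open>f\<close>.
\<close>

lemma monomorphism_inj:
  assumes m: "monomorphism (fg_mod \<Lambda>) A B f" and A: "fg_right_module \<Lambda> A" and B: "fg_right_module \<Lambda> B"
  shows "inj_on f (carrier A)"
proof (rule inj_onI)
  fix x y assume xy: "x \<in> carrier A" "y \<in> carrier A" "f x = f y"
  interpret A: right_module \<Lambda> A using A by (rule fg_right_moduleD)
  interpret B: right_module \<Lambda> B using B by (rule fg_right_moduleD)
  have f: "f \<in> rmod_hom \<Lambda> A B" using m by (simp add: monomorphism_def)
  obtain K :: "'a rmod" and k where K: "fg_right_module \<Lambda> K" "k \<in> rmod_hom \<Lambda> K A"
    "k ` carrier K = {x \<in> carrier A. f x = \<zero>\<^bsub>B\<^esub>}"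
    using kernel_exists[OF f A B] by (elim exE conjE) (rule that)
  note rK = fg_right_moduleD[OF K(1)]
  let ?z = "\<lambda>x\<in>carrier K. \<zero>\<^bsub>A\<^esub>"
  have z: "?z \<in> rmod_hom \<Lambda> K A" by (rule rmod_hom_Zero[OF rK A.right_module_axioms])
  have fz: "f \<zero>\<^bsub>A\<^esub> = \<zero>\<^bsub>B\<^esub>" by (rule rmod_hom_zero[OF f A.right_module_axioms B.right_module_axioms])
  have "f (k w) = \<zero>\<^bsub>B\<^esub>" if "w \<in> carrier K" for w using K(3) that by auto
  then have "compose (carrier K) f k = compose (carrier K) f ?z"
    using fz by (simp add: fun_eq_iff compose_def restrict_def)
  then have "k = ?z" using m K(1,2) z unfolding monomorphism_def by simp
  then have im: "k ` carrier K \<subseteq> {\<zero>\<^bsub>A\<^esub>}" by auto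
  have "f (x \<ominus>\<^bsub>A\<^esub> y) = \<zero>\<^bsub>B\<^esub>"
    using xy rmod_hom_closed[OF f]
    by (simp add: rmod_hom_minus[OF f A.right_module_axioms B.right_module_axioms])
  then have "x \<ominus>\<^bsub>A\<^esub> y \<in> k ` carrier K" using xy K(3) by simp
  then show "x = y" using im xy by auto
qed

text \<open>
  The projection to the cokernel and the zero map have the same composite with \<open>f\<close>.
\<close>

lemma epimorphism_surj:
  assumes e: "epimorphism (fg_mod \<Lambda>) A B f" and A: "fg_right_module \<Lambda> A" and B: "fg_right_module \<Lambda> B"
  shows "f ` carrier A = carrier B"
proof -
  have f: "f \<in> rmod_hom \<Lambda> A B" using e by (simp add: epimorphism_def)
  obtain Q :: "'a rmod" and p where Q: "fg_right_module \<Lambda> Q" "p \<in> rmod_hom \<Lambda> B Q"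
    "{x \<in> carrier B. p x = \<zero>\<^bsub>Q\<^esub>} = f ` carrier A"
    using cokernel_exists[OF f A B] by (elim exE conjE) (rule that)
  let ?z = "\<lambda>x\<in>carrier B. \<zero>\<^bsub>Q\<^esub>"
  have z: "?z \<in> rmod_hom \<Lambda> B Q" by (rule rmod_hom_Zero[OF fg_right_moduleD[OF B] fg_right_moduleD[OF Q(1)]])
  have "p (f x) = \<zero>\<^bsub>Q\<^esub>" if "x \<in> carrier A" for x using Q(3) that by auto
  then have "compose (carrier A) p f = compose (carrier A) ?z f"
    using rmod_hom_closed[OF f] by (simp add: fun_eq_iff compose_def restrict_def)
  then have "p = ?z" using e Q(1,2) z unfolding epimorphism_def by simp
  then have "{x \<in> carrier B. p x = \<zero>\<^bsub>Q\<^esub>} = carrier B" by auto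
  then show ?thesis using Q(3) by simp
qed

text \<open>
  Only exactness in the middle needs an argument: the categorical kernel has the same image as
  the kernel of elements, which is an object of the category.
\<close>

lemma short_exact_ses:
  assumes "short_exact (fg_mod \<Lambda>) (A, i, B, p, D)"
  shows "ses \<Lambda> A i B p D"
proof -
  have ob: "fg_right_module \<Lambda> A" "fg_right_module \<Lambda> B" "fg_right_module \<Lambda> D"
    and k: "is_kernel (fg_mod \<Lambda>) A i B p D"
    and i: "i \<in> rmod_hom \<Lambda> A B" and p: "p \<in> rmod_hom \<Lambda> B D"
    and pi: "compose (carrier A) p i = (\<lambda>x\<in>carrier A. \<zero>\<^bsub>D\<^esub>)"
    using assms by (auto simp: short_exact_def is_kernel_def is_cokernel_def)
  have "i ` carrier A = {x \<in> carrier B. p x = \<zero>\<^bsub>D\<^esub>}"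
  proof
    have "p (i x) = \<zero>\<^bsub>D\<^esub>" if "x \<in> carrier A" for x
      using compose_eqD[OF pi that] that by simp
    then show "i ` carrier A \<subseteq> {x \<in> carrier B. p x = \<zero>\<^bsub>D\<^esub>}" using rmod_hom_closed[OF i] by auto
    obtain K :: "'a rmod" and j where K: "fg_right_module \<Lambda> K" "j \<in> rmod_hom \<Lambda> K B"
      "j ` carrier K = {x \<in> carrier B. p x = \<zero>\<^bsub>D\<^esub>}"
      using kernel_exists[OF p ob(2,3)] by (elim exE conjE) (rule that)
    have "p (j x) = \<zero>\<^bsub>D\<^esub>" if "x \<in> carrier K" for x using K(3) that by auto
    then have "compose (carrier K) p j = (\<lambda>x\<in>carrier K. \<zero>\<^bsub>D\<^esub>)" by (simp add: fun_eq_iff compose_def restrict_def)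
    then obtain u where u: "u \<in> rmod_hom \<Lambda> K A" "compose (carrier K) i u = j"
      using is_kernelE[OF k, of K j] K by auto
    have "j x \<in> i ` carrier A" if "x \<in> carrier K" for x
      using that rmod_hom_closed[OF u(1)] unfolding u(2)[symmetric] by (simp add: compose_eq)
    then show "{x \<in> carrier B. p x = \<zero>\<^bsub>D\<^esub>} \<subseteq> i ` carrier A" unfolding K(3)[symmetric] by auto
  qed
  then show ?thesis
    using ob i p monomorphism_inj[OF short_exact_mono[OF assms]] epimorphism_surj[OF short_exact_epi[OF assms]]
    by (simp add: ses_def)
qed

lemma short_exact_iff_ses: "short_exact (fg_mod \<Lambda>) (A, i, B, p, D) \<longleftrightarrow> ses \<Lambda> A i B p D"
  using ses_short_exact short_exact_ses by blast

text \<open>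
  In an abelian category a monomorphism is the kernel of its cokernel.
\<close>

lemma cokernel_ses:
  assumes m: "monomorphism (fg_mod \<Lambda>) A B f" and c: "is_cokernel (fg_mod \<Lambda>) A f B p Q"
    and ob: "fg_right_module \<Lambda> A" "fg_right_module \<Lambda> B" "fg_right_module \<Lambda> Q"
  shows "ses \<Lambda> A f B p Q"
proof -
  have f: "f \<in> rmod_hom \<Lambda> A B" using m by (simp add: monomorphism_def)
  have p: "p \<in> rmod_hom \<Lambda> B Q" and pf: "compose (carrier A) p f = (\<lambda>x\<in>carrier A. \<zero>\<^bsub>Q\<^esub>)"
    using c by (auto simp: is_cokernel_def)
  have "epimorphism (fg_mod \<Lambda>) B Q p"
    unfolding epimorphism_def using p cokernel_cancel[OF c] f ob by simp
  note surj = epimorphism_surj[OF this ob(2,3)]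
  obtain Q' :: "'a rmod" and p' where Q': "fg_right_module \<Lambda> Q'" "p' \<in> rmod_hom \<Lambda> B Q'"
    "{x \<in> carrier B. p' x = \<zero>\<^bsub>Q'\<^esub>} = f ` carrier A"
    using cokernel_exists[OF f ob(1,2)] by (elim exE conjE) (rule that)
  have "p' (f x) = \<zero>\<^bsub>Q'\<^esub>" if "x \<in> carrier A" for x using Q'(3) that by auto
  then have "compose (carrier A) p' f = (\<lambda>x\<in>carrier A. \<zero>\<^bsub>Q'\<^esub>)" by (simp add: fun_eq_iff compose_def restrict_def)
  then obtain u where u: "u \<in> rmod_hom \<Lambda> Q Q'" "compose (carrier B) u p = p'"
    using is_cokernelE[OF c, of Q' p'] Q' by auto
  have "p' x = \<zero>\<^bsub>Q'\<^esub>" if "x \<in> carrier B" "p x = \<zero>\<^bsub>Q\<^esub>" for x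
    using that rmod_hom_zero[OF u(1) fg_right_moduleD[OF ob(3)] fg_right_moduleD[OF Q'(1)]]
    unfolding u(2)[symmetric] by (simp add: compose_eq)
  then have "{x \<in> carrier B. p x = \<zero>\<^bsub>Q\<^esub>} \<subseteq> f ` carrier A" unfolding Q'(3)[symmetric] by auto
  moreover have "p (f x) = \<zero>\<^bsub>Q\<^esub>" if "x \<in> carrier A" for x
    using compose_eqD[OF pf that] that by simp
  ultimately have "f ` carrier A = {x \<in> carrier B. p x = \<zero>\<^bsub>Q\<^esub>}" using rmod_hom_closed[OF f] by auto
  then show ?thesis using ob f p surj monomorphism_inj[OF m ob(1,2)] by (simp add: ses_def)
qed

end

section \<open>Free modules\<close>

text \<open>
  The algebra as a module over itself represents the functor of underlying sets: a
  homomorphism on it is the same as an element, the image of \<open>u\<close>.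
\<close>

lemma generator_exists:
  assumes "ring \<Lambda>"
  shows "\<exists>U\<in>Obj (fg_mod \<Lambda>). \<exists>u\<in>carrier U. \<forall>M\<in>Obj (fg_mod \<Lambda>).
    (\<forall>y\<in>carrier M. \<exists>h\<in>rmod_hom \<Lambda> U M. h u = y) \<and>
    (\<forall>h\<in>rmod_hom \<Lambda> U M. \<forall>k\<in>rmod_hom \<Lambda> U M. h u = k u \<longrightarrow> h = k)"
proof -
  interpret ring \<Lambda> by fact
  define F where "F = \<lparr>partial_object.carrier = carrier \<Lambda>, monoid.mult = (\<lambda>x y. x), monoid.one = \<zero>\<^bsub>\<Lambda>\<^esub>,
      ring.zero = \<zero>\<^bsub>\<Lambda>\<^esub>, ring.add = (\<lambda>x y. x \<oplus>\<^bsub>\<Lambda>\<^esub> y), module.smult = (\<lambda>a x. x \<otimes>\<^bsub>\<Lambda>\<^esub> a)\<rparr>"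
  have F [simp]: "carrier F = carrier \<Lambda>" "\<zero>\<^bsub>F\<^esub> = \<zero>\<^bsub>\<Lambda>\<^esub>" "\<And>x y. x \<oplus>\<^bsub>F\<^esub> y = x \<oplus>\<^bsub>\<Lambda>\<^esub> y"
    "\<And>a x. a \<odot>\<^bsub>F\<^esub> x = x \<otimes>\<^bsub>\<Lambda>\<^esub> a"
    by (simp_all add: F_def)
  interpret F: abelian_group F
  proof (rule abelian_groupI)
    fix x assume "x \<in> carrier F"
    then show "\<exists>y\<in>carrier F. y \<oplus>\<^bsub>F\<^esub> x = \<zero>\<^bsub>F\<^esub>"
      by (intro bexI[of _ "\<ominus>\<^bsub>\<Lambda>\<^esub> x"]) (simp_all add: l_neg)
  qed (simp_all add: a_ac)
  have rF: "right_module \<Lambda> F"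
    by unfold_locales (simp_all add: l_distr r_distr m_assoc)
  then interpret F: right_module \<Lambda> F .
  have gen: "carrier F \<subseteq> L" if "rsubmod \<Lambda> F L" "\<one>\<^bsub>\<Lambda>\<^esub> \<in> L" for L
    using rsubmodD(4)[OF that(1) _ that(2)] by auto
  have "rspan \<Lambda> F {\<one>\<^bsub>\<Lambda>\<^esub>} = carrier F"
    using gen[OF F.rsubmod_rspan[of "{\<one>\<^bsub>\<Lambda>\<^esub>}"]] rspan_incl[of "{\<one>\<^bsub>\<Lambda>\<^esub>}" \<Lambda> F]
      rsubmodD(1)[OF F.rsubmod_rspan[of "{\<one>\<^bsub>\<Lambda>\<^esub>}"]] by (intro subset_antisym) simp_all
  then have "fg_right_module \<Lambda> F"
    unfolding fg_right_module_iff_rspan using rF by (intro conjI exI[of _ "{\<one>\<^bsub>\<Lambda>\<^esub>}"]) simp_all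
  then obtain U f where U: "U \<in> Obj (fg_mod \<Lambda>)" and f: "f \<in> rmod_hom \<Lambda> F U"
    and bij: "bij_betw f (carrier F) (carrier U)"
    using fg_right_module_represented by blast
  have rU: "right_module \<Lambda> U" using U by (simp add: fg_right_moduleD)
  have fi: "inj_on f (carrier F)" "f ` carrier F = carrier U" using bij by (auto simp: bij_betw_def)
  obtain v where v: "v \<in> rmod_hom \<Lambda> U F" "\<forall>x\<in>carrier U. f (v x) = x"
    using rmod_hom_lift[OF f fi(1) rmod_hom_Id[OF rU] _ rF rU] fi(2) by auto
  define u where "u = f \<one>\<^bsub>\<Lambda>\<^esub>"
  have u: "u \<in> carrier U" using rmod_hom_closed[OF f, of "\<one>\<^bsub>\<Lambda>\<^esub>"] by (simp add: u_def)
  have vu: "v u = \<one>\<^bsub>\<Lambda>\<^esub>"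
    using inj_onD[OF fi(1), of "v u" "\<one>\<^bsub>\<Lambda>\<^esub>"] v(2) u rmod_hom_closed[OF v(1) u] by (simp add: u_def)
  have rep: "x = v x \<odot>\<^bsub>U\<^esub> u" "v x \<in> carrier \<Lambda>" if "x \<in> carrier U" for x
  proof -
    show c: "v x \<in> carrier \<Lambda>" using rmod_hom_closed[OF v(1) that] by simp
    have "f (v x \<odot>\<^bsub>F\<^esub> \<one>\<^bsub>\<Lambda>\<^esub>) = v x \<odot>\<^bsub>U\<^esub> u"
      unfolding u_def using c by (intro rmod_hom_ract[OF f]) simp_all
    then show "x = v x \<odot>\<^bsub>U\<^esub> u" using v(2) that c by simp
  qed
  have 1: "\<exists>h\<in>rmod_hom \<Lambda> U M. h u = y" if M: "M \<in> Obj (fg_mod \<Lambda>)" and y: "y \<in> carrier M" for M y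
  proof -
    interpret M: right_module \<Lambda> M using M by (simp add: fg_right_moduleD)
    have g: "(\<lambda>a\<in>carrier F. a \<odot>\<^bsub>M\<^esub> y) \<in> rmod_hom \<Lambda> F M"
      by (rule rmod_homI[OF _ _ _ rF])
        (use y in \<open>simp_all add: M.ract_closed M.ract_l_distr M.ract_assoc\<close>)
    have "compose (carrier U) (\<lambda>a\<in>carrier F. a \<odot>\<^bsub>M\<^esub> y) v \<in> rmod_hom \<Lambda> U M"
      by (rule rmod_hom_Comp[OF v(1) g rU])
    moreover have "compose (carrier U) (\<lambda>a\<in>carrier F. a \<odot>\<^bsub>M\<^esub> y) v u = y"
      using u vu y by (simp add: compose_eq M.ract_one)
    ultimately show ?thesis by blast
  qed
  have 2: "h = k" if "h \<in> rmod_hom \<Lambda> U M" "k \<in> rmod_hom \<Lambda> U M" "h u = k u" for M :: "'a rmod" and h k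
  proof (rule rmod_hom_ext[OF that(1,2)])
    fix x assume x: "x \<in> carrier U"
    have "h (v x \<odot>\<^bsub>U\<^esub> u) = k (v x \<odot>\<^bsub>U\<^esub> u)"
      using rep(2)[OF x] u that by (simp add: rmod_hom_ract)
    then show "h x = k x" using rep(1)[OF x] by simp
  qed
  show ?thesis using U u 1 2 by (intro bexI[of _ U] bexI[of _ u] ballI conjI impI) simp_all
qed

context artin_alg
begin

text \<open>
  A copy of the regular module is projective because a lift is found by lifting one element.
  Adding one such summand for each generator of \<open>M\<close> gives the surjection.
\<close>

lemma projective_surjection_exists:
  assumes M: "M \<in> Obj (fg_mod \<Lambda>)"
  shows "\<exists>P e. projective_object (fg_mod \<Lambda>) P \<and> e \<in> rmod_hom \<Lambda> P M \<and> e ` carrier P = carrier M"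
proof -
  have "ring \<Lambda>" using artin by (simp add: artin_algebra_def)
  obtain U u where U: "U \<in> Obj (fg_mod \<Lambda>)" "u \<in> carrier U"
    and uni: "\<forall>N\<in>Obj (fg_mod \<Lambda>). (\<forall>y\<in>carrier N. \<exists>h\<in>rmod_hom \<Lambda> U N. h u = y) \<and>
      (\<forall>h\<in>rmod_hom \<Lambda> U N. \<forall>k\<in>rmod_hom \<Lambda> U N. h u = k u \<longrightarrow> h = k)"
    using generator_exists[OF \<open>ring \<Lambda>\<close>] by (elim bexE) (rule that)
  have ex: "\<exists>h\<in>rmod_hom \<Lambda> U N. h u = y" if "N \<in> Obj (fg_mod \<Lambda>)" "y \<in> carrier N" for N y
    using bspec[OF uni that(1), THEN conjunct1] that(2) by (rule bspec)
  have un: "h = k"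
    if "N \<in> Obj (fg_mod \<Lambda>)" "h \<in> rmod_hom \<Lambda> U N" "k \<in> rmod_hom \<Lambda> U N" "h u = k u" for N h k
    using bspec[OF uni that(1), THEN conjunct2] that(2-4) by simp
  have proj: "projective_object (fg_mod \<Lambda>) U"
    unfolding projective_object_def
  proof (intro conjI ballI allI impI U(1))
    fix A B e f assume A: "A \<in> Obj (fg_mod \<Lambda>)" and B: "B \<in> Obj (fg_mod \<Lambda>)"
      and ef: "epimorphism (fg_mod \<Lambda>) A B e \<and> f \<in> Hom (fg_mod \<Lambda>) U B"
    have e: "e \<in> rmod_hom \<Lambda> A B" using ef by (simp add: epimorphism_def)
    have "f u \<in> carrier B" using ef U(2) rmod_hom_closed by fastforce
    then have "f u \<in> e ` carrier A" using epimorphism_surj[of A B e] A B ef by simp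
    then obtain y where y: "y \<in> carrier A" "e y = f u" by auto
    obtain h where h: "h \<in> rmod_hom \<Lambda> U A" "h u = y" using ex[OF A y(1)] by blast
    have "compose (carrier U) e h = f"
    proof (rule un[OF B])
      show "compose (carrier U) e h \<in> rmod_hom \<Lambda> U B"
        using rmod_hom_Comp[OF h(1) e] U(1) by (simp add: fg_right_moduleD)
    qed (use ef h y U in \<open>simp_all add: compose_eq\<close>)
    then show "\<exists>g\<in>Hom (fg_mod \<Lambda>) U A. Comp (fg_mod \<Lambda>) U A B e g = f" using h(1) by auto
  qed
  interpret M: right_module \<Lambda> M using M by (simp add: fg_right_moduleD)
  obtain G where G: "G \<subseteq> carrier M" "finite G" "rspan \<Lambda> M G = carrier M"
    using M by (auto simp: fg_right_module_iff_rspan)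
  have "\<exists>P e. projective_object (fg_mod \<Lambda>) P \<and> e \<in> rmod_hom \<Lambda> P M \<and> G \<subseteq> e ` carrier P"
    using G(2,1)
  proof (induction G)
    case empty
    obtain h where "h \<in> rmod_hom \<Lambda> U M" using ex[OF M M.M.zero_closed] by blast
    then show ?case using proj by blast
  next
    case (insert x G)
    then obtain P e where P: "projective_object (fg_mod \<Lambda>) P" and e: "e \<in> rmod_hom \<Lambda> P M"
      and eG: "G \<subseteq> e ` carrier P" by auto
    obtain h where h: "h \<in> rmod_hom \<Lambda> U M" "h u = x" using ex[OF M, of x] insert.prems by blast
    have Pob: "P \<in> Obj (fg_mod \<Lambda>)" using P by (simp add: projective_object_def)
    obtain S i j p q where b: "biproduct (fg_mod \<Lambda>) S P U i j p q"
      using fg_mod_biproduct_exists[OF Pob U(1)] by blast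
    have ij: "i \<in> rmod_hom \<Lambda> P S" "j \<in> rmod_hom \<Lambda> U S" using biproduct_arrows[OF b] by simp_all
    obtain k where k: "k \<in> rmod_hom \<Lambda> S M" "compose (carrier P) k i = e" "compose (carrier U) k j = h"
      using biproduct_copair[OF b, of e M h] e h(1) M by auto
    have "G \<subseteq> k ` carrier S"
    proof
      fix g assume "g \<in> G"
      then obtain y where y: "y \<in> carrier P" "g = e y" using eG by blast
      then show "g \<in> k ` carrier S"
        using compose_eqD[OF k(2) y(1)] rmod_hom_closed[OF ij(1) y(1)] by (metis imageI)
    qed
    moreover have "x \<in> k ` carrier S"
      using compose_eqD[OF k(3) U(2)] rmod_hom_closed[OF ij(2) U(2)] h(2) by (metis imageI)
    ultimately show ?case
      using biproduct_projective_object[OF b P proj] k(1)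
      by (intro exI[of _ S] exI[of _ k]) simp
  qed
  then obtain P e where P: "projective_object (fg_mod \<Lambda>) P" and e: "e \<in> rmod_hom \<Lambda> P M"
    and eG: "G \<subseteq> e ` carrier P" by blast
  have rP: "right_module \<Lambda> P" using P by (simp add: projective_object_def fg_right_moduleD)
  have im: "rsubmod \<Lambda> M (e ` carrier P)"
    by (rule rsubmod_image[OF e rP M.right_module_axioms right_module.rsubmod_carrier[OF rP]])
  have "carrier M \<subseteq> e ` carrier P" using rspan_least[OF im eG] unfolding G(3) .
  then have "e ` carrier P = carrier M" using rsubmodD(1)[OF im] by blast
  then show ?thesis using P e by blast
qed

end

section \<open>Three by three diagrams\<close>

lemma sesD:
  assumes "ses \<Lambda> A i B p D"
  shows "i \<in> rmod_hom \<Lambda> A B" "p \<in> rmod_hom \<Lambda> B D"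
    "right_module \<Lambda> A" "right_module \<Lambda> B" "right_module \<Lambda> D"
    "x \<in> carrier A \<Longrightarrow> i x \<in> carrier B" "y \<in> carrier B \<Longrightarrow> p y \<in> carrier D"
    "x \<in> carrier A \<Longrightarrow> p (i x) = \<zero>\<^bsub>D\<^esub>"
  using assms rmod_hom_closed[of i \<Lambda> A B x] rmod_hom_closed[of p \<Lambda> B D y]
  by (auto simp: ses_def fg_right_moduleD)

lemma ses_inj: "\<lbrakk>ses \<Lambda> A i B p D; x \<in> carrier A; y \<in> carrier A; i x = i y\<rbrakk> \<Longrightarrow> x = y"
  by (auto simp: ses_def dest: inj_onD)

lemma ses_surj:
  assumes "ses \<Lambda> A i B p D" "d \<in> carrier D"
  shows "\<exists>x\<in>carrier B. d = p x"
proof -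
  have "p ` carrier B = carrier D" using assms(1) by (simp add: ses_def)
  then show ?thesis using assms(2) by auto
qed

lemma ses_exact:
  assumes "ses \<Lambda> A i B p D" "x \<in> carrier B" "p x = \<zero>\<^bsub>D\<^esub>"
  shows "\<exists>a\<in>carrier A. x = i a"
proof -
  have "i ` carrier A = {x \<in> carrier B. p x = \<zero>\<^bsub>D\<^esub>}" using assms(1) by (simp add: ses_def)
  then have "x \<in> i ` carrier A" using assms(2,3) by simp
  then show ?thesis by auto
qed

lemma sesI:
  assumes "fg_right_module \<Lambda> A" "fg_right_module \<Lambda> B" "fg_right_module \<Lambda> D"
    and i: "i \<in> rmod_hom \<Lambda> A B" and p: "p \<in> rmod_hom \<Lambda> B D"
    and inj: "\<And>x. \<lbrakk>x \<in> carrier A; i x = \<zero>\<^bsub>B\<^esub>\<rbrakk> \<Longrightarrow> x = \<zero>\<^bsub>A\<^esub>"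
    and surj: "\<And>d. d \<in> carrier D \<Longrightarrow> \<exists>x\<in>carrier B. d = p x"
    and pi: "\<And>x. x \<in> carrier A \<Longrightarrow> p (i x) = \<zero>\<^bsub>D\<^esub>"
    and ex: "\<And>x. \<lbrakk>x \<in> carrier B; p x = \<zero>\<^bsub>D\<^esub>\<rbrakk> \<Longrightarrow> \<exists>a\<in>carrier A. x = i a"
  shows "ses \<Lambda> A i B p D"
proof -
  interpret A: right_module \<Lambda> A using assms(1) by (rule fg_right_moduleD)
  interpret B: right_module \<Lambda> B using assms(2) by (rule fg_right_moduleD)
  have "inj_on i (carrier A)"
  proof (rule inj_onI)
    fix x y assume xy: "x \<in> carrier A" "y \<in> carrier A" "i x = i y"
    then have "i (x \<ominus>\<^bsub>A\<^esub> y) = \<zero>\<^bsub>B\<^esub>"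
      using rmod_hom_closed[OF i]
      by (simp add: rmod_hom_minus[OF i A.right_module_axioms B.right_module_axioms])
    then show "x = y" using inj[of "x \<ominus>\<^bsub>A\<^esub> y"] xy by simp
  qed
  moreover have "p ` carrier B = carrier D" using surj rmod_hom_closed[OF p] by blast
  moreover have "i ` carrier A = {x \<in> carrier B. p x = \<zero>\<^bsub>D\<^esub>}" using pi ex rmod_hom_closed[OF i] by blast
  ultimately show ?thesis using assms by (simp add: ses_def)
qed

text \<open>
  Two exact rows are joined by injective columns; the cokernels of the columns form a third exact
  row. This is the snake lemma in a case where the connecting map is zero.
\<close>

lemma cokernel_row_exact:
  assumes top: "ses \<Lambda> A f B q Q" and bot: "ses \<Lambda> A' f' B' q' Q'"
    and c1: "ses \<Lambda> A \<alpha> A' a A''" and c2: "ses \<Lambda> B \<beta> B' b B''" and c3: "ses \<Lambda> Q \<gamma> Q' c Q''"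
    and sq1: "\<And>x. x \<in> carrier A \<Longrightarrow> \<beta> (f x) = f' (\<alpha> x)"
    and sq2: "\<And>x. x \<in> carrier B \<Longrightarrow> \<gamma> (q x) = q' (\<beta> x)"
  shows "\<exists>f'' q''. (\<forall>x\<in>carrier A'. f'' (a x) = b (f' x)) \<and> (\<forall>x\<in>carrier B'. q'' (b x) = c (q' x)) \<and>
    ses \<Lambda> A'' f'' B'' q'' Q''"
proof -
  note t = sesD[OF top] and o = sesD[OF bot] and d1 = sesD[OF c1] and d2 = sesD[OF c2] and d3 = sesD[OF c3]
  have fg: "fg_right_module \<Lambda> A''" "fg_right_module \<Lambda> B''" "fg_right_module \<Lambda> Q''"
    using c1 c2 c3 by (simp_all add: ses_def)
  interpret B': right_module \<Lambda> B' by (rule o(4))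
  have "\<exists>h\<in>rmod_hom \<Lambda> A'' B''. \<forall>x\<in>carrier A'. h (a x) = compose (carrier A') b f' x"
  proof (rule rmod_hom_descend[OF d1(2) _ rmod_hom_Comp[OF o(1) d2(2) o(3)] _ o(3) d1(5) d2(5)])
    show "a ` carrier A' = carrier A''" using c1 by (simp add: ses_def)
    fix x assume x: "x \<in> carrier A'" "a x = \<zero>\<^bsub>A''\<^esub>"
    then obtain y where y: "y \<in> carrier A" "x = \<alpha> y" using ses_exact[OF c1] by blast
    then have "b (f' x) = \<zero>\<^bsub>B''\<^esub>" using sq1 d2(8)[OF t(6)[OF y(1)]] by simp
    then show "compose (carrier A') b f' x = \<zero>\<^bsub>B''\<^esub>" using x by (simp add: compose_eq)
  qed
  then obtain f'' where f'': "f'' \<in> rmod_hom \<Lambda> A'' B''" "\<And>x. x \<in> carrier A' \<Longrightarrow> f'' (a x) = b (f' x)"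
    by (auto simp: compose_eq)
  have "\<exists>h\<in>rmod_hom \<Lambda> B'' Q''. \<forall>x\<in>carrier B'. h (b x) = compose (carrier B') c q' x"
  proof (rule rmod_hom_descend[OF d2(2) _ rmod_hom_Comp[OF o(2) d3(2) o(4)] _ o(4) d2(5) d3(5)])
    show "b ` carrier B' = carrier B''" using c2 by (simp add: ses_def)
    fix x assume x: "x \<in> carrier B'" "b x = \<zero>\<^bsub>B''\<^esub>"
    then obtain y where y: "y \<in> carrier B" "x = \<beta> y" using ses_exact[OF c2] by blast
    then have "c (q' x) = \<zero>\<^bsub>Q''\<^esub>" using sq2[symmetric] d3(8)[OF t(7)[OF y(1)]] by simp
    then show "compose (carrier B') c q' x = \<zero>\<^bsub>Q''\<^esub>" using x by (simp add: compose_eq)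
  qed
  then obtain q'' where q'': "q'' \<in> rmod_hom \<Lambda> B'' Q''" "\<And>x. x \<in> carrier B' \<Longrightarrow> q'' (b x) = c (q' x)"
    by (auto simp: compose_eq)
  have "ses \<Lambda> A'' f'' B'' q'' Q''"
  proof (rule sesI[OF fg f''(1) q''(1)])
    fix x assume x: "x \<in> carrier A''" "f'' x = \<zero>\<^bsub>B''\<^esub>"
    obtain v where v: "v \<in> carrier A'" "x = a v" using ses_surj[OF c1 x(1)] by blast
    then have "b (f' v) = \<zero>\<^bsub>B''\<^esub>" using x f''(2) by simp
    then obtain y where y: "y \<in> carrier B" "f' v = \<beta> y" using ses_exact[OF c2 o(6)[OF v(1)]] by blast
    have "\<gamma> (q y) = \<gamma> \<zero>\<^bsub>Q\<^esub>"
      using sq2[OF y(1)] y(2)[symmetric] o(8)[OF v(1)] rmod_hom_zero[OF d3(1,3,4)] by simp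
    moreover have "\<zero>\<^bsub>Q\<^esub> \<in> carrier Q" using rsubmodD(2)[OF right_module.rsubmod_carrier[OF d3(3)]] .
    ultimately have "q y = \<zero>\<^bsub>Q\<^esub>" using ses_inj[OF c3] t(7)[OF y(1)] by blast
    then obtain z where z: "z \<in> carrier A" "y = f z" using ses_exact[OF top y(1)] by blast
    then have "f' v = f' (\<alpha> z)" using y sq1 by simp
    then have "v = \<alpha> z" using ses_inj[OF bot v(1) d1(6)[OF z(1)]] by simp
    then show "x = \<zero>\<^bsub>A''\<^esub>" using v(2) d1(8)[OF z(1)] by simp
  next
    fix d assume "d \<in> carrier Q''"
    then obtain x y where "y \<in> carrier Q'" "d = c y" "x \<in> carrier B'" "y = q' x"
      using ses_surj[OF c3] ses_surj[OF bot] by blast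
    then show "\<exists>x\<in>carrier B''. d = q'' x" using q''(2) d2(7) by (intro bexI[of _ "b x"]) simp_all
  next
    fix x assume "x \<in> carrier A''"
    then obtain v where v: "v \<in> carrier A'" "x = a v" using ses_surj[OF c1] by blast
    then show "q'' (f'' x) = \<zero>\<^bsub>Q''\<^esub>"
      using f''(2) q''(2) o(6,8) rmod_hom_zero[OF d3(2,4,5)] by simp
  next
    fix x assume x: "x \<in> carrier B''" "q'' x = \<zero>\<^bsub>Q''\<^esub>"
    then obtain v where v: "v \<in> carrier B'" "x = b v" using ses_surj[OF c2] by blast
    then have "c (q' v) = \<zero>\<^bsub>Q''\<^esub>" using x q''(2) by simp
    then obtain z where z: "z \<in> carrier Q" "q' v = \<gamma> z" using ses_exact[OF c3 o(7)[OF v(1)]] by blast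
    obtain y where y: "y \<in> carrier B" "z = q y" using ses_surj[OF top z(1)] by blast
    note by_ = d2(6)[OF y(1)]
    have "q' (v \<ominus>\<^bsub>B'\<^esub> \<beta> y) = \<zero>\<^bsub>Q'\<^esub>"
      using z y sq2[OF y(1)] v(1) by_ o(7)[OF by_]
      by (simp add: rmod_hom_minus[OF o(2,4,5)] right_module.minus_eq_zero_iff[OF o(5)])
    then obtain w where w: "w \<in> carrier A'" "v \<ominus>\<^bsub>B'\<^esub> \<beta> y = f' w"
      using ses_exact[OF bot B'.M.minus_closed[OF v(1) by_]] by blast
    interpret B'': right_module \<Lambda> B'' by (rule d2(5))
    have "f'' (a w) = b (v \<ominus>\<^bsub>B'\<^esub> \<beta> y)" using f''(2) w by simp
    also have "\<dots> = x"
      using v by_ d2(7)[OF v(1)] d2(8)[OF y(1)] by (simp add: rmod_hom_minus[OF d2(2,4,5)] B''.M.minus_eq)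
    finally show "\<exists>u\<in>carrier A''. x = f'' u" using d1(7)[OF w(1)] by (intro bexI[of _ "a w"]) simp_all
  qed
  then show ?thesis using f''(2) q''(2) by blast
qed

text \<open>
  Two exact rows are joined by surjective columns; the kernels of the columns form a third exact
  row, dually to \<open>cokernel_row_exact\<close>.
\<close>

lemma kernel_row_exact:
  assumes top: "ses \<Lambda> A f B q Q" and bot: "ses \<Lambda> A' f' B' q' Q'"
    and c1: "ses \<Lambda> K k A \<alpha> A'" and c2: "ses \<Lambda> L l B \<beta> B'" and c3: "ses \<Lambda> N n Q \<gamma> Q'"
    and sq1: "\<And>x. x \<in> carrier A \<Longrightarrow> \<beta> (f x) = f' (\<alpha> x)"
    and sq2: "\<And>x. x \<in> carrier B \<Longrightarrow> \<gamma> (q x) = q' (\<beta> x)"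
  shows "\<exists>g h. (\<forall>x\<in>carrier K. l (g x) = f (k x)) \<and> (\<forall>x\<in>carrier L. n (h x) = q (l x)) \<and>
    ses \<Lambda> K g L h N"
proof -
  note t = sesD[OF top] and o = sesD[OF bot] and d1 = sesD[OF c1] and d2 = sesD[OF c2] and d3 = sesD[OF c3]
  have fg: "fg_right_module \<Lambda> K" "fg_right_module \<Lambda> L" "fg_right_module \<Lambda> N"
    using c1 c2 c3 by (simp_all add: ses_def)
  interpret B: right_module \<Lambda> B by (rule t(4))
  interpret K: right_module \<Lambda> K by (rule d1(3))
  interpret L: right_module \<Lambda> L by (rule d2(3))
  interpret N: right_module \<Lambda> N by (rule d3(3))
  interpret A: right_module \<Lambda> A by (rule t(3))
  interpret A': right_module \<Lambda> A' by (rule o(3))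
  interpret Q: right_module \<Lambda> Q by (rule t(5))
  have inj: "inj_on l (carrier L)" "inj_on n (carrier N)" using c2 c3 by (simp_all add: ses_def)
  have "\<exists>g\<in>rmod_hom \<Lambda> K L. \<forall>x\<in>carrier K. l (g x) = compose (carrier K) f k x"
  proof (rule rmod_hom_lift[OF d2(1) inj(1) rmod_hom_Comp[OF d1(1) t(1) d1(3)] _ d2(3) d1(3)])
    fix x assume x: "x \<in> carrier K"
    have "\<beta> (f (k x)) = \<zero>\<^bsub>B'\<^esub>"
      using sq1[OF d1(6)[OF x]] d1(8)[OF x] rmod_hom_zero[OF o(1,3,4)] by simp
    then obtain y where "y \<in> carrier L" "f (k x) = l y"
      using ses_exact[OF c2 t(6)[OF d1(6)[OF x]]] by blast
    then show "compose (carrier K) f k x \<in> l ` carrier L" using x by (simp add: compose_eq)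
  qed
  then obtain g where g: "g \<in> rmod_hom \<Lambda> K L" "\<And>x. x \<in> carrier K \<Longrightarrow> l (g x) = f (k x)"
    by (auto simp: compose_eq)
  have "\<exists>h\<in>rmod_hom \<Lambda> L N. \<forall>x\<in>carrier L. n (h x) = compose (carrier L) q l x"
  proof (rule rmod_hom_lift[OF d3(1) inj(2) rmod_hom_Comp[OF d2(1) t(2) d2(3)] _ d3(3) d2(3)])
    fix x assume x: "x \<in> carrier L"
    have "\<gamma> (q (l x)) = \<zero>\<^bsub>Q'\<^esub>"
      using sq2[OF d2(6)[OF x]] d2(8)[OF x] rmod_hom_zero[OF o(2,4,5)] by simp
    then obtain y where "y \<in> carrier N" "q (l x) = n y"
      using ses_exact[OF c3 t(7)[OF d2(6)[OF x]]] by blast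
    then show "compose (carrier L) q l x \<in> n ` carrier N" using x by (simp add: compose_eq)
  qed
  then obtain h where h: "h \<in> rmod_hom \<Lambda> L N" "\<And>x. x \<in> carrier L \<Longrightarrow> n (h x) = q (l x)"
    by (auto simp: compose_eq)
  note gc = rmod_hom_closed[OF g(1)] and hc = rmod_hom_closed[OF h(1)]
  have n0: "n \<zero>\<^bsub>N\<^esub> = \<zero>\<^bsub>Q\<^esub>" by (rule rmod_hom_zero[OF d3(1,3,4)])
  have "ses \<Lambda> K g L h N"
  proof (rule sesI[OF fg g(1) h(1)])
    fix x assume x: "x \<in> carrier K" "g x = \<zero>\<^bsub>L\<^esub>"
    then have "f (k x) = f (k \<zero>\<^bsub>K\<^esub>)"
      using g(2)[of x, symmetric] rmod_hom_zero[OF d2(1,3,4)] rmod_hom_zero[OF d1(1,3,4)]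
        rmod_hom_zero[OF t(1,3,4)] by simp
    then have "k x = k \<zero>\<^bsub>K\<^esub>" using ses_inj[OF top d1(6) d1(6)] x by simp
    then show "x = \<zero>\<^bsub>K\<^esub>" using ses_inj[OF c1] x by simp
  next
    fix z assume z: "z \<in> carrier N"
    obtain y where y: "y \<in> carrier B" "n z = q y" using ses_surj[OF top d3(6)[OF z]] by blast
    have "q' (\<beta> y) = \<zero>\<^bsub>Q'\<^esub>" using sq2[OF y(1)] y(2)[symmetric] d3(8)[OF z] by simp
    then obtain w where w: "w \<in> carrier A'" "\<beta> y = f' w" using ses_exact[OF bot d2(7)[OF y(1)]] by blast
    obtain v where v: "v \<in> carrier A" "w = \<alpha> v" using ses_surj[OF c1 w(1)] by blast
    note fv = t(6)[OF v(1)]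
    have "\<beta> (y \<ominus>\<^bsub>B\<^esub> f v) = \<zero>\<^bsub>B'\<^esub>"
      using w v sq1[OF v(1)] y(1) fv d2(7)[OF fv]
      by (simp add: rmod_hom_minus[OF d2(2,4,5)] right_module.minus_eq_zero_iff[OF d2(5)])
    then obtain x where x: "x \<in> carrier L" "y \<ominus>\<^bsub>B\<^esub> f v = l x"
      using ses_exact[OF c2 B.M.minus_closed[OF y(1) fv]] by blast
    have "n (h x) = q (y \<ominus>\<^bsub>B\<^esub> f v)" using h(2) x by simp
    also have "\<dots> = n z"
      using y fv t(7)[OF y(1)] t(8)[OF v(1)] by (simp add: rmod_hom_minus[OF t(2,4,5)] Q.M.minus_eq)
    finally have "z = h x" using ses_inj[OF c3 z hc[OF x(1)]] by simp
    then show "\<exists>x\<in>carrier L. z = h x" using x(1) by blast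
  next
    fix x assume x: "x \<in> carrier K"
    have "n (h (g x)) = n \<zero>\<^bsub>N\<^esub>" using h(2) gc g(2) x t(8)[OF d1(6)[OF x]] n0 by simp
    then show "h (g x) = \<zero>\<^bsub>N\<^esub>" using ses_inj[OF c3 hc[OF gc[OF x]]] by simp
  next
    fix x assume x: "x \<in> carrier L" "h x = \<zero>\<^bsub>N\<^esub>"
    then have "q (l x) = \<zero>\<^bsub>Q\<^esub>" using h(2)[of x, symmetric] n0 by simp
    then obtain y where y: "y \<in> carrier A" "l x = f y" using ses_exact[OF top d2(6)[OF x(1)]] by blast
    have "f' (\<alpha> y) = f' \<zero>\<^bsub>A'\<^esub>"
      using sq1[OF y(1)] y(2)[symmetric] d2(8)[OF x(1)] rmod_hom_zero[OF o(1,3,4)] by simp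
    then have "\<alpha> y = \<zero>\<^bsub>A'\<^esub>" using ses_inj[OF bot d1(7)[OF y(1)]] by simp
    then obtain w where w: "w \<in> carrier K" "y = k w" using ses_exact[OF c1 y(1)] by blast
    have "l x = l (g w)" using g(2) w y by simp
    then have "x = g w" using ses_inj[OF c2 x(1) gc[OF w(1)]] by simp
    then show "\<exists>u\<in>carrier K. x = g u" using w(1) by blast
  qed
  then show ?thesis using g(2) h(2) by blast
qed

section \<open>Enough projectives and injectives\<close>

lemma resolvingD:
  assumes "resolving C XX"
  shows "XX \<subseteq> Obj C"
    and "projective_object C P \<Longrightarrow> P \<in> XX"
    and "\<lbrakk>direct_sum C S A B; A \<in> XX; B \<in> XX\<rbrakk> \<Longrightarrow> S \<in> XX"
    and "\<lbrakk>direct_sum C S A B; S \<in> XX\<rbrakk> \<Longrightarrow> A \<in> XX \<and> B \<in> XX"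
    and "\<lbrakk>short_exact C (A, i, B, p, D); A \<in> XX; D \<in> XX\<rbrakk> \<Longrightarrow> B \<in> XX"
    and "\<lbrakk>A \<in> XX; B \<in> XX; epimorphism C A B p; K \<in> Obj C; is_kernel C K i A p B\<rbrakk> \<Longrightarrow> K \<in> XX"
proof -
  note r = assms[unfolded resolving_def subcategory_def]
  show "XX \<subseteq> Obj C" using r by (elim conjE)
  have "{P. projective_object C P} \<subseteq> XX" using r by (elim conjE)
  then show "projective_object C P \<Longrightarrow> P \<in> XX" by auto
  have 3: "\<forall>S A B. direct_sum C S A B \<and> A \<in> XX \<and> B \<in> XX \<longrightarrow> S \<in> XX" using r by (elim conjE)
  show "\<lbrakk>direct_sum C S A B; A \<in> XX; B \<in> XX\<rbrakk> \<Longrightarrow> S \<in> XX"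
    by (rule 3[rule_format, OF conjI, OF _ conjI])
  have 4: "\<forall>S A B. direct_sum C S A B \<and> S \<in> XX \<longrightarrow> A \<in> XX \<and> B \<in> XX" using r by (elim conjE)
  show "\<lbrakk>direct_sum C S A B; S \<in> XX\<rbrakk> \<Longrightarrow> A \<in> XX \<and> B \<in> XX"
    by (rule 4[rule_format, OF conjI])
  have 5: "\<forall>A i B p D. short_exact C (A, i, B, p, D) \<and> A \<in> XX \<and> D \<in> XX \<longrightarrow> B \<in> XX"
    using r by (elim conjE)
  show "\<lbrakk>short_exact C (A, i, B, p, D); A \<in> XX; D \<in> XX\<rbrakk> \<Longrightarrow> B \<in> XX"
    by (rule 5[rule_format, OF conjI, OF _ conjI])
  have 6: "\<forall>K i A B p. A \<in> XX \<and> B \<in> XX \<and> epimorphism C A B p \<and> K \<in> Obj C \<and> is_kernel C K i A p B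
      \<longrightarrow> K \<in> XX" using r by (elim conjE)
  show "\<lbrakk>A \<in> XX; B \<in> XX; epimorphism C A B p; K \<in> Obj C; is_kernel C K i A p B\<rbrakk> \<Longrightarrow> K \<in> XX"
    by (rule 6[rule_format, of A B p K i]) (intro conjI)
qed

locale artin_resolving = artin_alg R \<phi> \<Lambda>
  for R :: "('r, 's) ring_scheme" and \<phi> and \<Lambda> :: "('a, 't) ring_scheme" +
  fixes XX :: "'a rmod set"
  assumes resolving: "resolving (fg_mod \<Lambda>) XX"

sublocale artin_resolving \<subseteq> additive_subcat "fg_mod \<Lambda>" XX
proof
  show "XX \<subseteq> Obj (fg_mod \<Lambda>)" by (rule resolvingD(1)[OF resolving])
  show "Z \<in> XX" if "zero_object (fg_mod \<Lambda>) Z" for Z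
    by (rule resolvingD(2)[OF resolving zero_object_projective[OF that]])
  show "A \<in> XX \<and> B \<in> XX" if "direct_sum (fg_mod \<Lambda>) S A B" "S \<in> XX" for S A B
    by (rule resolvingD(4)[OF resolving that])
qed

context artin_resolving
begin

abbreviation "\<C> \<equiv> fg_mod \<Lambda>"
abbreviation "\<E> \<equiv> exact_subcat (fg_mod \<Lambda>) XX"
abbreviation "\<M> \<equiv> mono_cat (fg_mod \<Lambda>) XX"

lemmas projective_mem = resolvingD(2)[OF resolving]

lemma biproduct_mem: "\<lbrakk>biproduct \<C> S A B i j p q; A \<in> XX; B \<in> XX\<rbrakk> \<Longrightarrow> S \<in> XX"
  using resolvingD(3)[OF resolving, of S A B] unfolding direct_sum_iff by blast

lemma extension_mem: "\<lbrakk>ses \<Lambda> A i B p D; A \<in> XX; D \<in> XX\<rbrakk> \<Longrightarrow> B \<in> XX"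
  by (rule resolvingD(5)[OF resolving ses_short_exact])

lemma kernel_mem:
  assumes "ses \<Lambda> K i A p B" "A \<in> XX" "B \<in> XX"
  shows "K \<in> XX"
proof -
  note se = ses_short_exact[OF assms(1)]
  have "is_kernel \<C> K i A p B" "K \<in> Obj \<C>" using se by (simp_all add: short_exact_def)
  then show ?thesis using resolvingD(6)[OF resolving assms(2,3) short_exact_epi[OF se]] by blast
qed

lemma conflation_subcat:
  "(A, i, B, p, D) \<in> Conflations \<E> \<longleftrightarrow> ses \<Lambda> A i B p D \<and> A \<in> XX \<and> B \<in> XX \<and> D \<in> XX"
  by (simp add: short_exact_iff_ses)

lemma mono_objects_ses:
  "(A, f, B) \<in> mono_objects \<C> XX \<longleftrightarrow> A \<in> XX \<and> B \<in> XX \<and> (\<exists>q. \<exists>Q\<in>XX. ses \<Lambda> A f B q Q)"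
proof
  assume M: "(A, f, B) \<in> mono_objects \<C> XX"
  then obtain Q q where "Q \<in> XX" "is_cokernel \<C> A f B q Q" by (auto simp: mono_objects_def)
  moreover note mono_objectsD[OF M]
  ultimately show "A \<in> XX \<and> B \<in> XX \<and> (\<exists>q. \<exists>Q\<in>XX. ses \<Lambda> A f B q Q)"
    using cokernel_ses[of A B f q Q] obj[of Q] by auto
next
  assume "A \<in> XX \<and> B \<in> XX \<and> (\<exists>q. \<exists>Q\<in>XX. ses \<Lambda> A f B q Q)"
  then obtain q Q where *: "A \<in> XX" "B \<in> XX" "Q \<in> XX" "ses \<Lambda> A f B q Q" by blast
  note se = ses_short_exact[OF *(4)]
  have "is_cokernel \<C> A f B q Q" using se by (simp add: short_exact_def)
  then show "(A, f, B) \<in> mono_objects \<C> XX"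
    using * short_exact_mono[OF se] unfolding mono_objects_def by blast
qed

lemma biproduct_ses:
  assumes b: "biproduct \<C> S A B i j p q"
  shows "ses \<Lambda> A i S q B"
proof -
  note b' = biproduct_arrows[OF b]
  have "Comp \<C> A S A p i = Id \<C> A" using b by (simp only: biproduct_def)
  then have "monomorphism \<C> A S i" using b' by (intro split_mono_monomorphism) auto
  then show ?thesis using biproduct_cokernel[OF b] b' by (intro cokernel_ses) simp_all
qed

lemma surj_ses:
  assumes "f \<in> rmod_hom \<Lambda> A B" "fg_right_module \<Lambda> A" "fg_right_module \<Lambda> B" "f ` carrier A = carrier B"
  shows "\<exists>K k. ses \<Lambda> K k A f B"
proof -
  obtain K :: "'a rmod" and k where "fg_right_module \<Lambda> K" "k \<in> rmod_hom \<Lambda> K A" "inj_on k (carrier K)"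
    "k ` carrier K = {x \<in> carrier A. f x = \<zero>\<^bsub>B\<^esub>}"
    using kernel_exists[OF assms(1-3)] by (elim exE conjE) (rule that)
  then have "ses \<Lambda> K k A f B" using assms by (simp add: ses_def)
  then show ?thesis by blast
qed

lemma inj_ses:
  assumes "f \<in> rmod_hom \<Lambda> A B" "fg_right_module \<Lambda> A" "fg_right_module \<Lambda> B" "inj_on f (carrier A)"
  shows "\<exists>p Q. ses \<Lambda> A f B p Q"
proof -
  obtain Q :: "'a rmod" and p where "fg_right_module \<Lambda> Q" "p \<in> rmod_hom \<Lambda> B Q"
    "p ` carrier B = carrier Q" "{x \<in> carrier B. p x = \<zero>\<^bsub>Q\<^esub>} = f ` carrier A"
    using cokernel_exists[OF assms(1-3)] by (elim exE conjE) (rule that)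
  then have "ses \<Lambda> A f B p Q" using assms by (simp add: ses_def)
  then show ?thesis by blast
qed

lemma conflation_mono_cat:
  assumes c1: "ses \<Lambda> A1 i1 B1 p1 D1" and c2: "ses \<Lambda> A2 i2 B2 p2 D2"
    and f: "f \<in> rmod_hom \<Lambda> A1 A2" and g: "g \<in> rmod_hom \<Lambda> B1 B2" and h: "h \<in> rmod_hom \<Lambda> D1 D2"
    and sq: "\<And>x. x \<in> carrier A1 \<Longrightarrow> g (i1 x) = i2 (f x)" "\<And>x. x \<in> carrier B1 \<Longrightarrow> h (p1 x) = p2 (g x)"
    and mem: "(A1, f, A2) \<in> mono_objects \<C> XX" "(B1, g, B2) \<in> mono_objects \<C> XX"
      "(D1, h, D2) \<in> mono_objects \<C> XX"
  shows "((A1, f, A2), (i1, i2), (B1, g, B2), (p1, p2), (D1, h, D2)) \<in> Conflations \<M>"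
proof -
  have "compose (carrier A1) g i1 = compose (carrier A1) i2 f"
    "compose (carrier B1) h p1 = compose (carrier B1) p2 g"
    using sq by (simp_all add: compose_def cong: restrict_cong)
  then show ?thesis
    using c1 c2 f g h mem by (simp add: short_exact_morphism_cat short_exact_iff_ses)
qed

text \<open>
  Surjections \<open>\<alpha>\<close> from \<open>P\<close> to \<open>A\<close> and \<open>\<delta>\<close> from \<open>P'\<close> to \<open>B\<close> yield \<open>\<beta> = (f \<alpha>, \<delta>)\<close> on
  \<open>S = P \<oplus> P'\<close>. The induced map of cokernels is \<open>\<gamma> = q \<delta>\<close>, again surjective. The kernels of \<open>\<alpha>\<close>,
  \<open>\<beta>\<close> and \<open>\<gamma>\<close> form an exact row in the subcategory, that is, an object of the monomorphism category.
\<close>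

lemma projective_presentation:
  assumes M: "(A, f, B) \<in> mono_objects \<C> XX"
  shows "\<exists>P P' S i j p q e. biproduct \<C> S P P' i j p q \<and> projective_object \<C> P \<and>
    projective_object \<C> P' \<and> admissible_epi \<M> (P, i, S) (A, f, B) e"
proof -
  note M' = mono_objectsD[OF M]
  obtain q Q where Q: "Q \<in> XX" and row: "ses \<Lambda> A f B q Q" using M mono_objects_ses by blast
  note r = sesD[OF row]
  obtain P \<alpha> where P: "projective_object \<C> P" and \<alpha>: "\<alpha> \<in> rmod_hom \<Lambda> P A" "\<alpha> ` carrier P = carrier A"
    using projective_surjection_exists[OF M'(3)] by blast
  obtain P' \<delta> where P': "projective_object \<C> P'" and \<delta>: "\<delta> \<in> rmod_hom \<Lambda> P' B" "\<delta> ` carrier P' = carrier B"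
    using projective_surjection_exists[OF M'(4)] by blast
  have ob: "P \<in> Obj \<C>" "P' \<in> Obj \<C>" "Q \<in> Obj \<C>" using P P' Q obj by (auto simp: projective_object_def)
  obtain S i j p u where b: "biproduct \<C> S P P' i j p u"
    using fg_mod_biproduct_exists[OF ob(1,2)] by blast
  note b' = biproduct_arrows[OF b]
  have SX: "S \<in> XX" using biproduct_mem[OF b] P P' projective_mem by blast
  obtain \<beta> where \<beta>: "\<beta> \<in> Hom \<C> S B" "Comp \<C> P S B \<beta> i = Comp \<C> P A B f \<alpha>" "Comp \<C> P' S B \<beta> j = \<delta>"
    using biproduct_copair[OF b, of "Comp \<C> P A B f \<alpha>" B \<delta>] \<alpha>(1) \<delta>(1) M' ob Comp_in[of \<alpha> P A f B]
    by auto
  define \<gamma> where "\<gamma> = Comp \<C> P' B Q q \<delta>"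
  have \<gamma>: "\<gamma> \<in> Hom \<C> P' Q" unfolding \<gamma>_def using \<delta>(1) r(1,2) ob M' by (intro Comp_in) simp_all
  have q: "q \<in> Hom \<C> B Q" using r(2) by simp
  have qf: "Comp \<C> A B Q q f = Zero \<C> A Q"
    using ses_short_exact[OF row] unfolding short_exact_def is_cokernel_def by blast
  have uij: "Comp \<C> P S P' u i = Zero \<C> P P'" "Comp \<C> P' S P' u j = Id \<C> P'"
    using b by (simp_all only: biproduct_def)
  have "Comp \<C> S P' Q \<gamma> u = Comp \<C> S B Q q \<beta>"
  proof (rule biproduct_jointly_epic[OF b])
    show "Comp \<C> S P' Q \<gamma> u \<in> Hom \<C> S Q" "Comp \<C> S B Q q \<beta> \<in> Hom \<C> S Q"
      using Comp_in \<gamma> b' q \<beta>(1) M'(4) ob by blast+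
    have "Comp \<C> P S Q (Comp \<C> S P' Q \<gamma> u) i = Comp \<C> P P' Q \<gamma> (Comp \<C> P S P' u i)"
      using \<gamma> b' ob by (intro Comp_assoc) auto
    also have "\<dots> = Zero \<C> P Q" unfolding uij by (rule Comp_Zero[OF \<gamma>]) (use ob in auto)
    also have "\<dots> = Comp \<C> P A Q (Comp \<C> A B Q q f) \<alpha>"
      unfolding qf using Zero_Comp[of \<alpha> P A Q] \<alpha>(1) M' ob by simp
    also have "\<dots> = Comp \<C> P B Q q (Comp \<C> P A B f \<alpha>)"
      using \<alpha>(1) M' q ob by (intro Comp_assoc) auto
    also have "\<dots> = Comp \<C> P S Q (Comp \<C> S B Q q \<beta>) i"
      unfolding \<beta>(2)[symmetric] using \<beta>(1) M' q ob b' by (intro Comp_assoc[symmetric]) auto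
    finally show "Comp \<C> P S Q (Comp \<C> S P' Q \<gamma> u) i = Comp \<C> P S Q (Comp \<C> S B Q q \<beta>) i" .
    have "Comp \<C> P' S Q (Comp \<C> S P' Q \<gamma> u) j = Comp \<C> P' P' Q \<gamma> (Comp \<C> P' S P' u j)"
      using \<gamma> b' ob by (intro Comp_assoc) auto
    also have "\<dots> = Comp \<C> P' B Q q (Comp \<C> P' S B \<beta> j)"
      unfolding uij \<beta>(3) \<gamma>_def[symmetric] using \<gamma> ob by (intro Comp_Id) auto
    also have "\<dots> = Comp \<C> P' S Q (Comp \<C> S B Q q \<beta>) j"
      using \<beta>(1) M' q ob b' by (intro Comp_assoc[symmetric]) auto
    finally show "Comp \<C> P' S Q (Comp \<C> S P' Q \<gamma> u) j = Comp \<C> P' S Q (Comp \<C> S B Q q \<beta>) j" .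
  qed (rule ob)
  then have sq2: "\<gamma> (u x) = q (\<beta> x)" if "x \<in> carrier S" for x
    using that compose_eqD[of "carrier S" \<gamma> u "compose (carrier S) q \<beta>" x] by (simp add: compose_eq)
  have sq1: "\<beta> (i x) = f (\<alpha> x)" if "x \<in> carrier P" for x
    using that compose_eqD[of "carrier P" \<beta> i "compose (carrier P) f \<alpha>" x] \<beta>(2) by (simp add: compose_eq)
  have \<beta>j: "\<beta> (j x) = \<delta> x" if "x \<in> carrier P'" for x
    using that compose_eqD[of "carrier P'" \<beta> j \<delta> x] \<beta>(3) by simp
  have jc: "j x \<in> carrier S" if "x \<in> carrier P'" for x
    using that b' rmod_hom_closed[of j \<Lambda> P' S x] by simp
  have \<beta>c: "\<beta> x \<in> carrier B" if "x \<in> carrier S" for x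
    using that \<beta>(1) rmod_hom_closed[of \<beta> \<Lambda> S B x] by simp
  have \<beta>s: "\<beta> ` carrier S = carrier B"
  proof
    show "carrier B \<subseteq> \<beta> ` carrier S"
    proof
      fix y assume "y \<in> carrier B"
      then obtain x where "x \<in> carrier P'" "y = \<delta> x" using \<delta>(2) by auto
      then have "y = \<beta> (j x)" "j x \<in> carrier S" using \<beta>j jc by auto
      then show "y \<in> \<beta> ` carrier S" by (rule image_eqI)
    qed
  qed (use \<beta>c in auto)
  have \<gamma>s: "\<gamma> ` carrier P' = carrier Q"
  proof -
    have "\<gamma> ` carrier P' = q ` (\<delta> ` carrier P')"
      unfolding \<gamma>_def image_image by (intro image_cong) (simp_all add: compose_eq)
    also have "\<dots> = carrier Q" using \<delta>(2) row by (simp add: ses_def)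
    finally show ?thesis .
  qed
  have fgs: "fg_right_module \<Lambda> P" "fg_right_module \<Lambda> P'" "fg_right_module \<Lambda> S"
    "fg_right_module \<Lambda> A" "fg_right_module \<Lambda> B" "fg_right_module \<Lambda> Q"
    using ob b' M'(3,4) by simp_all
  obtain K k where c1: "ses \<Lambda> K k P \<alpha> A" using surj_ses[OF \<alpha>(1) fgs(1,4) \<alpha>(2)] by blast
  obtain L l where c2: "ses \<Lambda> L l S \<beta> B" using surj_ses[OF _ fgs(3,5) \<beta>s] \<beta>(1) by auto
  obtain N n where c3: "ses \<Lambda> N n P' \<gamma> Q" using surj_ses[OF _ fgs(2,6) \<gamma>s] \<gamma> by auto
  obtain g h where gh: "\<forall>x\<in>carrier K. l (g x) = i (k x)" "ses \<Lambda> K g L h N"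
    using kernel_row_exact[OF biproduct_ses[OF b] row c1 c2 c3 sq1 sq2] by blast
  have KX: "K \<in> XX" using kernel_mem[OF c1] projective_mem[OF P] M'(1) by blast
  have LX: "L \<in> XX" using kernel_mem[OF c2] SX M'(2) by blast
  have NX: "N \<in> XX" using kernel_mem[OF c3] projective_mem[OF P'] Q by blast
  have "((K, g, L), (k, l), (P, i, S), (\<alpha>, \<beta>), (A, f, B)) \<in> Conflations \<M>"
  proof (rule conflation_mono_cat[OF c1 c2])
    show "(K, g, L) \<in> mono_objects \<C> XX" using gh(2) KX LX NX mono_objects_ses by blast
    show "(P, i, S) \<in> mono_objects \<C> XX"
      by (rule mono_objects_biproduct[OF b projective_mem[OF P] SX])
  qed (use gh sq1 r sesD(1)[OF gh(2)] b' M in auto)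
  then show ?thesis using b P P' unfolding admissible_epi_def by blast
qed

text \<open>
  A map into \<open>(0 \<rightarrow> I)\<close> kills the domain, so it factors through the cokernel. Conflations
  induce inflations on cokernels, along which the factorisation extends.
\<close>

lemma exact_injective_Zero:
  assumes I: "exact_injective \<E> I" and Z: "zero_object \<C> Z"
  shows "exact_injective \<M> (Z, Zero \<C> Z I, I)"
  unfolding exact_injective_def
proof (intro conjI allI impI, goal_cases)
  case 1
  then show ?case using mono_objects_Zero[OF Z] I by (simp add: exact_injective_def)
next
  case (2 M N i t)
  have IX: "I \<in> XX" "I \<in> Obj \<C>" using I obj by (auto simp only: exact_injective_def exact_subcat_simps)
  obtain A1 f A2 where M: "M = (A1, f, A2)" by (metis prod_cases3)
  obtain B1 g B2 where N: "N = (B1, g, B2)" by (metis prod_cases3)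
  obtain i1 i2 where i: "i = (i1, i2)" by fastforce
  obtain t1 t2 where t: "t = (t1, t2)" by fastforce
  obtain D1 h D2 p1 p2 where se: "short_exact (morphism_cat \<C>) (M, i, N, (p1, p2), (D1, h, D2))"
    and mem: "M \<in> mono_objects \<C> XX" "N \<in> mono_objects \<C> XX" "(D1, h, D2) \<in> mono_objects \<C> XX"
    using 2 unfolding admissible_mono_def by auto
  note sq = se[unfolded M N i short_exact_morphism_cat short_exact_iff_ses]
  note mM = mem(1)[unfolded M] and mN = mem(2)[unfolded N]
  note M' = mono_objectsD[OF mM] and N' = mono_objectsD[OF mN] and D' = mono_objectsD[OF mem(3)]
  obtain a QA where QA: "QA \<in> XX" and cA: "ses \<Lambda> A1 f A2 a QA" using mM mono_objects_ses by blast
  obtain b QB where QB: "QB \<in> XX" and cB: "ses \<Lambda> B1 g B2 b QB" using mN mono_objects_ses by blast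
  obtain c QD where QD: "QD \<in> XX" and cD: "ses \<Lambda> D1 h D2 c QD" using mem(3) mono_objects_ses by blast
  have top: "ses \<Lambda> A1 i1 B1 p1 D1" and bot: "ses \<Lambda> A2 i2 B2 p2 D2" using sq by simp_all
  have sq1: "g (i1 x) = i2 (f x)" if "x \<in> carrier A1" for x
    using sq that compose_eqD[of "carrier A1" g i1 "compose (carrier A1) i2 f" x] by (simp add: compose_eq)
  have sq2: "h (p1 x) = p2 (g x)" if "x \<in> carrier B1" for x
    using sq that compose_eqD[of "carrier B1" h p1 "compose (carrier B1) p2 g" x] by (simp add: compose_eq)
  obtain f'' q'' where f'': "\<forall>x\<in>carrier A2. f'' (a x) = b (i2 x)" and row: "ses \<Lambda> QA f'' QB q'' QD"
    using cokernel_row_exact[OF top bot cA cB cD sq1 sq2] by blast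
  have adm: "admissible_mono \<E> QA QB f''"
    using row QA QB QD conflation_subcat unfolding admissible_mono_def by blast
  have t': "t1 \<in> Hom \<C> A1 Z" "t2 \<in> Hom \<C> A2 I" "Comp \<C> A1 Z I (Zero \<C> Z I) t1 = Comp \<C> A1 A2 I t2 f"
    using 2 unfolding M t by (simp_all only: mono_cat_simps morphism_cat_simps)
  then have "Comp \<C> A1 A2 I t2 f = Zero \<C> A1 I"
    using Zero_Comp[OF t'(1) M'(3) zero_object_in[OF Z] IX(2)] by metis
  moreover have "is_cokernel \<C> A1 f A2 a QA"
    using ses_short_exact[OF cA] by (simp only: short_exact_def prod.case)
  ultimately obtain t'' where t'': "t'' \<in> Hom \<C> QA I" "Comp \<C> A2 QA I t'' a = t2"
    using is_cokernelE t'(2) IX(2) by metis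
  obtain s where s: "s \<in> Hom \<E> QB I" "Comp \<E> QA QB I s f'' = t''"
    using exact_injectiveD[OF I adm, of t''] t''(1) by (auto simp only: exact_subcat_simps)
  have ts: "s (f'' x) = t'' x" if "x \<in> carrier QA" for x
    using that compose_eqD[of "carrier QA" s f'' t'' x] s(2) by simp
  have ta: "t'' (a x) = t2 x" if "x \<in> carrier A2" for x
    using that compose_eqD[of "carrier A2" t'' a t2 x] t''(2) by simp
  note dA = sesD[OF cA] and dB = sesD[OF cB] and dr = sesD[OF bot]
  have rI: "right_module \<Lambda> I" using IX(2) by (simp add: fg_right_moduleD)
  have s': "s \<in> rmod_hom \<Lambda> QB I" using s(1) by simp
  let ?v = "compose (carrier B2) s b"
  have v: "?v \<in> rmod_hom \<Lambda> B2 I" by (rule rmod_hom_Comp[OF dB(2) s' dB(4)])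
  have "compose (carrier A2) ?v i2 = t2"
  proof (subst compose_eq_iff[OF dr(1) v _ dA(4)])
    show "t2 \<in> rmod_hom \<Lambda> A2 I" using t'(2) by simp
    show "\<forall>x\<in>carrier A2. ?v (i2 x) = t2 x"
    proof
      fix x assume x: "x \<in> carrier A2"
      have "?v (i2 x) = s (f'' (a x))" using x dr(6) f'' by (simp add: compose_eq)
      then show "?v (i2 x) = t2 x" using x ts[OF dA(7)[OF x]] ta by simp
    qed
  qed
  moreover have "t1 = Zero \<C> A1 Z" using Hom_to_zero[OF Z t'(1)] M'(3) by blast
  moreover have "Comp \<C> A1 B1 Z (Zero \<C> B1 Z) i1 = Zero \<C> A1 Z"
    using sesD(1)[OF top] M' N' zero_object_in[OF Z] by (intro Zero_Comp) simp_all
  moreover have "Comp \<C> B1 Z I (Zero \<C> Z I) (Zero \<C> B1 Z) = Comp \<C> B1 B2 I ?v g"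
  proof -
    have "Comp \<C> B1 Z I (Zero \<C> Z I) (Zero \<C> B1 Z) = Zero \<C> B1 I"
      using N' zero_object_in[OF Z] IX by (intro Comp_Zero Zero_in) auto
    moreover have "?v (g x) = \<zero>\<^bsub>I\<^esub>" if "x \<in> carrier B1" for x
      using that dB(6,8) rmod_hom_zero[OF s' dB(5) rI] by (simp add: compose_eq)
    then have "compose (carrier B1) ?v g = (\<lambda>x\<in>carrier B1. \<zero>\<^bsub>I\<^esub>)"
      by (simp add: compose_eq_iff[OF dB(1) v rmod_hom_Zero[OF dB(3) rI] dB(3)])
    ultimately show ?thesis by simp
  qed
  moreover have "Zero \<C> B1 Z \<in> Hom \<C> B1 Z" using N' zero_object_in[OF Z] by (intro Zero_in) auto
  ultimately show ?case
    using v unfolding M N i t mono_cat_simps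
    by (intro bexI[of _ "(Zero \<C> B1 Z, ?v)"])
      (simp_all only: morphism_cat_simps fg_mod_simps prod.inject simp_thms)
qed

text \<open>
  \<open>\<alpha>\<close> and \<open>\<gamma>\<close> embed \<open>A\<close> and its cokernel \<open>Q\<close> into injectives. As \<open>f\<close> is an inflation, \<open>\<alpha>\<close>
  extends to \<open>e\<close> on \<open>B\<close>. The map \<open>\<beta> = (e, \<gamma> q)\<close> from \<open>B\<close> to \<open>S = I \<oplus> J\<close> is injective: an element
  killed by \<open>\<gamma> q\<close> comes from \<open>A\<close>, and on \<open>A\<close> the map \<open>e\<close> is the injective \<open>\<alpha>\<close>.
\<close>

lemma injective_copresentation:
  assumes M: "(A, f, B) \<in> mono_objects \<C> XX" and enough: "enough_injectives \<E>"
  shows "\<exists>I J S i j p q e. biproduct \<C> S I J i j p q \<and> exact_injective \<E> I \<and>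
    exact_injective \<E> J \<and> admissible_mono \<M> (A, f, B) (I, i, S) e"
proof -
  note M' = mono_objectsD[OF M]
  obtain q Q where Q: "Q \<in> XX" and row: "ses \<Lambda> A f B q Q" using M mono_objects_ses by blast
  note r = sesD[OF row]
  have "\<exists>I i. exact_injective \<E> I \<and> admissible_mono \<E> V I i" if "V \<in> XX" for V
    using enough that unfolding enough_injectives_def exact_subcat_simps by blast
  then obtain I \<alpha> J \<gamma> where I: "exact_injective \<E> I" and \<alpha>: "admissible_mono \<E> A I \<alpha>"
    and J: "exact_injective \<E> J" and \<gamma>: "admissible_mono \<E> Q J \<gamma>"
    using M'(1) Q by metis
  obtain a A'' where c1: "ses \<Lambda> A \<alpha> I a A''" and mem1: "I \<in> XX" "A'' \<in> XX"
    using \<alpha> conflation_subcat unfolding admissible_mono_def by blast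
  obtain c Q'' where c3: "ses \<Lambda> Q \<gamma> J c Q''" and mem3: "J \<in> XX" "Q'' \<in> XX"
    using \<gamma> conflation_subcat unfolding admissible_mono_def by blast
  note d1 = sesD[OF c1] and d3 = sesD[OF c3]
  have "admissible_mono \<E> A B f"
    using row M' Q conflation_subcat unfolding admissible_mono_def by blast
  then obtain e where e: "e \<in> rmod_hom \<Lambda> B I" "Comp \<C> A B I e f = \<alpha>"
    using exact_injectiveD[OF I, of A B f \<alpha>] d1(1) by auto
  have ob: "I \<in> Obj \<C>" "J \<in> Obj \<C>" "Q \<in> Obj \<C>" using mem1 mem3 Q by (auto simp del: fg_mod_simps)
  obtain S i j p u where b: "biproduct \<C> S I J i j p u"
    using fg_mod_biproduct_exists[OF ob(1,2)] by blast
  note b' = biproduct_arrows[OF b]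
  have SX: "S \<in> XX" using biproduct_mem[OF b mem1(1) mem3(1)] .
  have "Comp \<C> B Q J \<gamma> q \<in> Hom \<C> B J" using r(2) d3(1) ob M' by (intro Comp_in) simp_all
  then obtain \<beta> where \<beta>: "\<beta> \<in> Hom \<C> B S" "Comp \<C> B S I p \<beta> = e" "Comp \<C> B S J u \<beta> = Comp \<C> B Q J \<gamma> q"
    using biproduct_pair[OF b, of e B "Comp \<C> B Q J \<gamma> q"] e(1) M'(4) by auto
  note row2 = biproduct_ses[OF b]
  note o = sesD[OF row2]
  have pr: "p \<in> rmod_hom \<Lambda> S I" "u \<in> rmod_hom \<Lambda> S J" using b' by simp_all
  have \<beta>h: "\<beta> \<in> rmod_hom \<Lambda> B S" using \<beta>(1) by simp
  note \<beta>c = rmod_hom_closed[OF \<beta>h]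
  have p\<beta>: "p (\<beta> x) = e x" if "x \<in> carrier B" for x
    using that compose_eqD[of "carrier B" p \<beta> e x] \<beta>(2) by simp
  have u\<beta>: "\<gamma> (q x) = u (\<beta> x)" if "x \<in> carrier B" for x
    using that compose_eqD[of "carrier B" u \<beta> "compose (carrier B) \<gamma> q" x] \<beta>(3) by (simp add: compose_eq)
  have ef: "e (f x) = \<alpha> x" if "x \<in> carrier A" for x
    using that compose_eqD[of "carrier A" e f \<alpha> x] e(2) by simp
  have pi: "p (i x) = x" if "x \<in> carrier I" for x
  proof -
    have "Comp \<C> I S I p i = Id \<C> I" using b by (simp only: biproduct_def)
    then show ?thesis using that compose_eqD[of "carrier I" p i "\<lambda>x\<in>carrier I. x" x] by simp
  qed
  have "Comp \<C> A B S \<beta> f = Comp \<C> A I S i \<alpha>"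
  proof (rule biproduct_jointly_monic[OF b])
    have fh: "f \<in> rmod_hom \<Lambda> A B" and \<alpha>h: "\<alpha> \<in> rmod_hom \<Lambda> A I" and ih: "i \<in> rmod_hom \<Lambda> I S"
      by (rule r(1), rule d1(1), rule o(1))
    show h1: "Comp \<C> A B S \<beta> f \<in> Hom \<C> A S" and h2: "Comp \<C> A I S i \<alpha> \<in> Hom \<C> A S"
      using rmod_hom_Comp[OF fh \<beta>h r(3)] rmod_hom_Comp[OF \<alpha>h ih r(3)] by simp_all
    have "p (compose (carrier A) \<beta> f x) = p (compose (carrier A) i \<alpha> x)" if "x \<in> carrier A" for x
      using that r(6) d1(6) p\<beta> pi ef by (simp add: compose_eq)
    then show "Comp \<C> A S I p (Comp \<C> A B S \<beta> f) = Comp \<C> A S I p (Comp \<C> A I S i \<alpha>)"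
      by (simp add: compose_def[of _ p] cong: restrict_cong)
    have "u (compose (carrier A) \<beta> f x) = u (compose (carrier A) i \<alpha> x)" if "x \<in> carrier A" for x
      using that r(6,8) d1(6) u\<beta>[symmetric] o(8) rmod_hom_zero[OF d3(1,3,4)] by (simp add: compose_eq)
    then show "Comp \<C> A S J u (Comp \<C> A B S \<beta> f) = Comp \<C> A S J u (Comp \<C> A I S i \<alpha>)"
      by (simp add: compose_def[of _ u] cong: restrict_cong)
  qed (rule M')
  then have sq1: "\<beta> (f x) = i (\<alpha> x)" if "x \<in> carrier A" for x
    using that compose_eqD[of "carrier A" \<beta> f "compose (carrier A) i \<alpha>" x] by (simp add: compose_eq)
  have "inj_on \<beta> (carrier B)"
  proof (rule inj_onI)
    fix x y assume xy: "x \<in> carrier B" "y \<in> carrier B" "\<beta> x = \<beta> y"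
    interpret B: right_module \<Lambda> B by (rule r(4))
    interpret I: right_module \<Lambda> I by (rule d1(4))
    have "\<gamma> (q x) = \<gamma> (q y)" using u\<beta> xy by simp
    then have "q x = q y" using ses_inj[OF c3 r(7) r(7)] xy by simp
    then have "q (x \<ominus>\<^bsub>B\<^esub> y) = \<zero>\<^bsub>Q\<^esub>"
      using xy r(7) by (simp add: rmod_hom_minus[OF r(2,4,5)] right_module.minus_eq_zero_iff[OF r(5)])
    then obtain z where z: "z \<in> carrier A" "x \<ominus>\<^bsub>B\<^esub> y = f z"
      using ses_exact[OF row B.M.minus_closed[OF xy(1,2)]] by blast
    have "e x = e y" using p\<beta>[symmetric] xy by simp
    then have "e (x \<ominus>\<^bsub>B\<^esub> y) = \<zero>\<^bsub>I\<^esub>"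
      using xy rmod_hom_closed[OF e(1)] by (simp add: rmod_hom_minus[OF e(1) r(4) d1(4)])
    then have "\<alpha> z = \<alpha> \<zero>\<^bsub>A\<^esub>" using ef z rmod_hom_zero[OF d1(1,3,4)] by simp
    moreover have "\<zero>\<^bsub>A\<^esub> \<in> carrier A" using rsubmodD(2)[OF right_module.rsubmod_carrier[OF r(3)]] .
    ultimately have "z = \<zero>\<^bsub>A\<^esub>" using ses_inj[OF c1 z(1)] by blast
    then have "x \<ominus>\<^bsub>B\<^esub> y = \<zero>\<^bsub>B\<^esub>" using z rmod_hom_zero[OF r(1,3,4)] by simp
    then show "x = y" using xy by simp
  qed
  then obtain b0 B'' where c2: "ses \<Lambda> B \<beta> S b0 B''"
    using inj_ses[OF \<beta>h] M'(4) b' by auto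
  obtain f'' q'' where f'': "\<forall>x\<in>carrier I. f'' (a x) = b0 (i x)" and row'': "ses \<Lambda> A'' f'' B'' q'' Q''"
    using cokernel_row_exact[OF row row2 c1 c2 c3 sq1 u\<beta>] by blast
  have BX: "B'' \<in> XX" using extension_mem[OF row'' mem1(2) mem3(2)] .
  have "((A, f, B), (\<alpha>, \<beta>), (I, i, S), (a, b0), (A'', f'', B'')) \<in> Conflations \<M>"
  proof (rule conflation_mono_cat[OF c1 c2 r(1) o(1) sesD(1)[OF row'']])
    show "(I, i, S) \<in> mono_objects \<C> XX" by (rule mono_objects_biproduct[OF b mem1(1) SX])
    show "(A'', f'', B'') \<in> mono_objects \<C> XX" using row'' mem1(2) mem3(2) BX mono_objects_ses by blast
  qed (use sq1 f'' M in auto)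
  then show ?thesis using b I J unfolding admissible_mono_def by blast
qed

lemma enough_projectives_mono_cat: "enough_projectives \<M>"
  unfolding enough_projectives_def mono_cat_simps
proof
  fix M assume M: "M \<in> mono_objects \<C> XX"
  obtain A f B where M': "M = (A, f, B)" by (metis prod_cases3)
  obtain P P' S i j p q e where b: "biproduct \<C> S P P' i j p q" and P: "projective_object \<C> P"
    "projective_object \<C> P'" and e: "admissible_epi \<M> (P, i, S) M e"
    using projective_presentation M unfolding M' by metis
  obtain Z where Z: "zero_object \<C> Z" using zero_exists by blast
  have "S \<in> XX" using biproduct_mem[OF b] P projective_mem by blast
  then have "(P, i, S) \<in> mono_objects \<C> XX"
    using mono_objects_biproduct[OF b projective_mem[OF P(1)]] by blast
  then have "exact_projective \<M> (P, i, S)"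
    using mono.biproduct_exact_projective[OF biproduct_split_mono[OF _ b Z]]
      exact_projective_Id[OF P(1) projective_mem[OF P(1)]]
      exact_projective_Zero[OF P(2) projective_mem[OF P(2)] Z] by blast
  then show "\<exists>P p. exact_projective \<M> P \<and> admissible_epi \<M> P M p" using e by blast
qed

lemma enough_injectives_mono_cat:
  assumes "enough_injectives \<E>"
  shows "enough_injectives \<M>"
  unfolding enough_injectives_def mono_cat_simps
proof
  fix M assume M: "M \<in> mono_objects \<C> XX"
  obtain A f B where M': "M = (A, f, B)" by (metis prod_cases3)
  obtain I J S i j p q e where b: "biproduct \<C> S I J i j p q" and I: "exact_injective \<E> I"
    "exact_injective \<E> J" and e: "admissible_mono \<M> M (I, i, S) e"
    using injective_copresentation assms M unfolding M' by metis
  obtain Z where Z: "zero_object \<C> Z" using zero_exists by blast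
  have mem: "I \<in> XX" "J \<in> XX" using I by (simp_all add: exact_injective_def)
  then have "S \<in> XX" using biproduct_mem[OF b] by blast
  then have "(I, i, S) \<in> mono_objects \<C> XX" using mono_objects_biproduct[OF b mem(1)] by blast
  then have "exact_injective \<M> (I, i, S)"
    using mono.biproduct_exact_injective[OF biproduct_split_mono[OF _ b Z]]
      exact_injective_Id[OF I(1)] exact_injective_Zero[OF I(2) Z] by blast
  then show "\<exists>I i. exact_injective \<M> I \<and> admissible_mono \<M> M I i" using e by blast
qed

section \<open>The indecomposable projective and injective objects\<close>

lemma indecomposable_projective_iff:
  assumes M: "(A, f, B) \<in> mono_objects \<C> XX"
  shows "indecomposable \<M> (A, f, B) \<and> exact_projective \<M> (A, f, B) \<longleftrightarrow>
    (\<exists>P. indecomposable \<C> P \<and> projective_object \<C> P \<and>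
      (isomorphic \<M> (A, f, B) (P, Id \<C> P, P) \<or>
       (\<exists>Z. zero_object \<C> Z \<and> isomorphic \<M> (A, f, B) (Z, Zero \<C> Z P, P))))" (is "?l \<longleftrightarrow> ?r")
proof
  assume l: ?l
  note M' = mono_objectsD[OF M]
  obtain P P' S i j p q e where b: "biproduct \<C> S P P' i j p q" and P: "projective_object \<C> P"
    "projective_object \<C> P'" and e: "admissible_epi \<M> (P, i, S) (A, f, B) e"
    using projective_presentation[OF M] by metis
  have "retract \<M> (A, f, B) (P, i, S)" using mono.exact_projective_retract l e by blast
  from indecomposable_retract_cases[OF conjunct1[OF l] this b] show ?r
  proof
    assume "indecomposable \<E> A \<and> retract \<C> A P \<and> isomorphic \<M> (A, f, B) (A, Id \<C> A, A)"
    then show ?r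
      using retract_projective_object[OF _ P(1)] indecomposable_subcat[OF M'(1)] by blast
  next
    assume B: "zero_object \<C> A \<and> f = Zero \<C> A B \<and> indecomposable \<E> B \<and> retract \<C> B P'"
    have "isomorphic \<M> (A, f, B) (A, f, B)" using M by (intro mono.isomorphic_refl) simp
    then show ?r
      using B retract_projective_object[OF _ P(2)] indecomposable_subcat[OF M'(2)] by blast
  qed
next
  assume ?r
  then obtain P where P: "indecomposable \<C> P" "projective_object \<C> P"
    and iso: "isomorphic \<M> (A, f, B) (P, Id \<C> P, P) \<or>
       (\<exists>Z. zero_object \<C> Z \<and> isomorphic \<M> (A, f, B) (Z, Zero \<C> Z P, P))" by blast
  note PX = projective_mem[OF P(2)]
  have ind: "indecomposable \<E> P" using P(1) indecomposable_subcat[OF PX] by blast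
  obtain K where "isomorphic \<M> (A, f, B) K" "indecomposable \<M> K" "exact_projective \<M> K"
    using iso
  proof
    assume "isomorphic \<M> (A, f, B) (P, Id \<C> P, P)"
    then show thesis
      using that indecomposable_codomain[OF mono_objects_Id[OF PX] ind] exact_projective_Id[OF P(2) PX]
      by blast
  next
    assume "\<exists>Z. zero_object \<C> Z \<and> isomorphic \<M> (A, f, B) (Z, Zero \<C> Z P, P)"
    then obtain Z where Z: "zero_object \<C> Z" "isomorphic \<M> (A, f, B) (Z, Zero \<C> Z P, P)" by blast
    show thesis
      using that[OF Z(2) indecomposable_codomain[OF mono_objects_Zero[OF Z(1) PX] ind]
          exact_projective_Zero[OF P(2) PX Z(1)]] .
  qed
  then show ?l
    using mono.indecomposable_iso[OF isomorphic_sym] mono.retract_exact_projective[OF isomorphic_retract]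
    by blast
qed

lemma indecomposable_injective_iff:
  assumes M: "(A, f, B) \<in> mono_objects \<C> XX" and enough: "enough_injectives \<E>"
  shows "indecomposable \<M> (A, f, B) \<and> exact_injective \<M> (A, f, B) \<longleftrightarrow>
    (\<exists>I. indecomposable \<E> I \<and> exact_injective \<E> I \<and>
      (isomorphic \<M> (A, f, B) (I, Id \<C> I, I) \<or>
       (\<exists>Z. zero_object \<C> Z \<and> isomorphic \<M> (A, f, B) (Z, Zero \<C> Z I, I))))" (is "?l \<longleftrightarrow> ?r")
proof
  assume l: ?l
  note M' = mono_objectsD[OF M]
  obtain I J S i j p q e where b: "biproduct \<C> S I J i j p q" and I: "exact_injective \<E> I"
    "exact_injective \<E> J" and e: "admissible_mono \<M> (A, f, B) (I, i, S) e"
    using injective_copresentation[OF M enough] by metis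
  have mem: "I \<in> XX" "J \<in> XX" using I by (simp_all add: exact_injective_def)
  have sub: "retract \<E> V W" if "retract \<C> V W" "V \<in> XX" "W \<in> XX" for V W
    using that by (simp add: retract_def)
  have "retract \<M> (A, f, B) (I, i, S)" using mono.exact_injective_retract l e by blast
  from indecomposable_retract_cases[OF conjunct1[OF l] this b] show ?r
  proof
    assume A: "indecomposable \<E> A \<and> retract \<C> A I \<and> isomorphic \<M> (A, f, B) (A, Id \<C> A, A)"
    then have "exact_injective \<E> A"
      using sub.retract_exact_injective[OF sub I(1)] M'(1) mem(1) by blast
    then show ?r using A by blast
  next
    assume B: "zero_object \<C> A \<and> f = Zero \<C> A B \<and> indecomposable \<E> B \<and> retract \<C> B J"
    then have "exact_injective \<E> B"
      using sub.retract_exact_injective[OF sub I(2)] M'(2) mem(2) by blast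
    moreover have "isomorphic \<M> (A, f, B) (A, f, B)" using M by (intro mono.isomorphic_refl) simp
    ultimately show ?r using B by blast
  qed
next
  assume ?r
  then obtain I where I: "indecomposable \<E> I" "exact_injective \<E> I"
    and iso: "isomorphic \<M> (A, f, B) (I, Id \<C> I, I) \<or>
       (\<exists>Z. zero_object \<C> Z \<and> isomorphic \<M> (A, f, B) (Z, Zero \<C> Z I, I))" by blast
  have IX: "I \<in> XX" using I(2) by (simp add: exact_injective_def)
  obtain K where "isomorphic \<M> (A, f, B) K" "indecomposable \<M> K" "exact_injective \<M> K"
    using iso
  proof
    assume "isomorphic \<M> (A, f, B) (I, Id \<C> I, I)"
    then show thesis
      using that indecomposable_codomain[OF mono_objects_Id[OF IX] I(1)] exact_injective_Id[OF I(2)]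
      by blast
  next
    assume "\<exists>Z. zero_object \<C> Z \<and> isomorphic \<M> (A, f, B) (Z, Zero \<C> Z I, I)"
    then obtain Z where Z: "zero_object \<C> Z" "isomorphic \<M> (A, f, B) (Z, Zero \<C> Z I, I)" by blast
    show thesis
      using that[OF Z(2) indecomposable_codomain[OF mono_objects_Zero[OF Z(1) IX] I(1)]
          exact_injective_Zero[OF I(2) Z(1)]] .
  qed
  then show ?l
    using mono.indecomposable_iso[OF isomorphic_sym] mono.retract_exact_injective[OF isomorphic_retract]
    by blast
qed

end

theorem proposition3p1:
  fixes R :: "'r ring" and \<phi> :: "'r \<Rightarrow> 'a" and \<Lambda> :: "'a ring"
    and XX :: "'a rmod set"
  assumes "artin_algebra R \<phi> \<Lambda>"
    and "resolving (fg_mod \<Lambda>) XX"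
    and "contravariantly_finite (fg_mod \<Lambda>) XX"
  shows
    "(\<forall>(A, f, B) \<in> Obj (mono_cat (fg_mod \<Lambda>) XX).
        indecomposable (mono_cat (fg_mod \<Lambda>) XX) (A, f, B) \<and>
        exact_projective (mono_cat (fg_mod \<Lambda>) XX) (A, f, B) \<longleftrightarrow>
        (\<exists>P. indecomposable (fg_mod \<Lambda>) P \<and> projective_object (fg_mod \<Lambda>) P \<and>
           (isomorphic (mono_cat (fg_mod \<Lambda>) XX) (A, f, B) (P, Id (fg_mod \<Lambda>) P, P) \<or>
            (\<exists>Z. zero_object (fg_mod \<Lambda>) Z \<and>
               isomorphic (mono_cat (fg_mod \<Lambda>) XX) (A, f, B) (Z, Zero (fg_mod \<Lambda>) Z P, P))))) \<and>
     (enough_injectives (exact_subcat (fg_mod \<Lambda>) XX) \<longrightarrow>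
       (\<forall>(A, f, B) \<in> Obj (mono_cat (fg_mod \<Lambda>) XX).
          indecomposable (mono_cat (fg_mod \<Lambda>) XX) (A, f, B) \<and>
          exact_injective (mono_cat (fg_mod \<Lambda>) XX) (A, f, B) \<longleftrightarrow>
          (\<exists>I. indecomposable (exact_subcat (fg_mod \<Lambda>) XX) I \<and>
             exact_injective (exact_subcat (fg_mod \<Lambda>) XX) I \<and>
             (isomorphic (mono_cat (fg_mod \<Lambda>) XX) (A, f, B) (I, Id (fg_mod \<Lambda>) I, I) \<or>
              (\<exists>Z. zero_object (fg_mod \<Lambda>) Z \<and>
                 isomorphic (mono_cat (fg_mod \<Lambda>) XX) (A, f, B) (Z, Zero (fg_mod \<Lambda>) Z I, I)))))) \<and>
     enough_projectives (mono_cat (fg_mod \<Lambda>) XX) \<and>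
     (enough_injectives (exact_subcat (fg_mod \<Lambda>) XX) \<longrightarrow>
       enough_injectives (mono_cat (fg_mod \<Lambda>) XX))"
proof -
  interpret artin_resolving R \<phi> \<Lambda> XX
    using assms(1,2) by unfold_locales
  show ?thesis
    by (intro conjI impI ballI case_prodI2 enough_projectives_mono_cat enough_injectives_mono_cat;
        (rule indecomposable_projective_iff indecomposable_injective_iff)?;
        simp only: mono_cat_simps)
qed

end
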